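(* Let $d\ge 1$ and let $\Omega\subset\mathbb{R}^d$ be a bounded open set. The space $H^{1/2}(\partial\Omega)=\{{\rm tr}(u):u\in H^1_{\rm tr}(\Omega)\}$ is a Hilbert space with the scalar product $$\langle g,\widetilde g\rangle_{H^{1/2}}=\langle\Psi(g),\Psi(\widetilde g)\rangle_{H^1},$$ where, for $g\in H^{1/2}(\partial\Omega)$, $\Psi(g)$ is the unique $u\in H^1_{\rm tr}(\Omega)$ such that ${\rm tr}(u)=g$ and $\int_\Omega\nabla u\cdot\nabla w\,dx=0$ for all $w\in H^1_{{\rm tr},0}(\Omega)=\{w\in H^1_{\rm tr}(\Omega):{\rm tr}(w)=0\}$.
   Context: $\partial\Omega=\overline{\Omega}\setminus\Omega$; $\mathbb{S}^{d-1}$ is the Euclidean unit sphere; $]a,b[$ denotes the open real interval. $\langle u,v\rangle_{H^1}=\int_\Omega(uv+\nabla u\cdot\nabla v)\,dx$. For $\theta\in\mathbb{S}^{d-1}$, $W_\theta(\Omega)$ is the set of $u\in L^2(\Omega)$ whose weak derivative $\partial_\theta u$ in direction $\theta$ is in $L^2(\Omega)$; $H^1(\Omega)\subset W_\theta(\Omega)$. $H_\theta=\{y\in\mathbb{R}^d: y\cdot\theta=0\}$; $\mathcal{P}_\theta(x)=x-(x\cdot\theta)\theta$; $\lambda^{d-1}$ is the $(d-1)$-dimensional Lebesgue measure on $H_\theta$ (identified isometrically with $\mathbb{R}^{d-1}$). For $y\in H_\theta$, $\omega_\theta(y)=\{s\in\mathbb{R}: s\theta+y\in\Omega\}$, and $\mathcal{I}_\theta(y)$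 is the countable set of disjoint bounded open intervals (the connected components) whose union is $\omega_\theta(y)$. Directional trace: a function $g:\partial\Omega\to\mathbb{R}$ is a directional trace of $u\in W_\theta(\Omega)$ in the direction $\theta$ if there exist a representative of $u$ (still denoted $u$) and a set $A\subset\mathcal{P}_\theta(\Omega)$ such that (1) $\mathcal{P}_\theta(\Omega)\setminus A$ is $\lambda^{d-1}$-negligible; (2) for all $y\in A$, $u_{\theta,y}:s\mapsto u(s\theta+y)$ is an element of $H^1(\omega_\theta(y))$ and, for all $]\alpha,\beta[\,\in\mathcal{I}_\theta(y)$, taking the representative of $u_{\theta,y}$ which is continuous on $]\alpha,\beta]$, one has $g(\beta\theta+y)=u_{\theta,y}(\beta)$. Directional measure: for $x\in\Omega$, $\delta_\theta(x)=\sup\{s\ge 0:\forall t\in[0,s[,\ x+t\theta\in\Omega\}$ and $\Phi_\theta(x)=x+\delta_\theta(x)\theta\in\partial\Omega$. The finite Borel measure $\mu_\theta$ on $\partial\Omega$ is $\mu_\theta(A)=\int_\Omega\chi_A(\Phi_\theta(x))\,dx$ for Borel $A\subset\partial\Omega$. $\gamma_\theta u$ is the set of all directional traces of $u$ in direction $\theta$, an equivalence class for equality $\mu_\theta$-a.e. $\mathcal{L}^2(\partial\Omega,(\mu_\theta)_{\theta\in\mathbb{S}^{d-1}})$ is the set of functions $f:\partial\Omega\to\mathbb{R}$ for which there is $M\ge 0$ such that for every $\theta\in\mathbb{S}^{d-1}$ there is $g_\theta\in\mathcal{L}^2(\partial\Omega,\mu_\theta)$ with $f=g_\theta$ $\mu_\theta$-a.e.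 and $\int|g_\theta|^2d\mu_\theta\le M$. $L^2(\partial\Omega,(\mu_\theta)_{\theta\in\mathbb{S}^{d-1}})$ is its quotient by the relation "$f=g$ $\mu_\theta$-a.e. for every $\theta\in\mathbb{S}^{d-1}$". Omnidirectional trace: $u\in H^1(\Omega)$ belongs to $H^1_{\rm tr}(\Omega)$ if there is $g\in L^2(\partial\Omega,(\mu_\theta)_{\theta\in\mathbb{S}^{d-1}})$ such that for all $\theta\in\mathbb{S}^{d-1}$, $\gamma_\theta u(z)=g(z)$ for $\mu_\theta$-a.e. $z\in\partial\Omega$; then ${\rm tr}(u):=g$. *)

theory Defs
  imports "HOL-Analysis.Analysis"
begin

section \<open>Square-integrable functions and classes of functions\<close>

definition L2_fun :: "'a measure \<Rightarrow> ('a \<Rightarrow> real) set" where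
  "L2_fun M = {f \<in> borel_measurable M. integrable M (\<lambda>x. (f x)\<^sup>2)}"

text \<open>Functions are total on the ambient type; their values outside the space of \<open>M\<close> play no role,
  since \<open>AE\<close> only concerns points of that space. Classes of functions are literally sets of
  functions, so a representative of a class is an element of it.\<close>

definition L2_rel :: "'a measure \<Rightarrow> (('a \<Rightarrow> real) \<times> ('a \<Rightarrow> real)) set" where
  "L2_rel M = {(f, g). f \<in> L2_fun M \<and> g \<in> L2_fun M \<and> (AE x in M. f x = g x)}"

definition rep :: "('a \<Rightarrow> real) set \<Rightarrow> 'a \<Rightarrow> real" where
  "rep U = (SOME u. u \<in> U)"

section \<open>Weak derivatives and Sobolev spaces\<close>

primrec Ck :: "nat \<Rightarrow> ('a::euclidean_space \<Rightarrow> real) \<Rightarrow> bool" where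
  "Ck 0 f \<longleftrightarrow> continuous_on UNIV f"
| "Ck (Suc k) f \<longleftrightarrow>
     f differentiable_on UNIV \<and> (\<forall>v. Ck k (\<lambda>x. frechet_derivative f (at x) v))"

definition test_functions :: "'a::euclidean_space set \<Rightarrow> ('a \<Rightarrow> real) set" where
  "test_functions \<Omega> =
     {\<phi>. (\<forall>k. Ck k \<phi>) \<and> compact (closure {x. \<phi> x \<noteq> 0}) \<and> closure {x. \<phi> x \<noteq> 0} \<subseteq> \<Omega>}"

definition has_weak_deriv ::
    "'a::euclidean_space set \<Rightarrow> 'a \<Rightarrow> ('a \<Rightarrow> real) \<Rightarrow> ('a \<Rightarrow> real) \<Rightarrow> bool" where
  "has_weak_deriv \<Omega> \<theta> u v \<longleftrightarrow>
     (\<forall>\<phi>\<in>test_functions \<Omega>.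
        (LINT x|lebesgue_on \<Omega>. u x * frechet_derivative \<phi> (at x) \<theta>)
          = - (LINT x|lebesgue_on \<Omega>. v x * \<phi> x))"

definition W_fun :: "'a::euclidean_space set \<Rightarrow> 'a \<Rightarrow> ('a \<Rightarrow> real) set" where
  "W_fun \<Omega> \<theta> =
     {u \<in> L2_fun (lebesgue_on \<Omega>). \<exists>v \<in> L2_fun (lebesgue_on \<Omega>). has_weak_deriv \<Omega> \<theta> u v}"

definition H1_fun :: "'a::euclidean_space set \<Rightarrow> ('a \<Rightarrow> real) set" where
  "H1_fun \<Omega> =
     {u \<in> L2_fun (lebesgue_on \<Omega>).
        \<forall>b\<in>Basis. \<exists>v \<in> L2_fun (lebesgue_on \<Omega>). has_weak_deriv \<Omega> b u v}"

definition W :: "'a::euclidean_space set \<Rightarrow> 'a \<Rightarrow> ('a \<Rightarrow> real) set set" where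
  "W \<Omega> \<theta> = W_fun \<Omega> \<theta> // L2_rel (lebesgue_on \<Omega>)"

definition H1 :: "'a::euclidean_space set \<Rightarrow> ('a \<Rightarrow> real) set set" where
  "H1 \<Omega> = H1_fun \<Omega> // L2_rel (lebesgue_on \<Omega>)"

text \<open>Weak derivatives are only determined almost everywhere; the integrals below do not depend on
  the chosen representatives.\<close>

definition weak_deriv ::
    "'a::euclidean_space set \<Rightarrow> 'a \<Rightarrow> ('a \<Rightarrow> real) \<Rightarrow> 'a \<Rightarrow> real" where
  "weak_deriv \<Omega> \<theta> u = (SOME v. v \<in> L2_fun (lebesgue_on \<Omega>) \<and> has_weak_deriv \<Omega> \<theta> u v)"

definition weak_grad :: "'a::euclidean_space set \<Rightarrow> ('a \<Rightarrow> real) \<Rightarrow> 'a \<Rightarrow> 'a" where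
  "weak_grad \<Omega> u x = (\<Sum>b\<in>Basis. weak_deriv \<Omega> b u x *\<^sub>R b)"

definition grad_inner ::
    "'a::euclidean_space set \<Rightarrow> ('a \<Rightarrow> real) set \<Rightarrow> ('a \<Rightarrow> real) set \<Rightarrow> real" where
  "grad_inner \<Omega> U V =
     (LINT x|lebesgue_on \<Omega>. weak_grad \<Omega> (rep U) x \<bullet> weak_grad \<Omega> (rep V) x)"

definition H1_inner ::
    "'a::euclidean_space set \<Rightarrow> ('a \<Rightarrow> real) set \<Rightarrow> ('a \<Rightarrow> real) set \<Rightarrow> real" where
  "H1_inner \<Omega> U V =
     (LINT x|lebesgue_on \<Omega>.
        rep U x * rep V x + weak_grad \<Omega> (rep U) x \<bullet> weak_grad \<Omega> (rep V) x)"

section \<open>Directional traces\<close>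

definition hyperplane :: "'a::euclidean_space \<Rightarrow> 'a set" where
  "hyperplane \<theta> = {y. y \<bullet> \<theta> = 0}"

definition proj :: "'a::euclidean_space \<Rightarrow> 'a \<Rightarrow> 'a" where
  "proj \<theta> x = x - (x \<bullet> \<theta>) *\<^sub>R \<theta>"

text \<open>The \<open>(d-1)\<close>-dimensional Lebesgue measure on the hyperplane is the image of the product measure
  under the coordinate isometry given by an orthonormal basis (compare the definition of
  \<open>lborel\<close>). It does not depend on the basis. For \<open>d = 1\<close> it is the Dirac measure at \<open>0\<close>.\<close>

definition hyperplane_basis :: "'a::euclidean_space \<Rightarrow> 'a set" where
  "hyperplane_basis \<theta> =
     (SOME B. pairwise orthogonal B \<and> (\<forall>b\<in>B. norm b = 1) \<and> span B = hyperplane \<theta>)"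

definition hyperplane_measure :: "'a::euclidean_space \<Rightarrow> 'a measure" where
  "hyperplane_measure \<theta> =
     distr (\<Pi>\<^sub>M b\<in>hyperplane_basis \<theta>. lborel) (restrict_space borel (hyperplane \<theta>))
       (\<lambda>c. \<Sum>b\<in>hyperplane_basis \<theta>. c b *\<^sub>R b)"

definition slice :: "'a::euclidean_space set \<Rightarrow> 'a \<Rightarrow> 'a \<Rightarrow> real set" where
  "slice \<Omega> \<theta> y = {s. s *\<^sub>R \<theta> + y \<in> \<Omega>}"

text \<open>On a component \<open>]\<alpha>, \<beta>[\<close> of a slice, \<open>w\<close> is the representative of the restriction of \<open>u\<close> to
  the line which is continuous on \<open>]\<alpha>, \<beta>]\<close>; its value at \<open>\<beta>\<close> is unique.\<close>

definition is_directional_trace ::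
    "'a::euclidean_space set \<Rightarrow> 'a \<Rightarrow> ('a \<Rightarrow> real) set \<Rightarrow> ('a \<Rightarrow> real) \<Rightarrow> bool" where
  "is_directional_trace \<Omega> \<theta> U g \<longleftrightarrow>
     U \<in> W \<Omega> \<theta> \<and>
     (\<exists>u\<in>U. \<exists>A \<subseteq> proj \<theta> ` \<Omega>.
        proj \<theta> ` \<Omega> - A \<in> null_sets (completion (hyperplane_measure \<theta>)) \<and>
        (\<forall>y\<in>A.
           (\<lambda>s. u (s *\<^sub>R \<theta> + y)) \<in> H1_fun (slice \<Omega> \<theta> y) \<and>
           (\<forall>\<alpha> \<beta>. {\<alpha><..<\<beta>} \<in> components (slice \<Omega> \<theta> y) \<longrightarrow>
              (\<exists>w. continuous_on {\<alpha><..\<beta>} w \<and>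
                   (AE s in lebesgue_on {\<alpha><..<\<beta>}. w s = u (s *\<^sub>R \<theta> + y)) \<and>
                   g (\<beta> *\<^sub>R \<theta> + y) = w \<beta>))))"

definition directional_traces ::
    "'a::euclidean_space set \<Rightarrow> 'a \<Rightarrow> ('a \<Rightarrow> real) set \<Rightarrow> ('a \<Rightarrow> real) set" where
  "directional_traces \<Omega> \<theta> U = {g. is_directional_trace \<Omega> \<theta> U g}"

text \<open>For open \<open>\<Omega>\<close>, \<open>frontier \<Omega>\<close> is \<open>closure \<Omega> - \<Omega>\<close>.\<close>

definition exit_time :: "'a::euclidean_space set \<Rightarrow> 'a \<Rightarrow> 'a \<Rightarrow> real" where
  "exit_time \<Omega> \<theta> x = Sup {s. 0 \<le> s \<and> (\<forall>t\<in>{0..<s}. x + t *\<^sub>R \<theta> \<in> \<Omega>)}"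

definition exit_point :: "'a::euclidean_space set \<Rightarrow> 'a \<Rightarrow> 'a \<Rightarrow> 'a" where
  "exit_point \<Omega> \<theta> x = x + exit_time \<Omega> \<theta> x *\<^sub>R \<theta>"

definition directional_measure :: "'a::euclidean_space set \<Rightarrow> 'a \<Rightarrow> 'a measure" where
  "directional_measure \<Omega> \<theta> =
     distr (lebesgue_on \<Omega>) (restrict_space borel (frontier \<Omega>)) (exit_point \<Omega> \<theta>)"

section \<open>The space of boundary functions\<close>

definition bdL2_fun :: "'a::euclidean_space set \<Rightarrow> ('a \<Rightarrow> real) set" where
  "bdL2_fun \<Omega> =
     {f. \<exists>C\<ge>0. \<forall>\<theta>\<in>sphere 0 1. \<exists>g\<in>L2_fun (directional_measure \<Omega> \<theta>).
           (AE z in directional_measure \<Omega> \<theta>. f z = g z) \<and>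
           (LINT z|directional_measure \<Omega> \<theta>. \<bar>g z\<bar>\<^sup>2) \<le> C}"

definition bdL2_rel :: "'a::euclidean_space set \<Rightarrow> (('a \<Rightarrow> real) \<times> ('a \<Rightarrow> real)) set" where
  "bdL2_rel \<Omega> =
     {(f, g). f \<in> bdL2_fun \<Omega> \<and> g \<in> bdL2_fun \<Omega> \<and>
        (\<forall>\<theta>\<in>sphere 0 1. AE z in directional_measure \<Omega> \<theta>. f z = g z)}"

definition bdL2 :: "'a::euclidean_space set \<Rightarrow> ('a \<Rightarrow> real) set set" where
  "bdL2 \<Omega> = bdL2_fun \<Omega> // bdL2_rel \<Omega>"

definition bd_zero :: "'a::euclidean_space set \<Rightarrow> ('a \<Rightarrow> real) set" where
  "bd_zero \<Omega> = bdL2_rel \<Omega> `` {\<lambda>z. 0}"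

definition bd_add ::
    "'a::euclidean_space set \<Rightarrow> ('a \<Rightarrow> real) set \<Rightarrow> ('a \<Rightarrow> real) set \<Rightarrow> ('a \<Rightarrow> real) set" where
  "bd_add \<Omega> F G = (\<Union>f\<in>F. \<Union>g\<in>G. bdL2_rel \<Omega> `` {\<lambda>z. f z + g z})"

definition bd_scale ::
    "'a::euclidean_space set \<Rightarrow> real \<Rightarrow> ('a \<Rightarrow> real) set \<Rightarrow> ('a \<Rightarrow> real) set" where
  "bd_scale \<Omega> c F = (\<Union>f\<in>F. bdL2_rel \<Omega> `` {\<lambda>z. c * f z})"

section \<open>Omnidirectional traces\<close>

text \<open>The directional traces of \<open>U\<close> agree with each other \<open>directional_measure \<Omega> \<theta>\<close>-almost
  everywhere, and so do the elements of \<open>G\<close>; hence it does not matter which of them are compared.\<close>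

definition has_trace ::
    "'a::euclidean_space set \<Rightarrow> ('a \<Rightarrow> real) set \<Rightarrow> ('a \<Rightarrow> real) set \<Rightarrow> bool" where
  "has_trace \<Omega> U G \<longleftrightarrow>
     G \<in> bdL2 \<Omega> \<and>
     (\<forall>\<theta>\<in>sphere 0 1. \<exists>h\<in>directional_traces \<Omega> \<theta> U. \<forall>g\<in>G.
        AE z in directional_measure \<Omega> \<theta>. h z = g z)"

definition H1_tr :: "'a::euclidean_space set \<Rightarrow> ('a \<Rightarrow> real) set set" where
  "H1_tr \<Omega> = {U \<in> H1 \<Omega>. \<exists>G. has_trace \<Omega> U G}"

definition tr :: "'a::euclidean_space set \<Rightarrow> ('a \<Rightarrow> real) set \<Rightarrow> ('a \<Rightarrow> real) set" where
  "tr \<Omega> U = (THE G. has_trace \<Omega> U G)"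

definition H1_tr0 :: "'a::euclidean_space set \<Rightarrow> ('a \<Rightarrow> real) set set" where
  "H1_tr0 \<Omega> = {U \<in> H1_tr \<Omega>. tr \<Omega> U = bd_zero \<Omega>}"

definition H_half :: "'a::euclidean_space set \<Rightarrow> ('a \<Rightarrow> real) set set" where
  "H_half \<Omega> = tr \<Omega> ` H1_tr \<Omega>"

definition is_harmonic_lifting ::
    "'a::euclidean_space set \<Rightarrow> ('a \<Rightarrow> real) set \<Rightarrow> ('a \<Rightarrow> real) set \<Rightarrow> bool" where
  "is_harmonic_lifting \<Omega> G U \<longleftrightarrow>
     U \<in> H1_tr \<Omega> \<and> tr \<Omega> U = G \<and> (\<forall>V\<in>H1_tr0 \<Omega>. grad_inner \<Omega> U V = 0)"

definition Psi :: "'a::euclidean_space set \<Rightarrow> ('a \<Rightarrow> real) set \<Rightarrow> ('a \<Rightarrow> real) set" where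
  "Psi \<Omega> G = (THE U. is_harmonic_lifting \<Omega> G U)"

definition H_half_inner ::
    "'a::euclidean_space set \<Rightarrow> ('a \<Rightarrow> real) set \<Rightarrow> ('a \<Rightarrow> real) set \<Rightarrow> real" where
  "H_half_inner \<Omega> F G = H1_inner \<Omega> (Psi \<Omega> F) (Psi \<Omega> G)"

section \<open>Real Hilbert spaces on a carrier set\<close>

locale real_vector_space_on =
  fixes V :: "'v set"
    and add :: "'v \<Rightarrow> 'v \<Rightarrow> 'v"
    and zero :: 'v
    and scale :: "real \<Rightarrow> 'v \<Rightarrow> 'v"
  assumes add_closed: "\<lbrakk>x \<in> V; y \<in> V\<rbrakk> \<Longrightarrow> add x y \<in> V"
    and zero_closed: "zero \<in> V"
    and scale_closed: "x \<in> V \<Longrightarrow> scale a x \<in> V"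
    and add_assoc: "\<lbrakk>x \<in> V; y \<in> V; z \<in> V\<rbrakk> \<Longrightarrow> add (add x y) z = add x (add y z)"
    and add_commute: "\<lbrakk>x \<in> V; y \<in> V\<rbrakk> \<Longrightarrow> add x y = add y x"
    and add_zero: "x \<in> V \<Longrightarrow> add x zero = x"
    and add_inverse: "x \<in> V \<Longrightarrow> \<exists>y\<in>V. add x y = zero"
    and scale_add_right:
      "\<lbrakk>x \<in> V; y \<in> V\<rbrakk> \<Longrightarrow> scale a (add x y) = add (scale a x) (scale a y)"
    and scale_add_left: "x \<in> V \<Longrightarrow> scale (a + b) x = add (scale a x) (scale b x)"
    and scale_scale: "x \<in> V \<Longrightarrow> scale a (scale b x) = scale (a * b) x"
    and scale_one: "x \<in> V \<Longrightarrow> scale 1 x = x"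

locale real_inner_product_space_on = real_vector_space_on V add zero scale
  for V :: "'v set" and add zero scale +
  fixes ip :: "'v \<Rightarrow> 'v \<Rightarrow> real"
  assumes ip_commute: "\<lbrakk>x \<in> V; y \<in> V\<rbrakk> \<Longrightarrow> ip x y = ip y x"
    and ip_add_left: "\<lbrakk>x \<in> V; y \<in> V; z \<in> V\<rbrakk> \<Longrightarrow> ip (add x y) z = ip x z + ip y z"
    and ip_scale_left: "\<lbrakk>x \<in> V; y \<in> V\<rbrakk> \<Longrightarrow> ip (scale a x) y = a * ip x y"
    and ip_nonneg: "x \<in> V \<Longrightarrow> 0 \<le> ip x x"
    and ip_definite: "\<lbrakk>x \<in> V; ip x x = 0\<rbrakk> \<Longrightarrow> x = zero"
begin

definition ip_dist :: "'v \<Rightarrow> 'v \<Rightarrow> real" where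
  "ip_dist x y = sqrt (ip (add x (scale (- 1) y)) (add x (scale (- 1) y)))"

end

locale real_hilbert_space_on = real_inner_product_space_on V add zero scale ip
  for V :: "'v set" and add zero scale ip +
  assumes complete:
    "\<lbrakk>\<And>n. X n \<in> V; \<And>e. 0 < e \<Longrightarrow> \<exists>N. \<forall>m\<ge>N. \<forall>n\<ge>N. ip_dist (X m) (X n) < e\<rbrakk>
       \<Longrightarrow> \<exists>x\<in>V. (\<lambda>n. ip_dist (X n) x) \<longlonglongrightarrow> 0"

end

theory Submission
  imports Defs
begin

text \<open>Fix a direction \<open>\<theta>\<close> and write \<open>\<delta> x\<close> for the exit time and \<open>\<Phi> x = x + \<delta> x *\<^sub>R \<theta>\<close> for the exit
  point of \<open>x\<close>. A function \<open>u\<close> with weak derivative \<open>v\<close> in direction \<open>\<theta>\<close> is a primitive of \<open>v\<close>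
  on almost every line, so a function \<open>h\<close> on the boundary is a directional trace of \<open>u\<close> if and
  only if, for almost every \<open>x\<close> in the domain, \<open>h (\<Phi> x)\<close> equals \<open>u x\<close> plus the integral of
  \<open>t \<mapsto> v (x + t *\<^sub>R \<theta>)\<close> over \<open>{0..\<delta> x}\<close> (\<open>directional_trace_eq_exit_integral\<close> and
  \<open>directional_traceI\<close>). The directional measure is the image of Lebesgue measure under \<open>\<Phi>\<close>, and
  a property holds almost everywhere for it as soon as it holds at \<open>\<Phi> x\<close> for almost every \<open>x\<close>
  (\<open>AE_directional_measure_iff\<close>). Both facts together turn the theory of traces into statements
  about integrals over the domain: a boundary function that is almost everywhere equal to a
  measurable one, for each directional measure, is the omnidirectional trace of \<open>u\<close> exactly if,
  in every direction, its composition with \<open>\<Phi>\<close> is this boundary value of \<open>u\<close>.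

  Three consequences carry the theorem. Traces are unique and linear. The Cauchy-Schwarz
  inequality on a line of length at most the diameter bounds the square integral of the boundary
  value by a constant times the squared \<open>H\<^sup>1\<close> norm, with the same constant for all directions;
  hence along a rapidly convergent sequence the traces converge at the exit points of almost all
  \<open>x\<close>, for every direction, and one pointwise limit serves as trace of the limit in all
  directions at once (\<open>jets_with_trace_complete\<close>). If the trace vanishes, then \<open>u\<close> is minus its
  exit integral, and the same bound becomes a Poincare inequality (\<open>Poincare_zero_trace\<close>).

  The harmonic lifting of a trace minimises the Dirichlet energy among all functions with that
  trace: by the parallelogram law and the Poincare inequality a minimising sequence is a Cauchy
  sequence in \<open>H\<^sup>1\<close>, and by completeness its limit still has the given trace
  (\<open>harmonic_jet_exists\<close>). Two harmonic liftings of one trace differ by a function with zero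
  trace and zero energy, so they coincide. Hence the trace space is isometric to the space of
  harmonic functions that have a trace, and this space is complete because orthogonality to the
  functions with zero trace passes to limits.

  A class in \<open>H\<^sup>1\<close> is handled through a jet, a Borel function whose value at \<open>x\<close> is the pair of
  \<open>u x\<close> and the gradient of \<open>u\<close> at \<open>x\<close>, extended by zero to the whole space. The scalar product
  of \<open>H\<^sup>1\<close> is then the \<open>L\<^sup>2\<close> scalar product of jets, without any choice of representatives.\<close>

section \<open>Square-integrable functions\<close>

text \<open>The values lie in a Euclidean space, so that a function together with its gradient is one
  vector-valued function.\<close>

definition sq_integrable :: "'a measure \<Rightarrow> ('a \<Rightarrow> 'b::euclidean_space) \<Rightarrow> bool" where
  "sq_integrable M f \<longleftrightarrow> f \<in> borel_measurable M \<and> integrable M (\<lambda>x. (norm (f x))\<^sup>2)"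

lemma sq_integrable_measurable [measurable_dest]:
  "sq_integrable M f \<Longrightarrow> f \<in> borel_measurable M"
  by (simp add: sq_integrable_def)

lemma sq_integrable_inner:
  assumes "sq_integrable M f" "sq_integrable M g"
  shows "integrable M (\<lambda>x. f x \<bullet> g x)"
proof (rule Bochner_Integration.integrable_bound)
  show "integrable M (\<lambda>x. (norm (f x))\<^sup>2 + (norm (g x))\<^sup>2)"
    using assms by (simp add: sq_integrable_def)
  show "(\<lambda>x. f x \<bullet> g x) \<in> borel_measurable M"
    using assms by (auto simp: sq_integrable_def)
  have "\<bar>f x \<bullet> g x\<bar> \<le> (norm (f x))\<^sup>2 + (norm (g x))\<^sup>2" for x
  proof -
    have "\<bar>f x \<bullet> g x\<bar> \<le> norm (f x) * norm (g x)"
      by (rule Cauchy_Schwarz_ineq2)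
    moreover have "0 \<le> (norm (f x) - norm (g x))\<^sup>2" "0 \<le> norm (f x) * norm (g x)" by auto
    ultimately show ?thesis by (simp add: power2_diff)
  qed
  then show "AE x in M. norm (f x \<bullet> g x) \<le> norm ((norm (f x))\<^sup>2 + (norm (g x))\<^sup>2)"
    by (auto intro!: AE_I2 order_trans[OF _ abs_ge_self])
qed

lemma sq_integrable_scaleR:
  assumes "sq_integrable M f" shows "sq_integrable M (\<lambda>x. c *\<^sub>R f x)"
  using assms by (auto simp: sq_integrable_def power_mult_distrib)

lemma norm_square_add: "(norm (x + y))\<^sup>2 = (norm x)\<^sup>2 + 2 * (x \<bullet> y) + (norm y)\<^sup>2"
  for x y :: "'b::real_inner"
  by (simp add: power2_norm_eq_inner inner_add_left inner_add_right inner_commute)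

lemma sq_integrable_add:
  assumes "sq_integrable M f" "sq_integrable M g"
  shows "sq_integrable M (\<lambda>x. f x + g x)"
  using assms sq_integrable_inner[OF assms] by (auto simp: sq_integrable_def norm_square_add)

lemma sq_integrable_diff:
  assumes "sq_integrable M f" "sq_integrable M g"
  shows "sq_integrable M (\<lambda>x. f x - g x)"
  using sq_integrable_add[OF assms(1) sq_integrable_scaleR[OF assms(2), of "-1"]] by simp

lemma integral_norm_square_add_scaleR:
  assumes "sq_integrable M f" "sq_integrable M g"
  shows "(LINT x|M. (norm (f x + t *\<^sub>R g x))\<^sup>2) =
    (LINT x|M. (norm (f x))\<^sup>2) + 2 * t * (LINT x|M. f x \<bullet> g x) + t\<^sup>2 * (LINT x|M. (norm (g x))\<^sup>2)"
  using assms sq_integrable_inner[OF assms]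
  by (simp add: norm_square_add sq_integrable_def power_mult_distrib)

text \<open>The quadratic polynomial \<open>t \<mapsto> \<integral> |f + t g|\<^sup>2\<close> is nonnegative, hence its discriminant is not
  positive.\<close>

lemma Cauchy_Schwarz_integral:
  assumes f: "sq_integrable M f" and g: "sq_integrable M g"
  shows "(LINT x|M. f x \<bullet> g x)\<^sup>2 \<le> (LINT x|M. (norm (f x))\<^sup>2) * (LINT x|M. (norm (g x))\<^sup>2)"
proof -
  define a b c where "a = (LINT x|M. (norm (f x))\<^sup>2)" and "b = (LINT x|M. f x \<bullet> g x)"
    and "c = (LINT x|M. (norm (g x))\<^sup>2)"
  have pos: "0 \<le> a + 2 * t * b + t\<^sup>2 * c" for t
    unfolding a_def b_def c_def integral_norm_square_add_scaleR[OF f g, symmetric] by simp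
  have "0 \<le> c" by (simp add: c_def)
  have "b\<^sup>2 \<le> a * c"
  proof (cases "c = 0")
    case True
    have "b = 0"
    proof (rule ccontr)
      assume "b \<noteq> 0"
      then show False using pos[of "- (a + 1) / (2 * b)"] True by (simp add: field_simps)
    qed
    then show ?thesis using True by simp
  next
    case False
    then have "c > 0" using \<open>0 \<le> c\<close> by simp
    have "0 \<le> c * (a + 2 * (- b / c) * b + (- b / c)\<^sup>2 * c)"
      using pos[of "- b / c"] \<open>c > 0\<close> by simp
    also have "\<dots> = a * c - b\<^sup>2"
      using \<open>c > 0\<close> by (simp add: field_simps power2_eq_square)
    finally show ?thesis by simp
  qed
  then show ?thesis by (simp add: a_def b_def c_def)
qed

lemma sq_integrable_dominated:
  assumes F: "sq_integrable M F" and [measurable]: "f \<in> borel_measurable M"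
    and le: "\<And>x. norm (f x) \<le> norm (F x)"
  shows "sq_integrable M f" and "(LINT x|M. (norm (f x))\<^sup>2) \<le> (LINT x|M. (norm (F x))\<^sup>2)"
proof -
  have sq: "(norm (f x))\<^sup>2 \<le> (norm (F x))\<^sup>2" for x using le[of x] by (intro power_mono) auto
  have "integrable M (\<lambda>x. (norm (f x))\<^sup>2)"
  proof (rule Bochner_Integration.integrable_bound)
    show "integrable M (\<lambda>x. (norm (F x))\<^sup>2)" using F by (simp add: sq_integrable_def)
  qed (use sq in auto)
  then show "sq_integrable M f" by (simp add: sq_integrable_def)
  then show "(LINT x|M. (norm (f x))\<^sup>2) \<le> (LINT x|M. (norm (F x))\<^sup>2)"
    using F sq by (intro integral_mono) (auto simp: sq_integrable_def)
qed

lemma tendsto_integral_inner: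
  assumes f: "\<And>n. sq_integrable M (f n)" "sq_integrable M f'" and h: "sq_integrable M h"
    and lim: "(\<lambda>n. LINT x|M. (norm (f n x - f' x))\<^sup>2) \<longlonglongrightarrow> 0"
  shows "(\<lambda>n. LINT x|M. f n x \<bullet> h x) \<longlonglongrightarrow> (LINT x|M. f' x \<bullet> h x)"
proof -
  have "(\<lambda>n. (LINT x|M. (f n x - f' x) \<bullet> h x)\<^sup>2) \<longlonglongrightarrow> 0"
  proof (rule tendsto_sandwich[where f = "\<lambda>_. 0"])
    show "(\<lambda>n. (LINT x|M. (norm (f n x - f' x))\<^sup>2) * (LINT x|M. (norm (h x))\<^sup>2)) \<longlonglongrightarrow> 0"
      using tendsto_mult[OF lim tendsto_const] by simp
    show "\<forall>\<^sub>F n in sequentially. (LINT x|M. (f n x - f' x) \<bullet> h x)\<^sup>2 \<le>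
        (LINT x|M. (norm (f n x - f' x))\<^sup>2) * (LINT x|M. (norm (h x))\<^sup>2)"
      by (intro always_eventually allI Cauchy_Schwarz_integral sq_integrable_diff f h)
  qed auto
  then have "(\<lambda>n. sqrt ((LINT x|M. (f n x - f' x) \<bullet> h x)\<^sup>2)) \<longlonglongrightarrow> sqrt 0"
    by (rule tendsto_real_sqrt)
  then have "(\<lambda>n. LINT x|M. (f n x - f' x) \<bullet> h x) \<longlonglongrightarrow> 0"
    by (simp add: tendsto_rabs_zero_iff)
  moreover have "(LINT x|M. (f n x - f' x) \<bullet> h x) = (LINT x|M. f n x \<bullet> h x) - (LINT x|M. f' x \<bullet> h x)" for n
    unfolding inner_diff_left
    by (intro Bochner_Integration.integral_diff sq_integrable_inner f h)
  ultimately show ?thesis by (simp add: LIM_zero_iff)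
qed

lemma AE_summable_if_summable_integral:
  fixes f :: "nat \<Rightarrow> 'a \<Rightarrow> real"
  assumes f: "\<And>k. integrable M (f k)" and nonneg: "\<And>k x. 0 \<le> f k x"
    and sum: "summable (\<lambda>k. LINT x|M. f k x)"
  shows "AE x in M. summable (\<lambda>k. f k x)"
proof -
  have [measurable]: "f k \<in> borel_measurable M" for k using f by auto
  have "(\<integral>\<^sup>+x. (\<Sum>k. ennreal (f k x)) \<partial>M) = (\<Sum>k. \<integral>\<^sup>+x. ennreal (f k x) \<partial>M)"
    by (rule nn_integral_suminf) auto
  also have "\<dots> = (\<Sum>k. ennreal (LINT x|M. f k x))"
    using f nonneg by (intro arg_cong[where f = suminf] ext nn_integral_eq_integral) auto
  also have "\<dots> = ennreal (\<Sum>k. LINT x|M. f k x)"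
    using nonneg by (intro suminf_ennreal2 sum integral_nonneg_AE) auto
  finally have "(\<integral>\<^sup>+x. (\<Sum>k. ennreal (f k x)) \<partial>M) \<noteq> \<infinity>" by simp
  then have "AE x in M. (\<Sum>k. ennreal (f k x)) \<noteq> \<infinity>"
    by (intro nn_integral_PInf_AE) auto
  then show ?thesis
    by (rule AE_mp) (auto intro!: AE_I2 summable_suminf_not_top nonneg)
qed

lemma AE_tendsto_0_if_integral_geometric:
  fixes f :: "nat \<Rightarrow> 'a \<Rightarrow> real"
  assumes f: "\<And>k. integrable M (f k)" and nonneg: "\<And>k x. 0 \<le> f k x"
    and le: "\<And>k. (LINT x|M. f k x) \<le> C * (1/4)^k"
  shows "AE x in M. (\<lambda>k. f k x) \<longlonglongrightarrow> 0"
proof -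
  have "summable (\<lambda>k. LINT x|M. f k x)"
  proof (rule summable_comparison_test')
    show "summable (\<lambda>k. C * (1/4::real)^k)" by (intro summable_mult summable_geometric) simp
    show "norm (LINT x|M. f k x) \<le> C * (1/4)^k" for k
      using le[of k] nonneg by (simp add: integral_nonneg_AE)
  qed
  from AE_summable_if_summable_integral[OF f nonneg this] show ?thesis
    by (rule AE_mp) (auto intro!: AE_I2 dest: summable_LIMSEQ_zero)
qed

text \<open>The terms of a convergent series are bounded, so the increments are dominated by a geometric
  series with ratio \<open>sqrt (1/2)\<close>.\<close>

lemma convergent_if_weighted_square_summable:
  fixes f :: "nat \<Rightarrow> 'b::banach"
  assumes "summable (\<lambda>k. 2^k * (norm (f (Suc k) - f k))\<^sup>2)"
  shows "convergent f"
proof -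
  obtain B where B: "\<And>k. norm (2^k * (norm (f (Suc k) - f k))\<^sup>2) \<le> B"
    using summable_imp_bounded[OF assms] by (auto simp: bounded_iff)
  have "B \<ge> 0" using B[of 0] norm_ge_zero order_trans by blast
  have le: "norm (f (Suc k) - f k) \<le> sqrt B * (sqrt (1/2))^k" for k
  proof -
    have "(norm (f (Suc k) - f k))\<^sup>2 \<le> B * (1/2)^k"
      using B[of k] by (simp add: field_simps power_divide)
    then have "sqrt ((norm (f (Suc k) - f k))\<^sup>2) \<le> sqrt (B * (1/2)^k)"
      by (rule real_sqrt_le_mono)
    then show ?thesis by (simp add: real_sqrt_mult real_sqrt_power)
  qed
  have "summable (\<lambda>k. f (Suc k) - f k)"
  proof (rule summable_comparison_test')
    have "sqrt (1/2) < 1" by (simp add: real_sqrt_less_iff)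
    then show "summable (\<lambda>k. sqrt B * (sqrt (1/2))^k)"
      by (intro summable_mult summable_geometric) auto
    show "norm (f (Suc k) - f k) \<le> sqrt B * (sqrt (1/2))^k" for k by (rule le)
  qed
  then have "(\<lambda>n. \<Sum>k<n. f (Suc k) - f k) \<longlonglongrightarrow> (\<Sum>k. f (Suc k) - f k)"
    by (rule summable_LIMSEQ)
  then have "(\<lambda>n. f n - f 0) \<longlonglongrightarrow> (\<Sum>k. f (Suc k) - f k)"
    by (simp add: sum_lessThan_telescope)
  from tendsto_add[OF this tendsto_const[of "f 0"]] show ?thesis
    by (auto simp: convergent_def)
qed

text \<open>The limit is the pointwise limit of a subsequence whose distance to the limit decays
  geometrically. The subsequence and its rate are part of the conclusion because traces are
  later recovered as pointwise limits along it.

  The increments of the subsequence satisfy the hypothesis of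
  \<open>convergent_if_weighted_square_summable\<close> almost everywhere, because their weighted squares
  have a finite sum of integrals; Fatou's lemma then gives the estimates for the limit.\<close>

theorem L2_complete:
  fixes f :: "nat \<Rightarrow> 'a \<Rightarrow> 'b::euclidean_space"
  assumes sq: "\<And>n. sq_integrable M (f n)"
    and Cauchy: "\<And>e. 0 < e \<Longrightarrow> \<exists>N. \<forall>m\<ge>N. \<forall>n\<ge>N. (LINT x|M. (norm (f m x - f n x))\<^sup>2) < e"
  obtains r :: "nat \<Rightarrow> nat" and F where "F = (\<lambda>x. lim (\<lambda>k. f (r k) x))" "sq_integrable M F"
    "AE x in M. (\<lambda>k. f (r k) x) \<longlonglongrightarrow> F x"
    "\<And>k. (LINT x|M. (norm (f (r k) x - F x))\<^sup>2) \<le> (1/4)^k"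
    "(\<lambda>n. LINT x|M. (norm (f n x - F x))\<^sup>2) \<longlonglongrightarrow> 0"
proof -
  note [measurable] = sq_integrable_measurable[OF sq]
  have "\<forall>k. \<exists>N. \<forall>m\<ge>N. \<forall>n\<ge>N. (LINT x|M. (norm (f m x - f n x))\<^sup>2) < (1/4)^k"
    using Cauchy by simp
  then obtain N where N: "\<And>k m n. m \<ge> N k \<Longrightarrow> n \<ge> N k \<Longrightarrow>
      (LINT x|M. (norm (f m x - f n x))\<^sup>2) < (1/4)^k"
    by metis
  \<comment> \<open>Adding up all earlier thresholds makes \<open>r\<close> monotone, and the summand \<open>k\<close> makes it
    unbounded.\<close>
  define r where "r k = (\<Sum>i\<le>k. N i) + k" for k
  have rN: "r k \<ge> N k" for k
    using member_le_sum[of k "{..k}" N] by (simp add: r_def trans_le_add1)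
  have r_mono: "r k \<le> r (Suc k)" for k by (simp add: r_def)
  have r_ge: "r k \<ge> k" for k by (simp add: r_def)
  define F where "F = (\<lambda>x. lim (\<lambda>k. f (r k) x))"
  have [measurable]: "F \<in> borel_measurable M"
    unfolding F_def by (rule borel_measurable_lim_metric) measurable
  have dsq: "sq_integrable M (\<lambda>x. f m x - f n x)" for m n
    by (intro sq_integrable_diff sq)
  have conv: "AE x in M. (\<lambda>k. f (r k) x) \<longlonglongrightarrow> F x"
  proof -
    have "summable (\<lambda>k. LINT x|M. 2^k * (norm (f (r (Suc k)) x - f (r k) x))\<^sup>2)"
    proof (rule summable_comparison_test')
      show "summable (\<lambda>k. (1/2::real)^k)" by (rule summable_geometric) simp
      fix k :: nat
      have "(LINT x|M. (norm (f (r (Suc k)) x - f (r k) x))\<^sup>2) \<le> (1/4)^k"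
        using N[of k "r (Suc k)" "r k"] rN[of k] r_mono[of k] by simp
      then have "2^k * (LINT x|M. (norm (f (r (Suc k)) x - f (r k) x))\<^sup>2) \<le> 2^k * (1/4)^k"
        by (intro mult_left_mono) auto
      also have "2^k * (1/4::real)^k = (1/2)^k" by (simp flip: power_mult_distrib)
      finally show "norm (LINT x|M. 2^k * (norm (f (r (Suc k)) x - f (r k) x))\<^sup>2) \<le> (1/2)^k"
        by (simp add: integral_nonneg_AE)
    qed
    then have "AE x in M. summable (\<lambda>k. 2^k * (norm (f (r (Suc k)) x - f (r k) x))\<^sup>2)"
      using dsq by (intro AE_summable_if_summable_integral) (auto simp: sq_integrable_def)
    then show ?thesis
    proof (rule AE_mp, intro AE_I2 impI)
      fix x assume "summable (\<lambda>k. 2^k * (norm (f (r (Suc k)) x - f (r k) x))\<^sup>2)"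
      from convergent_if_weighted_square_summable[OF this]
      show "(\<lambda>k. f (r k) x) \<longlonglongrightarrow> F x" by (simp add: F_def convergent_LIMSEQ_iff)
    qed
  qed
  \<comment> \<open>Fatou's lemma along the subsequence\<close>
  have bound: "integrable M (\<lambda>x. (norm (f n x - F x))\<^sup>2) \<and> (LINT x|M. (norm (f n x - F x))\<^sup>2) \<le> e"
    if e: "\<And>m. m \<ge> K \<Longrightarrow> (LINT x|M. (norm (f n x - f m x))\<^sup>2) \<le> e" for n K e
  proof -
    have "0 \<le> (LINT x|M. (norm (f n x - f K x))\<^sup>2)" by simp
    also have "\<dots> \<le> e" by (rule e) simp
    finally have "e \<ge> 0" .
    have "(\<integral>\<^sup>+x. ennreal ((norm (f n x - F x))\<^sup>2) \<partial>M) =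
        (\<integral>\<^sup>+x. liminf (\<lambda>k. ennreal ((norm (f n x - f (r k) x))\<^sup>2)) \<partial>M)"
    proof (rule nn_integral_cong_AE, rule AE_mp[OF conv], intro AE_I2 impI)
      fix x assume "(\<lambda>k. f (r k) x) \<longlonglongrightarrow> F x"
      then have "(\<lambda>k. ennreal ((norm (f n x - f (r k) x))\<^sup>2)) \<longlonglongrightarrow> ennreal ((norm (f n x - F x))\<^sup>2)"
        by (intro tendsto_intros)
      from lim_imp_Liminf[OF _ this]
      show "ennreal ((norm (f n x - F x))\<^sup>2) = liminf (\<lambda>k. ennreal ((norm (f n x - f (r k) x))\<^sup>2))"
        by simp
    qed
    also have "\<dots> \<le> liminf (\<lambda>k. \<integral>\<^sup>+x. ennreal ((norm (f n x - f (r k) x))\<^sup>2) \<partial>M)"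
      by (rule nn_integral_liminf) measurable
    also have "\<dots> = liminf (\<lambda>k. ennreal (LINT x|M. (norm (f n x - f (r k) x))\<^sup>2))"
      using dsq by (intro arg_cong[where f = liminf] ext nn_integral_eq_integral)
        (auto simp: sq_integrable_def)
    also have "\<dots> \<le> liminf (\<lambda>k::nat. ennreal e)"
    proof (rule Liminf_mono)
      show "\<forall>\<^sub>F k in sequentially. ennreal (LINT x|M. (norm (f n x - f (r k) x))\<^sup>2) \<le> ennreal e"
        using eventually_ge_at_top[of K]
        by eventually_elim (use e r_ge le_trans in \<open>blast intro: ennreal_leI\<close>)
    qed
    also have "\<dots> = ennreal e" by (simp add: Liminf_const)
    finally have le: "(\<integral>\<^sup>+x. ennreal ((norm (f n x - F x))\<^sup>2) \<partial>M) \<le> ennreal e" .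
    then have "(\<integral>\<^sup>+x. ennreal ((norm (f n x - F x))\<^sup>2) \<partial>M) < \<infinity>"
      using le_less_trans by fastforce
    then have int: "integrable M (\<lambda>x. (norm (f n x - F x))\<^sup>2)"
      by (intro integrableI_bounded) auto
    from le show ?thesis
      using int \<open>e \<ge> 0\<close> by (subst (asm) nn_integral_eq_integral) auto
  qed
  have "(LINT x|M. (norm (f (r k) x - F x))\<^sup>2) \<le> (1/4)^k" for k
    using bound[where n = "r k" and e = "(1/4)^k" and K = "r k"] N[of k "r k"] rN[of k]
    by (meson le_trans less_imp_le)
  note quarter = this
  have fF: "sq_integrable M (\<lambda>x. f (r 0) x - F x)"
  proof -
    have "(LINT x|M. (norm (f (r 0) x - f m x))\<^sup>2) \<le> 1" if "m \<ge> r 0" for m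
      using N[of 0 "r 0" m] rN[of 0] that by simp
    from bound[OF this] show ?thesis by (simp add: sq_integrable_def)
  qed
  have "sq_integrable M F"
    using sq_integrable_diff[OF sq[of "r 0"] fF] by simp
  moreover have "(\<lambda>n. LINT x|M. (norm (f n x - F x))\<^sup>2) \<longlonglongrightarrow> 0"
  proof (rule LIMSEQ_I)
    fix e :: real assume "0 < e"
    then obtain K where K: "\<forall>m\<ge>K. \<forall>n\<ge>K. (LINT x|M. (norm (f m x - f n x))\<^sup>2) < e/2"
      using Cauchy[of "e/2"] by auto
    have "norm ((LINT x|M. (norm (f n x - F x))\<^sup>2) - 0) < e" if "n \<ge> K" for n
    proof -
      have "(LINT x|M. (norm (f n x - F x))\<^sup>2) \<le> e/2"
        using bound[where K = K and n = n and e = "e/2"] K that by (auto intro: less_imp_le)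
      then show ?thesis using \<open>0 < e\<close> by (simp add: integral_nonneg_AE)
    qed
    then show "\<exists>no. \<forall>n\<ge>no. norm ((LINT x|M. (norm (f n x - F x))\<^sup>2) - 0) < e" by blast
  qed
  ultimately show thesis
    using that[of F r] conv quarter F_def by blast
qed

section \<open>Exit times\<close>

locale bounded_domain =
  fixes \<Omega> :: "'a::euclidean_space set"
  assumes open_domain: "open \<Omega>" and bounded_domain: "bounded \<Omega>"
begin

lemma domain_borel [measurable]: "\<Omega> \<in> sets borel"
  using open_domain by simp

lemma domain_lebesgue: "\<Omega> \<in> sets lebesgue"
  using open_domain by simp

lemma emeasure_domain_finite: "emeasure lborel \<Omega> < \<infinity>"
  using emeasure_bounded_finite[OF bounded_domain] by simp

lemma AE_lebesgue_on_domain: "(AE x in lebesgue_on \<Omega>. P x) \<longleftrightarrow> (AE x in lborel. x \<in> \<Omega> \<longrightarrow> P x)"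
  by (subst AE_restrict_space_iff) (simp_all add: domain_lebesgue AE_completion_iff)

end

locale directed_domain = bounded_domain \<Omega> for \<Omega> :: "'a::euclidean_space set" +
  fixes \<theta> :: 'a
  assumes norm_direction [simp]: "norm \<theta> = 1"
begin

lemma direction_inner_self [simp]: "\<theta> \<bullet> \<theta> = 1"
  by (simp add: dot_square_norm)

abbreviation \<delta> :: "'a \<Rightarrow> real" where "\<delta> \<equiv> exit_time \<Omega> \<theta>"
abbreviation \<Phi> :: "'a \<Rightarrow> 'a" where "\<Phi> \<equiv> exit_point \<Omega> \<theta>"

lemma exit_times_bdd:
  assumes "s \<in> {s. 0 \<le> s \<and> (\<forall>t\<in>{0..<s}. x + t *\<^sub>R \<theta> \<in> \<Omega>)}"
  shows "s \<le> diameter \<Omega>"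
proof (rule ccontr)
  assume "\<not> s \<le> diameter \<Omega>"
  then obtain t where t: "diameter \<Omega> < t" "t < s" using dense[of "diameter \<Omega>" s] by auto
  have "0 \<le> diameter \<Omega>" by (rule diameter_ge_0[OF bounded_domain])
  have "\<forall>t\<in>{0..<s}. x + t *\<^sub>R \<theta> \<in> \<Omega>" using assms by simp
  then have "x + 0 *\<^sub>R \<theta> \<in> \<Omega>" "x + t *\<^sub>R \<theta> \<in> \<Omega>"
    using t \<open>0 \<le> diameter \<Omega>\<close> by (auto simp del: scaleR_zero_left)
  then have "dist (x + t *\<^sub>R \<theta>) (x + 0 *\<^sub>R \<theta>) \<le> diameter \<Omega>"
    by (intro diameter_bounded_bound bounded_domain) auto
  then show False using t \<open>0 \<le> diameter \<Omega>\<close> by (simp add: dist_norm)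
qed

lemma exit_times_bdd_above: "bdd_above {s. 0 \<le> s \<and> (\<forall>t\<in>{0..<s}. x + t *\<^sub>R \<theta> \<in> \<Omega>)}"
  using exit_times_bdd by (intro bdd_aboveI) blast

lemma exit_time_nonneg [simp]: "0 \<le> \<delta> x"
  unfolding exit_time_def by (rule cSup_upper[OF _ exit_times_bdd_above]) simp

lemma exit_time_le_diameter: "\<delta> x \<le> diameter \<Omega>"
  unfolding exit_time_def by (rule cSup_least) (auto intro!: exit_times_bdd)

text \<open>The domain is open, so a half-line that is still inside at time \<open>a\<close> stays inside a little
  longer; this is why the inequality is strict.\<close>

lemma less_exit_time_iff:
  assumes "0 \<le> a" shows "a < \<delta> x \<longleftrightarrow> (\<forall>t\<in>{0..a}. x + t *\<^sub>R \<theta> \<in> \<Omega>)"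
proof
  assume "a < \<delta> x"
  then obtain s where "a < s" "\<forall>t\<in>{0..<s}. x + t *\<^sub>R \<theta> \<in> \<Omega>"
    unfolding exit_time_def by (subst (asm) less_cSup_iff[OF _ exit_times_bdd_above]) auto
  then show "\<forall>t\<in>{0..a}. x + t *\<^sub>R \<theta> \<in> \<Omega>" by auto
next
  assume *: "\<forall>t\<in>{0..a}. x + t *\<^sub>R \<theta> \<in> \<Omega>"
  then have "x + a *\<^sub>R \<theta> \<in> \<Omega>" using assms by auto
  then obtain e where e: "e > 0" "ball (x + a *\<^sub>R \<theta>) e \<subseteq> \<Omega>"
    using open_domain open_contains_ball by blast
  have "x + t *\<^sub>R \<theta> \<in> \<Omega>" if t: "0 \<le> t" "t < a + e" for t
  proof (cases "t \<le> a")
    case False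
    then have "dist (x + a *\<^sub>R \<theta>) (x + t *\<^sub>R \<theta>) < e"
      using t by (simp add: dist_norm flip: scaleR_diff_left)
    then show ?thesis using e by auto
  qed (use t * in auto)
  then have "a + e \<le> \<delta> x"
    unfolding exit_time_def using assms e by (intro cSup_upper exit_times_bdd_above) auto
  then show "a < \<delta> x" using e by simp
qed

lemma exit_time_pos_iff: "0 < \<delta> x \<longleftrightarrow> x \<in> \<Omega>"
  using less_exit_time_iff[of 0 x] by simp

lemma mem_domain_before_exit: "0 \<le> t \<Longrightarrow> t < \<delta> x \<Longrightarrow> x + t *\<^sub>R \<theta> \<in> \<Omega>"
  using less_exit_time_iff[of t x] by auto

lemma exit_point_notin: "\<Phi> x \<notin> \<Omega>"
proof
  assume "\<Phi> x \<in> \<Omega>"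
  then have "x + t *\<^sub>R \<theta> \<in> \<Omega>" if "t \<in> {0..\<delta> x}" for t
    using that mem_domain_before_exit[of t x] by (cases "t = \<delta> x") (auto simp: exit_point_def)
  then have "\<forall>t\<in>{0..\<delta> x}. x + t *\<^sub>R \<theta> \<in> \<Omega>" by blast
  then show False using less_exit_time_iff[of "\<delta> x" x] by simp
qed

lemma exit_point_frontier:
  assumes "x \<in> \<Omega>" shows "\<Phi> x \<in> frontier \<Omega>"
proof -
  have "((\<lambda>t. x + t *\<^sub>R \<theta>) \<longlongrightarrow> x + \<delta> x *\<^sub>R \<theta>) (at_left (\<delta> x))"
    by (intro tendsto_intros)
  moreover have "\<forall>\<^sub>F t in at_left (\<delta> x). x + t *\<^sub>R \<theta> \<in> closure \<Omega>"
    using eventually_at_left_real[of 0 "\<delta> x"] assms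
    by (auto simp: exit_time_pos_iff elim!: eventually_mono
        intro!: mem_domain_before_exit subsetD[OF closure_subset])
  ultimately have "\<Phi> x \<in> closure \<Omega>"
    unfolding exit_point_def by (intro Lim_in_closed_set[OF closed_closure]) auto
  then show ?thesis
    using exit_point_notin[of x] open_domain by (simp add: frontier_def interior_open)
qed

text \<open>Moving along the half-line uses up the exit time and keeps the exit point. This makes
  functions of the exit point constant on the components of slices.\<close>

lemma exit_time_shift:
  assumes "0 \<le> t" "t < \<delta> x"
  shows "\<delta> (x + t *\<^sub>R \<theta>) = \<delta> x - t"
proof -
  have iff: "a < \<delta> (x + t *\<^sub>R \<theta>) \<longleftrightarrow> a < \<delta> x - t" if "0 \<le> a" for a
  proof -
    have "a < \<delta> (x + t *\<^sub>R \<theta>) \<longleftrightarrow> (\<forall>s\<in>{0..a}. x + (t + s) *\<^sub>R \<theta> \<in> \<Omega>)"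
      using less_exit_time_iff[OF that, of "x + t *\<^sub>R \<theta>"] by (simp add: scaleR_add_left add.assoc)
    also have "\<dots> \<longleftrightarrow> (\<forall>s\<in>{0..t + a}. x + s *\<^sub>R \<theta> \<in> \<Omega>)"
    proof (intro iffI ballI)
      fix s assume *: "\<forall>s\<in>{0..a}. x + (t + s) *\<^sub>R \<theta> \<in> \<Omega>" and s: "s \<in> {0..t + a}"
      show "x + s *\<^sub>R \<theta> \<in> \<Omega>"
      proof (cases "s < t")
        case True then show ?thesis using s assms by (intro mem_domain_before_exit) auto
      next
        case False then show ?thesis using s *[rule_format, of "s - t"] by auto
      qed
    qed (use assms that in auto)
    also have "\<dots> \<longleftrightarrow> t + a < \<delta> x"
      using less_exit_time_iff[of "t + a" x] assms that by simp
    finally show ?thesis by linarith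
  qed
  show ?thesis
  proof (rule antisym)
    show "\<delta> (x + t *\<^sub>R \<theta>) \<le> \<delta> x - t" using iff[of "\<delta> x - t"] assms by auto
    show "\<delta> x - t \<le> \<delta> (x + t *\<^sub>R \<theta>)" using iff[of "\<delta> (x + t *\<^sub>R \<theta>)"] by auto
  qed
qed

lemma exit_point_shift:
  assumes "0 \<le> t" "t < \<delta> x"
  shows "\<Phi> (x + t *\<^sub>R \<theta>) = \<Phi> x"
  by (simp add: exit_point_def exit_time_shift[OF assms] algebra_simps)

text \<open>The complement consists of the points from which some point outside the domain is reached
  along a compact segment; it is the closed complement of the domain minus that segment, hence
  closed. This lower semicontinuity makes the exit time Borel measurable.\<close>

lemma open_less_exit_time:
  assumes "0 \<le> a" shows "open {x. a < \<delta> x}"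
proof -
  have "{x. a < \<delta> x} = - (\<Union>c\<in>-\<Omega>. \<Union>y\<in>(\<lambda>t. t *\<^sub>R \<theta>) ` {0..a}. {c - y})"
  proof (intro set_eqI iffI)
    fix x assume x: "x \<in> {x. a < \<delta> x}"
    show "x \<in> - (\<Union>c\<in>-\<Omega>. \<Union>y\<in>(\<lambda>t. t *\<^sub>R \<theta>) ` {0..a}. {c - y})"
      using x by (auto simp: less_exit_time_iff[OF assms])
  next
    fix x assume x: "x \<in> - (\<Union>c\<in>-\<Omega>. \<Union>y\<in>(\<lambda>t. t *\<^sub>R \<theta>) ` {0..a}. {c - y})"
    have "x + t *\<^sub>R \<theta> \<in> \<Omega>" if "t \<in> {0..a}" for t
    proof (rule ccontr)
      assume "x + t *\<^sub>R \<theta> \<notin> \<Omega>"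
      then have "(x + t *\<^sub>R \<theta>) - t *\<^sub>R \<theta> \<noteq> x" using x that by blast
      then show False by simp
    qed
    then show "x \<in> {x. a < \<delta> x}" by (simp add: less_exit_time_iff[OF assms])
  qed
  moreover have "closed (\<Union>c\<in>-\<Omega>. \<Union>y\<in>(\<lambda>t. t *\<^sub>R \<theta>) ` {0..a}. {c - y})"
    using open_domain
    by (intro closed_compact_differences compact_continuous_image) (auto intro!: continuous_intros)
  ultimately show ?thesis by (simp only: open_Compl)
qed

lemma exit_time_borel [measurable]: "\<delta> \<in> borel_measurable borel"
proof (rule borel_measurableI_greater)
  fix a :: real
  have "open {x. a < \<delta> x}"
  proof (cases "0 \<le> a")
    case True
    then show ?thesis by (rule open_less_exit_time)
  next
    case False
    then have "{x. a < \<delta> x} = UNIV" by (auto intro: less_le_trans[OF _ exit_time_nonneg])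
    then show ?thesis by simp
  qed
  then show "{x \<in> space borel. a < \<delta> x} \<in> sets borel" by simp
qed

lemma exit_point_borel [measurable]: "\<Phi> \<in> borel_measurable borel"
  unfolding exit_point_def by measurable

lemma exit_point_measurable:
  "\<Phi> \<in> lebesgue_on \<Omega> \<rightarrow>\<^sub>M restrict_space borel (frontier \<Omega>)"
proof (rule measurable_restrict_space2)
  show "\<Phi> \<in> space (lebesgue_on \<Omega>) \<rightarrow> frontier \<Omega>"
    using exit_point_frontier by simp
  show "\<Phi> \<in> borel_measurable (lebesgue_on \<Omega>)"
    by (intro measurable_restrict_space1 measurable_completion) simp
qed

section \<open>Integration along lines and the directional measure\<close>

lemma nn_integral_translate:
  assumes [measurable]: "f \<in> borel_measurable borel"
  shows "(\<integral>\<^sup>+x. f (x + c) \<partial>lborel) = (\<integral>\<^sup>+x. f x \<partial>(lborel :: 'a measure))"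
proof -
  have "(\<integral>\<^sup>+x. f x \<partial>lborel) = (\<integral>\<^sup>+x. f x \<partial>distr lborel borel ((+) c))"
    by (simp add: lborel_distr_plus)
  also have "\<dots> = (\<integral>\<^sup>+x. f (c + x) \<partial>lborel)" by (rule nn_integral_distr) auto
  finally show ?thesis by (simp add: add.commute)
qed

text \<open>Integrating first over lines and then over the base points counts every point with the total
  weight of \<open>g\<close>, by Fubini and translation invariance. Taking \<open>g\<close> to be an indicator, this
  replaces the decomposition of the domain into parallel lines wherever only null sets or bounds
  matter.\<close>

lemma nn_integral_lines:
  assumes [measurable]: "f \<in> borel_measurable borel" "g \<in> borel_measurable borel"
  shows "(\<integral>\<^sup>+x. \<integral>\<^sup>+t. g t * f (x + t *\<^sub>R \<theta>) \<partial>lborel \<partial>lborel) = (\<integral>\<^sup>+t. g t \<partial>lborel) * (\<integral>\<^sup>+x. f x \<partial>lborel)"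
proof -
  have "(\<integral>\<^sup>+x. \<integral>\<^sup>+t. g t * f (x + t *\<^sub>R \<theta>) \<partial>lborel \<partial>lborel)
      = (\<integral>\<^sup>+t. \<integral>\<^sup>+x. g t * f (x + t *\<^sub>R \<theta>) \<partial>lborel \<partial>lborel)"
    by (rule lborel_pair.Fubini') measurable
  also have "\<dots> = (\<integral>\<^sup>+t. g t * (\<integral>\<^sup>+x. f x \<partial>lborel) \<partial>lborel)"
    by (subst nn_integral_cmult) (simp_all add: nn_integral_translate)
  finally show ?thesis by (simp add: nn_integral_multc)
qed

lemma null_set_lines:
  assumes "N \<in> null_sets lborel"
  shows "AE x in lborel. AE t in lborel. x + t *\<^sub>R \<theta> \<notin> N"
proof -
  have [measurable]: "N \<in> sets borel" using assms by auto
  have "(\<integral>\<^sup>+x. \<integral>\<^sup>+t. 1 * indicator N (x + t *\<^sub>R \<theta>) \<partial>lborel \<partial>lborel) = (\<integral>\<^sup>+(t::real). 1 \<partial>lborel) * (\<integral>\<^sup>+x. indicator N x \<partial>lborel)"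
    by (rule nn_integral_lines) auto
  also have "\<dots> = 0" using assms by auto
  finally have "AE x in lborel. (\<integral>\<^sup>+t. indicator N (x + t *\<^sub>R \<theta>) \<partial>lborel) = 0"
    by (subst (asm) nn_integral_0_iff_AE) simp_all
  then show ?thesis
  proof eventually_elim
    case (elim x)
    then have "AE t in lborel. (indicator N (x + t *\<^sub>R \<theta>) :: ennreal) = 0"
      by (subst (asm) nn_integral_0_iff_AE) simp_all
    then show ?case by eventually_elim (auto simp: indicator_eq_0_iff)
  qed
qed

lemma AE_lines:
  assumes "AE x in lborel. P x"
  shows "AE x in lborel. AE t in lborel. P (x + t *\<^sub>R \<theta>)"
proof -
  obtain N where N: "\<And>x. x \<in> space lborel - N \<Longrightarrow> P x" "N \<in> null_sets lborel"
    using assms by (rule AE_E3) blast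
  from null_set_lines[OF N(2)] show ?thesis
    
  proof eventually_elim
    case (elim x)
    then show ?case by eventually_elim (simp add: N(1))
  qed
qed

text \<open>A set of points \<open>x\<close> being null does not make its image under the exit map measurable, so the
  nontrivial direction needs a Borel set of full measure on which \<open>P\<close> holds. If \<open>E\<close> is a null
  set containing the bad \<open>x\<close>, then \<open>P z\<close> holds at every exit point \<open>z\<close> whose line meets \<open>E\<close> in a
  null set: the points shortly before \<open>z\<close> all leave through \<open>z\<close>, and not all of them lie in \<open>E\<close>.\<close>

theorem AE_directional_measure_iff:
  "(AE z in directional_measure \<Omega> \<theta>. P z) \<longleftrightarrow> (AE x in lebesgue_on \<Omega>. P (\<Phi> x))"
proof
  assume "AE z in directional_measure \<Omega> \<theta>. P z"
  then show "AE x in lebesgue_on \<Omega>. P (\<Phi> x)"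
    unfolding directional_measure_def by (rule AE_distrD[OF exit_point_measurable])
next
  assume "AE x in lebesgue_on \<Omega>. P (\<Phi> x)"
  then have "AE x in lborel. x \<in> \<Omega> \<longrightarrow> P (\<Phi> x)" by (simp add: AE_lebesgue_on_domain)
  then obtain E where "\<And>x. x \<in> space lborel - E \<Longrightarrow> x \<in> \<Omega> \<longrightarrow> P (\<Phi> x)"
    and E: "E \<in> null_sets lborel"
    by (rule AE_E3) blast
  then have bad: "\<And>x. x \<in> \<Omega> \<Longrightarrow> \<not> P (\<Phi> x) \<Longrightarrow> x \<in> E" by auto
  have [measurable]: "E \<in> sets borel" using E by auto
  define L where "L z = (\<integral>\<^sup>+t. indicator E (z + t *\<^sub>R \<theta>) \<partial>lborel)" for z
  have [measurable]: "L \<in> borel_measurable borel" unfolding L_def by measurable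
  \<comment> \<open>The second part of \<open>Q\<close> says that \<open>z\<close> is an exit point: the half-line from a point shortly
    before \<open>z\<close> stays inside at least until \<open>z\<close>. In this form it is a Borel condition.\<close>
  define Q where "Q z \<longleftrightarrow> L z = 0 \<and> (\<exists>n::nat. 1 / Suc n \<le> \<delta> (z - (1 / Suc n) *\<^sub>R \<theta>))" for z
  have [measurable]: "Measurable.pred borel Q" unfolding Q_def by measurable
  have L_shift: "L (z + c *\<^sub>R \<theta>) = L z" for z c
  proof -
    have "L (z + c *\<^sub>R \<theta>) = (\<integral>\<^sup>+t. indicator E (z + (c + t) *\<^sub>R \<theta>) \<partial>lborel)"
      unfolding L_def by (simp add: scaleR_add_left add.assoc)
    also have "\<dots> = (\<integral>\<^sup>+t. indicator E (z + t *\<^sub>R \<theta>) \<partial>distr lborel borel ((+) c))"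
      by (subst nn_integral_distr) auto
    finally show ?thesis by (simp add: lborel_distr_plus L_def)
  qed
  have "AE x in lebesgue_on \<Omega>. Q (\<Phi> x)"
    unfolding AE_lebesgue_on_domain using null_set_lines[OF E]
  proof eventually_elim
    case (elim x)
    show ?case
    proof
      assume x: "x \<in> \<Omega>"
      from elim have "L x = 0"
        unfolding L_def by (subst nn_integral_0_iff_AE) (auto simp: indicator_eq_0_iff)
      then have "L (\<Phi> x) = 0" by (simp add: exit_point_def L_shift)
      moreover obtain n where n: "1 / real (Suc n) < \<delta> x"
        using x reals_Archimedean[of "\<delta> x"] by (auto simp: exit_time_pos_iff inverse_eq_divide)
      have "\<Phi> x - (1 / Suc n) *\<^sub>R \<theta> = x + (\<delta> x - 1 / Suc n) *\<^sub>R \<theta>"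
        by (simp add: exit_point_def algebra_simps)
      with n have "1 / Suc n \<le> \<delta> (\<Phi> x - (1 / Suc n) *\<^sub>R \<theta>)"
        by (simp add: exit_time_shift)
      ultimately show "Q (\<Phi> x)" by (auto simp: Q_def)
    qed
  qed
  then have "AE z in directional_measure \<Omega> \<theta>. Q z"
    unfolding directional_measure_def
    by (subst AE_distr_iff[OF exit_point_measurable])
      (auto simp: sets_restrict_space space_restrict_space intro!: measurable_restrict_space1)
  moreover have "AE z in directional_measure \<Omega> \<theta>. z \<in> frontier \<Omega>"
    by (rule AE_I2) (simp add: directional_measure_def space_restrict_space)
  ultimately show "AE z in directional_measure \<Omega> \<theta>. P z"
  proof eventually_elim
    case (elim z)
    then obtain n where n: "1 / Suc n \<le> \<delta> (z - (1 / Suc n) *\<^sub>R \<theta>)" by (auto simp: Q_def)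
    define x where "x = z - (1 / Suc n) *\<^sub>R \<theta>"
    have "z \<notin> \<Omega>" using elim(2) open_domain by (simp add: frontier_def interior_open)
    then have "\<not> 1 / Suc n < \<delta> x"
      using mem_domain_before_exit[of "1 / Suc n" x] by (auto simp: x_def)
    with n have dx: "\<delta> x = 1 / Suc n" by (simp add: x_def)
    then have "\<Phi> x = z" by (simp add: exit_point_def x_def)
    show "P z"
    proof (rule ccontr)
      assume "\<not> P z"
      have inE: "x + t *\<^sub>R \<theta> \<in> E" if "t \<in> {0<..<1 / Suc n}" for t
      proof -
        have "x + t *\<^sub>R \<theta> \<in> \<Omega>" "\<Phi> (x + t *\<^sub>R \<theta>) = z"
          using that dx \<open>\<Phi> x = z\<close> by (auto intro!: mem_domain_before_exit simp: exit_point_shift)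
        then show ?thesis using bad \<open>\<not> P z\<close> by auto
      qed
      have "ennreal (1 / Suc n) = (\<integral>\<^sup>+t. indicator {0<..<1 / Suc n} t \<partial>lborel)" by simp
      also have "\<dots> \<le> (\<integral>\<^sup>+t. indicator E (x + t *\<^sub>R \<theta>) \<partial>lborel)"
        by (intro nn_integral_mono) (auto simp: inE split: split_indicator)
      also have "\<dots> = L z"
        using L_shift[of x "1 / Suc n"] by (simp add: L_def x_def)
      finally show False using elim(1) by (simp add: Q_def)
    qed
  qed
qed

section \<open>Lebesgue measure on a hyperplane\<close>

lemma hyperplane_basis_exists:
  "\<exists>B. pairwise orthogonal B \<and> (\<forall>b\<in>B. norm b = 1) \<and> span B = hyperplane \<theta>"
proof -
  have "subspace (hyperplane \<theta>)"
    unfolding hyperplane_def by (rule subspace_hyperplane2)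
  then obtain B where "pairwise orthogonal B" "\<And>x. x \<in> B \<Longrightarrow> norm x = 1" "span B = hyperplane \<theta>"
    by (rule orthonormal_basis_subspace) blast
  then show ?thesis by blast
qed

lemma
  shows hyperplane_basis_orthogonal: "pairwise orthogonal (hyperplane_basis \<theta>)"
    and hyperplane_basis_norm: "\<And>b. b \<in> hyperplane_basis \<theta> \<Longrightarrow> norm b = 1"
    and span_hyperplane_basis: "span (hyperplane_basis \<theta>) = hyperplane \<theta>"
  using someI_ex[OF hyperplane_basis_exists] unfolding hyperplane_basis_def[symmetric] by auto

lemma hyperplane_basis_inner: "b \<in> hyperplane_basis \<theta> \<Longrightarrow> b \<bullet> \<theta> = 0"
  using span_hyperplane_basis span_base by (fastforce simp: hyperplane_def)

lemma orthonormal_pairwise: "pairwise orthogonal (insert \<theta> (hyperplane_basis \<theta>))"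
  using hyperplane_basis_orthogonal
  by (auto simp: pairwise_insert orthogonal_def hyperplane_basis_inner inner_commute)

lemma orthonormal_norm: "b \<in> insert \<theta> (hyperplane_basis \<theta>) \<Longrightarrow> norm b = 1"
  using hyperplane_basis_norm by auto

lemma orthonormal_independent: "independent (insert \<theta> (hyperplane_basis \<theta>))"
  using orthonormal_norm by (intro pairwise_orthogonal_independent orthonormal_pairwise) force

lemma orthonormal_finite: "finite (insert \<theta> (hyperplane_basis \<theta>))"
  using orthonormal_independent by (rule independent_imp_finite)

lemma finite_hyperplane_basis [simp]: "finite (hyperplane_basis \<theta>)"
  using orthonormal_finite by simp

lemma direction_notin_hyperplane_basis [simp]: "\<theta> \<notin> hyperplane_basis \<theta>"
  using hyperplane_basis_inner by fastforce

lemma proj_hyperplane: "proj \<theta> x \<in> hyperplane \<theta>"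
  by (simp add: proj_def hyperplane_def inner_diff_left)

lemma proj_line: "y \<in> hyperplane \<theta> \<Longrightarrow> proj \<theta> (s *\<^sub>R \<theta> + y) = y"
  by (simp add: proj_def hyperplane_def inner_add_left)

lemma proj_decomp: "(x \<bullet> \<theta>) *\<^sub>R \<theta> + proj \<theta> x = x"
  by (simp add: proj_def)

lemma proj_borel [measurable]: "proj \<theta> \<in> borel_measurable borel"
  unfolding proj_def by measurable

lemma hyperplane_borel [measurable]: "hyperplane \<theta> \<in> sets borel"
  unfolding hyperplane_def by (intro borel_closed) (simp add: closed_hyperplane inner_commute[of _ \<theta>])

lemma orthonormal_span: "span (insert \<theta> (hyperplane_basis \<theta>)) = UNIV"
proof -
  have "x \<in> span (insert \<theta> (hyperplane_basis \<theta>))" for x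
  proof -
    have "proj \<theta> x \<in> span (hyperplane_basis \<theta>)"
      by (simp add: span_hyperplane_basis proj_hyperplane)
    then have "proj \<theta> x \<in> span (insert \<theta> (hyperplane_basis \<theta>))"
      using span_mono[of "hyperplane_basis \<theta>" "insert \<theta> (hyperplane_basis \<theta>)"] by auto
    moreover have "(x \<bullet> \<theta>) *\<^sub>R \<theta> \<in> span (insert \<theta> (hyperplane_basis \<theta>))"
      by (intro span_scale span_base) simp
    ultimately have "(x \<bullet> \<theta>) *\<^sub>R \<theta> + proj \<theta> x \<in> span (insert \<theta> (hyperplane_basis \<theta>))"
      by (rule span_add[rotated])
    then show ?thesis by (simp only: proj_decomp)
  qed
  then show ?thesis by auto
qed

lemma orthonormal_card: "card (insert \<theta> (hyperplane_basis \<theta>)) = DIM('a)"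
  using dim_eq_card_independent[OF orthonormal_independent] dim_span[of "insert \<theta> (hyperplane_basis \<theta>)"]
  by (simp add: orthonormal_span)

text \<open>The isometry between the standard basis and an orthonormal basis adapted to the direction maps
  null sets to null sets in both ways, because it is linear.\<close>

lemma orthonormal_coordinates_null_iff:
  assumes N[measurable]: "N \<in> sets borel"
  shows "emeasure (distr (\<Pi>\<^sub>M b\<in>insert \<theta> (hyperplane_basis \<theta>). lborel) borel
           (\<lambda>c. \<Sum>b\<in>insert \<theta> (hyperplane_basis \<theta>). c b *\<^sub>R b)) N = 0
    \<longleftrightarrow> emeasure lborel N = 0"
proof -
  define B where "B = insert \<theta> (hyperplane_basis \<theta>)"
  have fB[simp]: "finite B" using orthonormal_finite by (simp add: B_def)
  obtain \<pi> where \<pi>: "bij_betw \<pi> (Basis :: 'a set) B"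
    using finite_same_card_bij[of "Basis :: 'a set" B] orthonormal_card by (auto simp: B_def)
  define \<pi>' where "\<pi>' = the_inv_into Basis \<pi>"
  have \<pi>'\<pi>[simp]: "\<pi>' (\<pi> i) = i" if "i \<in> Basis" for i
    unfolding \<pi>'_def using \<pi> that by (intro the_inv_into_f_f) (auto simp: bij_betw_def)
  have \<pi>B[simp]: "\<pi> i \<in> B" if "i \<in> Basis" for i using \<pi> that by (auto simp: bij_betw_def)
  have \<pi>'B[simp]: "\<pi>' b \<in> Basis" "\<pi> (\<pi>' b) = b" if "b \<in> B" for b
    using bij_betw_the_inv_into[OF \<pi>] that \<pi> unfolding \<pi>'_def
    by (auto simp: bij_betw_def f_the_inv_into_f)
  interpret product_sigma_finite "\<lambda>b::'a. lborel :: real measure" ..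
  let ?\<rho> = "\<lambda>c::'a \<Rightarrow> real. \<lambda>b\<in>B. c (\<pi>' b)"
  have \<rho>[measurable]: "?\<rho> \<in> (\<Pi>\<^sub>M b\<in>Basis. lborel) \<rightarrow>\<^sub>M (\<Pi>\<^sub>M b\<in>B. lborel :: real measure)"
    by (rule measurable_restrict) (simp add: measurable_component_singleton)
  have reindex: "distr (\<Pi>\<^sub>M b\<in>Basis. lborel) (\<Pi>\<^sub>M b\<in>B. lborel) ?\<rho> = (\<Pi>\<^sub>M b\<in>B. lborel)"
  proof (rule PiM_eqI)
    fix A :: "'a \<Rightarrow> real set" assume A: "\<And>b. b \<in> B \<Longrightarrow> A b \<in> sets lborel"
    have "?\<rho> -` (Pi\<^sub>E B A) \<inter> space (\<Pi>\<^sub>M b\<in>Basis. lborel) = (\<Pi>\<^sub>E i\<in>Basis. A (\<pi> i))"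
    proof (intro set_eqI iffI)
      fix c assume c: "c \<in> ?\<rho> -` (Pi\<^sub>E B A) \<inter> space (\<Pi>\<^sub>M b\<in>Basis. lborel)"
      have "c i \<in> A (\<pi> i)" if "i \<in> Basis" for i
        using c \<pi>B[OF that] that by (auto simp: PiE_iff dest!: bspec[of B _ "\<pi> i"])
      then show "c \<in> (\<Pi>\<^sub>E i\<in>Basis. A (\<pi> i))"
        using c by (auto simp: space_PiM PiE_iff)
    next
      fix c assume c: "c \<in> (\<Pi>\<^sub>E i\<in>Basis. A (\<pi> i))"
      have "c (\<pi>' b) \<in> A b" if "b \<in> B" for b
        using c \<pi>'B[OF that] by (metis PiE_mem)
      then show "c \<in> ?\<rho> -` (Pi\<^sub>E B A) \<inter> space (\<Pi>\<^sub>M b\<in>Basis. lborel)"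
        using c by (auto simp: space_PiM PiE_iff)
    qed
    moreover have "Pi\<^sub>E B A \<in> sets (\<Pi>\<^sub>M b\<in>B. lborel)" using A by (intro sets_PiM_I_finite) auto
    ultimately have "emeasure (distr (\<Pi>\<^sub>M b\<in>Basis. lborel) (\<Pi>\<^sub>M b\<in>B. lborel) ?\<rho>) (Pi\<^sub>E B A)
        = emeasure (\<Pi>\<^sub>M b\<in>Basis. lborel) (\<Pi>\<^sub>E i\<in>Basis. A (\<pi> i))"
      by (simp add: emeasure_distr)
    also have "\<dots> = (\<Prod>i\<in>Basis. emeasure lborel (A (\<pi> i)))"
      using A by (intro emeasure_PiM) auto
    also have "\<dots> = (\<Prod>b\<in>B. emeasure lborel (A b))"
      by (rule prod.reindex_bij_betw[OF \<pi>])
    finally show "emeasure (distr (\<Pi>\<^sub>M b\<in>Basis. lborel) (\<Pi>\<^sub>M b\<in>B. lborel) ?\<rho>) (Pi\<^sub>E B A)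
        = (\<Prod>b\<in>B. emeasure lborel (A b))" .
  qed auto
  define T where "T x = (\<Sum>i\<in>Basis. (x \<bullet> i) *\<^sub>R \<pi> i)" for x
  have linT: "linear T" unfolding T_def
    by (intro linear_compose_sum ballI linear_compose_scale_right)
       (auto intro!: linearI simp: inner_add_left scaleR_add_left)
  have [measurable]: "T \<in> borel_measurable borel" unfolding T_def by measurable
  have "range T = span B"
  proof -
    have "b \<in> range T" if "b \<in> B" for b
    proof -
      have "T (\<pi>' b) = (\<Sum>i\<in>Basis. (if i = \<pi>' b then \<pi> i else 0))"
        unfolding T_def using that by (intro sum.cong) (auto simp: inner_Basis)
      also have "\<dots> = b" using that by (simp add: sum.delta)
      finally show ?thesis by (metis rangeI)
    qed
    then have "B \<subseteq> range T" by auto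
    then have "span B \<subseteq> range T"
      by (intro span_minimal linear_subspace_image[OF linT subspace_UNIV]) auto
    then show ?thesis using orthonormal_span by (auto simp: B_def)
  qed
  then have "surj T" using orthonormal_span by (simp add: B_def)
  obtain T' where linT': "linear T'" and T': "\<And>x. T' (T x) = x" "\<And>x. T (T' x) = x"
    using linear_surjective_isomorphism[OF linT \<open>surj T\<close>] by auto
  have "(\<lambda>c. \<Sum>b\<in>B. c b *\<^sub>R b) \<in> borel_measurable (\<Pi>\<^sub>M b\<in>B. lborel)"
    by measurable
  then have "distr (\<Pi>\<^sub>M b\<in>B. lborel) borel (\<lambda>c. \<Sum>b\<in>B. c b *\<^sub>R b)
      = distr (\<Pi>\<^sub>M b\<in>Basis. lborel) borel ((\<lambda>c. \<Sum>b\<in>B. c b *\<^sub>R b) \<circ> ?\<rho>)"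
    by (subst reindex[symmetric], subst distr_distr) auto
  also have "\<dots> = distr (\<Pi>\<^sub>M b\<in>Basis. lborel) borel (T \<circ> (\<lambda>c. \<Sum>b\<in>Basis. c b *\<^sub>R b))"
  proof (intro distr_cong refl)
    fix c :: "'a \<Rightarrow> real"
    have "(\<Sum>b\<in>B. c (\<pi>' b) *\<^sub>R b) = (\<Sum>i\<in>Basis. c i *\<^sub>R \<pi> i)"
      by (subst sum.reindex_bij_betw[OF \<pi>, symmetric]) simp
    then show "((\<lambda>c. \<Sum>b\<in>B. c b *\<^sub>R b) \<circ> ?\<rho>) c = (T \<circ> (\<lambda>c. \<Sum>b\<in>Basis. c b *\<^sub>R b)) c"
      by (simp add: T_def)
  qed
  also have "\<dots> = distr lborel borel T"
    unfolding lborel_eq[where 'a='a] by (subst distr_distr) auto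
  finally have "emeasure (distr (\<Pi>\<^sub>M b\<in>B. lborel) borel (\<lambda>c. \<Sum>b\<in>B. c b *\<^sub>R b)) N = emeasure lborel (T -` N)"
    by (simp add: emeasure_distr)
  moreover have "emeasure lborel (T -` N) = 0 \<longleftrightarrow> emeasure lborel N = 0"
  proof -
    have meas: "T -` N \<in> sets borel" using measurable_sets[of T borel borel N] by simp
    have neg: "emeasure lborel S = 0 \<longleftrightarrow> negligible S" if "S \<in> sets borel" for S :: "'a set"
      using that by (auto simp: negligible_iff_null_sets null_sets_def)
    have "T ` (T -` N) = N" using \<open>surj T\<close> by (simp add: surj_image_vimage_eq)
    moreover have "T' ` N = T -` N"
      using T' by (auto simp: image_iff) metis
    moreover have "negligible (h ` S)" if "linear h" "negligible S" for h :: "'a \<Rightarrow> 'a" and S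
      using that by (intro negligible_differentiable_image_negligible linear_imp_differentiable_on) auto
    ultimately have "negligible (T -` N) \<longleftrightarrow> negligible N"
      using linT linT' by metis
    then show ?thesis using neg[OF meas] neg[OF N] by simp
  qed
  ultimately show ?thesis by (simp add: B_def)
qed

lemma hyperplane_coordinates_measurable:
  "(\<lambda>c. \<Sum>b\<in>hyperplane_basis \<theta>. c b *\<^sub>R b) \<in>
     (\<Pi>\<^sub>M b\<in>hyperplane_basis \<theta>. lborel) \<rightarrow>\<^sub>M restrict_space borel (hyperplane \<theta>)"
proof (rule measurable_restrict_space2)
  show "(\<lambda>c. \<Sum>b\<in>hyperplane_basis \<theta>. c b *\<^sub>R b) \<in> space (\<Pi>\<^sub>M b\<in>hyperplane_basis \<theta>. lborel) \<rightarrow> hyperplane \<theta>"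
  proof
    fix c :: "'a \<Rightarrow> real"
    have "(\<Sum>b\<in>hyperplane_basis \<theta>. c b *\<^sub>R b) \<in> span (hyperplane_basis \<theta>)"
      by (intro span_sum span_scale span_base)
    then show "(\<Sum>b\<in>hyperplane_basis \<theta>. c b *\<^sub>R b) \<in> hyperplane \<theta>"
      by (simp add: span_hyperplane_basis)
  qed
qed measurable

text \<open>Fubini in coordinates of which one runs along the direction and the others along the
  hyperplane.\<close>

lemma null_iff_AE_slice_null:
  assumes N[measurable]: "N \<in> sets borel"
  shows "emeasure lborel N = 0 \<longleftrightarrow>
    (AE y in hyperplane_measure \<theta>. (\<integral>\<^sup>+s. indicator N (s *\<^sub>R \<theta> + y) \<partial>lborel) = 0)"
proof -
  let ?H = "hyperplane_basis \<theta>"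
  interpret product_sigma_finite "\<lambda>b::'a. lborel :: real measure" ..
  have meas: "(\<lambda>y. \<integral>\<^sup>+s. indicator N (s *\<^sub>R \<theta> + y) \<partial>lborel) \<in> borel_measurable borel"
    by measurable
  have meas': "(\<lambda>c. indicator N (\<Sum>b\<in>insert \<theta> ?H. c b *\<^sub>R b) :: ennreal)
      \<in> borel_measurable (\<Pi>\<^sub>M b\<in>insert \<theta> ?H. lborel)"
    by measurable
  have "emeasure (distr (\<Pi>\<^sub>M b\<in>insert \<theta> ?H. lborel) borel (\<lambda>c. \<Sum>b\<in>insert \<theta> ?H. c b *\<^sub>R b)) N
      = (\<integral>\<^sup>+x. indicator N x \<partial>distr (\<Pi>\<^sub>M b\<in>insert \<theta> ?H. lborel) borel (\<lambda>c. \<Sum>b\<in>insert \<theta> ?H. c b *\<^sub>R b))"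
    by simp
  also have "\<dots> = (\<integral>\<^sup>+c. indicator N (\<Sum>b\<in>insert \<theta> ?H. c b *\<^sub>R b) \<partial>(\<Pi>\<^sub>M b\<in>insert \<theta> ?H. lborel))"
    by (rule nn_integral_distr) measurable
  also have "\<dots> = (\<integral>\<^sup>+c. \<integral>\<^sup>+s. indicator N (\<Sum>b\<in>insert \<theta> ?H. (c(\<theta> := s)) b *\<^sub>R b) \<partial>lborel
      \<partial>(\<Pi>\<^sub>M b\<in>?H. lborel))"
    by (rule product_nn_integral_insert[OF _ _ meas']) auto
  also have "\<dots> = (\<integral>\<^sup>+c. \<integral>\<^sup>+s. indicator N (s *\<^sub>R \<theta> + (\<Sum>b\<in>?H. c b *\<^sub>R b)) \<partial>lborel \<partial>(\<Pi>\<^sub>M b\<in>?H. lborel))"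
  proof -
    have "(\<Sum>b\<in>insert \<theta> ?H. (c(\<theta> := s)) b *\<^sub>R b) = s *\<^sub>R \<theta> + (\<Sum>b\<in>?H. c b *\<^sub>R b)" for c s
    proof -
      have "(\<Sum>b\<in>?H. (c(\<theta> := s)) b *\<^sub>R b) = (\<Sum>b\<in>?H. c b *\<^sub>R b)"
        using direction_notin_hyperplane_basis by (intro sum.cong) auto
      then show ?thesis by simp
    qed
    then show ?thesis by simp
  qed
  also have "\<dots> = (\<integral>\<^sup>+y. \<integral>\<^sup>+s. indicator N (s *\<^sub>R \<theta> + y) \<partial>lborel \<partial>hyperplane_measure \<theta>)"
    unfolding hyperplane_measure_def
    by (rule nn_integral_distr[symmetric, OF hyperplane_coordinates_measurable])
      (simp add: measurable_restrict_space1[OF meas])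
  finally have "emeasure lborel N = 0 \<longleftrightarrow> (\<integral>\<^sup>+y. \<integral>\<^sup>+s. indicator N (s *\<^sub>R \<theta> + y) \<partial>lborel \<partial>hyperplane_measure \<theta>) = 0"
    using orthonormal_coordinates_null_iff[OF N] by simp
  also have "\<dots> \<longleftrightarrow> (AE y in hyperplane_measure \<theta>. (\<integral>\<^sup>+s. indicator N (s *\<^sub>R \<theta> + y) \<partial>lborel) = 0)"
    by (rule nn_integral_0_iff_AE)
      (auto simp: hyperplane_measure_def intro!: measurable_restrict_space1[OF meas])
  finally show ?thesis .
qed

lemma space_hyperplane_measure [simp]: "space (hyperplane_measure \<theta>) = hyperplane \<theta>"
  by (simp add: hyperplane_measure_def space_restrict_space)

lemma open_slice: "open (slice \<Omega> \<theta> y)"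
proof -
  have "slice \<Omega> \<theta> y = (\<lambda>s. s *\<^sub>R \<theta> + y) -` \<Omega>" by (auto simp: slice_def)
  then show ?thesis
    using open_domain by (simp add: open_vimage continuous_intros)
qed

lemma AE_lebesgue_on_slice:
  "(AE s in lebesgue_on (slice \<Omega> \<theta> y). P s) \<longleftrightarrow> (AE s in lborel. s \<in> slice \<Omega> \<theta> y \<longrightarrow> P s)"
  using open_slice by (subst AE_restrict_space_iff) (simp_all add: AE_completion_iff)

text \<open>Passage from almost every point to almost every point of almost every line.\<close>

lemma almost_every_slice:
  assumes "AE x in lebesgue_on \<Omega>. R x"
  shows "proj \<theta> ` \<Omega> - {y. AE s in lebesgue_on (slice \<Omega> \<theta> y). R (s *\<^sub>R \<theta> + y)}
    \<in> null_sets (completion (hyperplane_measure \<theta>))"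
proof -
  have "AE x in lborel. x \<in> \<Omega> \<longrightarrow> R x" using assms by (simp add: AE_lebesgue_on_domain)
  then obtain E where E: "\<And>x. x \<in> space lborel - E \<Longrightarrow> x \<in> \<Omega> \<longrightarrow> R x" "E \<in> null_sets lborel"
    by (rule AE_E3) blast
  have [measurable]: "E \<in> sets borel" using E by auto
  have "AE y in hyperplane_measure \<theta>. (\<integral>\<^sup>+s. indicator E (s *\<^sub>R \<theta> + y) \<partial>lborel) = 0"
    using E by (subst null_iff_AE_slice_null[symmetric]) auto
  then obtain Z where Z: "\<And>y. y \<in> space (hyperplane_measure \<theta>) - Z \<Longrightarrow>
      (\<integral>\<^sup>+s. indicator E (s *\<^sub>R \<theta> + y) \<partial>lborel) = 0"
    "Z \<in> null_sets (hyperplane_measure \<theta>)"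
    by (rule AE_E3) blast
  have "proj \<theta> ` \<Omega> - {y. AE s in lebesgue_on (slice \<Omega> \<theta> y). R (s *\<^sub>R \<theta> + y)} \<subseteq> Z"
  proof
    fix y assume y: "y \<in> proj \<theta> ` \<Omega> - {y. AE s in lebesgue_on (slice \<Omega> \<theta> y). R (s *\<^sub>R \<theta> + y)}"
    then have "y \<in> hyperplane \<theta>" using proj_hyperplane by auto
    show "y \<in> Z"
    proof (rule ccontr)
      assume "y \<notin> Z"
      then have "(\<integral>\<^sup>+s. indicator E (s *\<^sub>R \<theta> + y) \<partial>lborel) = 0"
        using Z(1) \<open>y \<in> hyperplane \<theta>\<close> by simp
      then have "AE s in lborel. (indicator E (s *\<^sub>R \<theta> + y) :: ennreal) = 0"
        by (subst (asm) nn_integral_0_iff_AE) simp_all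
      then have "AE s in lebesgue_on (slice \<Omega> \<theta> y). R (s *\<^sub>R \<theta> + y)"
        unfolding AE_lebesgue_on_slice
        by eventually_elim (use E(1) in \<open>auto simp: slice_def indicator_eq_0_iff\<close>)
      then show False using y by simp
    qed
  qed
  then show ?thesis
    by (rule null_sets_completion_subset[OF _ null_sets_completionI[OF Z(2)]])
qed

text \<open>The preimage of a null set \<open>Z\<close> of the hyperplane has empty slices over all points outside \<open>Z\<close>.\<close>

lemma AE_proj_notin_null:
  assumes "A \<in> null_sets (completion (hyperplane_measure \<theta>))"
  shows "AE x in lborel. proj \<theta> x \<notin> A"
proof -
  have "AE y in completion (hyperplane_measure \<theta>). y \<notin> A" by (rule AE_not_in[OF assms])
  then have "AE y in hyperplane_measure \<theta>. y \<notin> A" by (simp add: AE_completion_iff)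
  then obtain Z where Z: "\<And>y. y \<in> space (hyperplane_measure \<theta>) - Z \<Longrightarrow> y \<notin> A"
    "Z \<in> null_sets (hyperplane_measure \<theta>)"
    by (rule AE_E3) blast
  have "Z \<in> sets (restrict_space borel (hyperplane \<theta>))"
    using Z(2) by (auto simp: hyperplane_measure_def)
  then have [measurable]: "Z \<in> sets borel" and sub: "Z \<subseteq> hyperplane \<theta>"
    by (auto simp: sets_restrict_space_iff)
  have [measurable]: "proj \<theta> -` Z \<in> sets borel"
    using measurable_sets[of "proj \<theta>" borel borel Z] by simp
  have "AE y in hyperplane_measure \<theta>. y \<notin> Z \<and> y \<in> hyperplane \<theta>"
    using AE_not_in[OF Z(2)] AE_space[of "hyperplane_measure \<theta>"] by eventually_elim simp
  then have "AE y in hyperplane_measure \<theta>. (\<integral>\<^sup>+s. indicator (proj \<theta> -` Z) (s *\<^sub>R \<theta> + y) \<partial>lborel) = 0"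
    by eventually_elim (simp add: proj_line indicator_def)
  then have "emeasure lborel (proj \<theta> -` Z) = 0"
    by (subst null_iff_AE_slice_null) simp_all
  then have "proj \<theta> -` Z \<in> null_sets lborel" by auto
  from AE_not_in[OF this] show ?thesis
    by eventually_elim (use Z(1) proj_hyperplane in auto)
qed

end

section \<open>Smooth bumps and the fundamental lemma of the calculus of variations\<close>

text \<open>The predicate \<open>Ck\<close> is defined through directional derivatives; an explicit derivative replaces
  the choice made by \<open>frechet_derivative\<close>.\<close>

lemma Ck_SucI:
  assumes "\<And>x. (f has_derivative D x) (at x)" and "\<And>v. Ck k (\<lambda>x. D x v)"
  shows "Ck (Suc k) f"
proof -
  have "frechet_derivative f (at x) = D x" for x
    using frechet_derivative_at[OF assms(1)] by simp
  then show ?thesis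
    using assms by (auto simp: differentiable_on_def differentiable_def has_derivative_at_withinI)
qed

lemma Ck_Suc_has_derivative:
  assumes "Ck (Suc k) f" shows "(f has_derivative frechet_derivative f (at x)) (at x)"
  using assms by (auto simp: differentiable_on_def frechet_derivative_works)

lemma Ck_SucD: "Ck (Suc k) f \<Longrightarrow> Ck k f"
proof (induction k arbitrary: f)
  case 0
  then show ?case by (auto intro: differentiable_imp_continuous_on)
next
  case (Suc k)
  then show ?case by (metis Ck.simps(2))
qed

lemma Ck_const: "Ck k (\<lambda>x. c)"
proof (induction k arbitrary: c)
  case (Suc k)
  then show ?case by (intro Ck_SucI[where D = "\<lambda>x v. 0"]) auto
qed simp

lemma Ck_add: "Ck k f \<Longrightarrow> Ck k g \<Longrightarrow> Ck k (\<lambda>x. f x + g x)"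
proof (induction k arbitrary: f g)
  case 0
  then show ?case by (simp add: continuous_intros)
next
  case (Suc k)
  show ?case
    by (rule Ck_SucI[OF has_derivative_add[OF Suc.prems[THEN Ck_Suc_has_derivative]]])
      (use Suc in auto)
qed

lemma Ck_mult: "Ck k f \<Longrightarrow> Ck k g \<Longrightarrow> Ck k (\<lambda>x. f x * g x)"
proof (induction k arbitrary: f g)
  case 0
  then show ?case by (simp add: continuous_intros)
next
  case (Suc k)
  show ?case
  proof (rule Ck_SucI[OF has_derivative_mult[OF Suc.prems[THEN Ck_Suc_has_derivative]]])
    fix v
    show "Ck k (\<lambda>x. f x * frechet_derivative g (at x) v + frechet_derivative f (at x) v * g x)"
      using Suc.prems Suc.prems[THEN Ck_SucD] by (intro Ck_add Suc.IH) auto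
  qed
qed

lemma Ck_prod:
  assumes "finite I" "\<And>i. i \<in> I \<Longrightarrow> Ck k (f i)"
  shows "Ck k (\<lambda>x. \<Prod>i\<in>I. f i x)"
  using assms by (induction I rule: finite_induct) (auto intro: Ck_const Ck_mult)

lemma Ck_translate: "Ck k f \<Longrightarrow> Ck k (\<lambda>x. f (x - c))"
proof (induction k arbitrary: f)
  case 0
  then show ?case by (auto intro!: continuous_intros continuous_on_compose2[of UNIV f])
next
  case (Suc k)
  show ?case
  proof (rule Ck_SucI)
    fix x v
    show "((\<lambda>x. f (x - c)) has_derivative (\<lambda>v. frechet_derivative f (at (x - c)) v)) (at x)"
      by (rule has_derivative_compose[OF _ Ck_Suc_has_derivative[OF Suc.prems], of "\<lambda>x. x - c" "\<lambda>v. v" x UNIV])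
        (auto intro!: derivative_eq_intros)
    show "Ck k (\<lambda>x. frechet_derivative f (at (x - c)) v)"
      using Suc.prems by (intro Suc.IH) auto
  qed
qed

lemma Ck_compose_affine:
  fixes g :: "real \<Rightarrow> real" and a :: "'a::euclidean_space"
  assumes "Ck k g" shows "Ck k (\<lambda>x. g (c * (x \<bullet> a) + d))"
  using assms
proof (induction k arbitrary: g)
  case 0
  then show ?case by (auto intro!: continuous_intros continuous_on_compose2[of UNIV g])
next
  case (Suc k)
  show ?case
  proof (rule Ck_SucI)
    fix x :: 'a
    have "((\<lambda>x. g (c * (x \<bullet> a) + d)) has_derivative
        (\<lambda>v. frechet_derivative g (at (c * (x \<bullet> a) + d)) (c * (v \<bullet> a)))) (at x)"
      by (rule has_derivative_compose[OF _ Ck_Suc_has_derivative[OF Suc.prems],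
            of "\<lambda>x. c * (x \<bullet> a) + d" "\<lambda>v. c * (v \<bullet> a)" x UNIV])
        (auto intro!: derivative_eq_intros)
    moreover have lin: "frechet_derivative g (at s) h = h * frechet_derivative g (at s) 1" for s h :: real
      using linear_frechet_derivative[of g "at s"] Suc.prems linear_cmul[of "frechet_derivative g (at s)" h 1]
      by (auto simp: differentiable_on_def)
    ultimately show "((\<lambda>x. g (c * (x \<bullet> a) + d)) has_derivative
        (\<lambda>v. (c * (v \<bullet> a)) * frechet_derivative g (at (c * (x \<bullet> a) + d)) 1)) (at x)"
      by (subst (asm) lin)
  next
    fix v :: 'a
    show "Ck k (\<lambda>x. (c * (v \<bullet> a)) * frechet_derivative g (at (c * (x \<bullet> a) + d)) 1)"
      using Suc.prems by (intro Ck_mult Ck_const Suc.IH) auto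
  qed
qed

text \<open>Smoothness of \<open>exp (- 1 / s)\<close> at \<open>0\<close> is proved by induction, which needs a family that
  contains the derivatives: polynomials in \<open>1 / s\<close> times \<open>exp (- 1 / s)\<close>.\<close>

definition flat_exp :: "real poly \<Rightarrow> real \<Rightarrow> real" where
  "flat_exp p s = (if 0 < s then poly p (1 / s) * exp (- 1 / s) else 0)"

lemma poly_exp_minus_at_top: "((\<lambda>x. poly p x * exp (- x)) \<longlongrightarrow> (0::real)) at_top"
proof -
  have "((\<lambda>x. \<Sum>i\<le>degree p. coeff p i * (x ^ i / exp x)) \<longlongrightarrow> (\<Sum>i\<le>degree p. coeff p i * 0)) at_top"
    by (intro tendsto_sum tendsto_mult tendsto_const tendsto_power_div_exp_0)
  then show ?thesis
    by (simp add: poly_altdef exp_minus sum_distrib_right divide_inverse mult.assoc)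
qed

lemma flat_exp_tendsto_0: "(flat_exp p \<longlongrightarrow> 0) (at 0)"
proof (rule filterlim_split_at)
  show "(flat_exp p \<longlongrightarrow> 0) (at_left 0)"
    by (rule tendsto_eventually) (auto simp: flat_exp_def eventually_at_filter)
  have "((\<lambda>s. poly p (inverse s) * exp (- inverse s)) \<longlongrightarrow> 0) (at_right 0)"
    by (rule filterlim_compose[OF poly_exp_minus_at_top filterlim_inverse_at_top_right])
  then show "(flat_exp p \<longlongrightarrow> 0) (at_right 0)"
    by (rule Lim_transform_eventually)
      (auto simp: flat_exp_def eventually_at_filter inverse_eq_divide)
qed

lemma flat_exp_has_derivative:
  "(flat_exp p has_field_derivative flat_exp ([:0, 0, 1:] * (p - pderiv p)) s) (at s)"
proof -
  consider "s < 0" | "s = 0" | "0 < s" by linarith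
  then show ?thesis
  proof cases
    case 1
    have "((\<lambda>s. 0) has_field_derivative 0) (at s)" by simp
    from has_field_derivative_transform_within_open[OF this open_lessThan[of 0]]
    show ?thesis using 1 by (simp add: flat_exp_def)
  next
    case 2
    have "((\<lambda>h. (flat_exp p (0 + h) - flat_exp p 0) / h) \<longlongrightarrow> 0) (at 0)"
    proof (rule Lim_transform_eventually[OF flat_exp_tendsto_0[of "pCons 0 p"]])
      show "\<forall>\<^sub>F h in at 0. flat_exp (pCons 0 p) h = (flat_exp p (0 + h) - flat_exp p 0) / h"
        by (auto simp: flat_exp_def eventually_at_filter)
    qed
    then show ?thesis using 2 by (simp add: DERIV_def flat_exp_def)
  next
    case 3
    have inv: "((\<lambda>s. 1 / s) has_field_derivative - (1 / s\<^sup>2)) (at s)"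
      "((\<lambda>s. - 1 / s) has_field_derivative 1 / s\<^sup>2) (at s)"
      using 3 by (auto intro!: derivative_eq_intros simp: power2_eq_square)
    from DERIV_mult[OF DERIV_chain2[OF poly_DERIV inv(1)] DERIV_fun_exp[OF inv(2)]]
    have "((\<lambda>s. poly p (1 / s) * exp (- 1 / s)) has_field_derivative
        flat_exp ([:0, 0, 1:] * (p - pderiv p)) s) (at s)"
      by (rule DERIV_cong) (use 3 in \<open>simp add: flat_exp_def field_simps power2_eq_square\<close>)
    from has_field_derivative_transform_within_open[OF this open_greaterThan[of 0]]
    show ?thesis using 3 by (simp add: flat_exp_def[of p])
  qed
qed

lemma Ck_flat_exp: "Ck k (flat_exp p)"
proof (induction k arbitrary: p)
  case 0
  then show ?case
    using flat_exp_has_derivative by (auto intro!: DERIV_isCont continuous_at_imp_continuous_on)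
next
  case (Suc k)
  show ?case
  proof (rule Ck_SucI)
    show "(flat_exp p has_derivative (\<lambda>v. flat_exp ([:0, 0, 1:] * (p - pderiv p)) s * v)) (at s)" for s
      using flat_exp_has_derivative[of p s] by (simp add: has_field_derivative_def)
    show "Ck k (\<lambda>s. flat_exp ([:0, 0, 1:] * (p - pderiv p)) s * v)" for v
      by (intro Ck_mult Ck_const Suc.IH)
  qed
qed

text \<open>A smooth bump that is positive exactly on the box and tends to its indicator as \<open>c\<close> tends to
  infinity, because \<open>exp (- 1 / (c * s))\<close> tends to \<open>1\<close> for \<open>s > 0\<close>.\<close>

definition box_bump :: "'a::euclidean_space \<Rightarrow> 'a \<Rightarrow> real \<Rightarrow> 'a \<Rightarrow> real" where
  "box_bump a b c x = (\<Prod>i\<in>Basis. flat_exp 1 (c * (x \<bullet> i - a \<bullet> i)) * flat_exp 1 (c * (b \<bullet> i - x \<bullet> i)))"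

lemma flat_exp_1_bounds: "0 \<le> flat_exp 1 s" "flat_exp 1 s \<le> 1"
  by (auto simp: flat_exp_def)

lemma flat_exp_1_eq_0_iff: "flat_exp 1 s = 0 \<longleftrightarrow> s \<le> 0"
  by (auto simp: flat_exp_def)

lemma box_bump_bounds: "0 \<le> box_bump a b c x" "box_bump a b c x \<le> 1"
  unfolding box_bump_def using flat_exp_1_bounds
  by (auto intro!: prod_nonneg prod_le_1 mult_le_one)

lemma box_bump_nonzero_iff: "0 < c \<Longrightarrow> box_bump a b c x \<noteq> 0 \<longleftrightarrow> x \<in> box a b"
  by (auto simp: box_bump_def flat_exp_1_eq_0_iff mem_box mult_le_0_iff not_le)

lemma box_bump_tendsto: "(\<lambda>n. box_bump a b (Suc n) x) \<longlonglongrightarrow> indicator (box a b) x"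
proof (cases "x \<in> box a b")
  case True
  have lim: "(\<lambda>n. flat_exp 1 (Suc n * s)) \<longlonglongrightarrow> 1" if "0 < s" for s :: real
  proof -
    have "(\<lambda>n. exp (- (1 / s) * inverse (real (Suc n)))) \<longlonglongrightarrow> exp (- (1 / s) * 0)"
      by (intro tendsto_intros LIMSEQ_inverse_real_of_nat)
    moreover have "flat_exp 1 (Suc n * s) = exp (- (1 / s) * inverse (real (Suc n)))" for n
      using that by (simp add: flat_exp_def divide_inverse mult.commute del: of_nat_Suc)
    ultimately show ?thesis by simp
  qed
  have "(\<lambda>n. box_bump a b (Suc n) x) \<longlonglongrightarrow> (\<Prod>i\<in>(Basis::'a set). 1 * 1)"
    unfolding box_bump_def using True by (intro tendsto_prod tendsto_mult lim) (auto simp: mem_box)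
  then show ?thesis using True by simp
next
  case False
  then have "box_bump a b (Suc n) x = 0" for n using box_bump_nonzero_iff[of "Suc n"] by auto
  then show ?thesis using False by simp
qed

lemma box_bump_test_function:
  assumes "0 < c" "cbox a b \<subseteq> S" shows "box_bump a b c \<in> test_functions S"
proof -
  have "Ck k (\<lambda>x. flat_exp 1 (c * (x \<bullet> i) + - c * (a \<bullet> i)) * flat_exp 1 (- c * (x \<bullet> i) + c * (b \<bullet> i)))" for k i
    by (intro Ck_mult Ck_compose_affine Ck_flat_exp)
  then have "Ck k (box_bump a b c)" for k
    unfolding box_bump_def
    by (intro Ck_prod) (auto simp: algebra_simps)
  moreover have "closure {x. box_bump a b c x \<noteq> 0} \<subseteq> cbox a b"
    using box_subset_cbox[of a b] assms
    by (intro closure_minimal closed_cbox) (auto simp: box_bump_nonzero_iff)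
  moreover have "bounded {x. box_bump a b c x \<noteq> 0}"
    using assms by (simp add: box_bump_nonzero_iff)
  ultimately show ?thesis
    using assms(2) unfolding test_functions_def by simp
qed

lemma
  assumes "\<phi> \<in> test_functions S"
  shows test_function_has_derivative: "(\<phi> has_derivative frechet_derivative \<phi> (at x)) (at x)"
    and test_function_continuous: "continuous_on UNIV \<phi>"
    and test_function_deriv_continuous: "continuous_on UNIV (\<lambda>x. frechet_derivative \<phi> (at x) v)"
proof -
  have "Ck k \<phi>" for k using assms by (simp add: test_functions_def)
  from this[of 0] this[of "Suc 0"]
  show "(\<phi> has_derivative frechet_derivative \<phi> (at x)) (at x)" "continuous_on UNIV \<phi>"
    "continuous_on UNIV (\<lambda>x. frechet_derivative \<phi> (at x) v)"
    by (auto intro: Ck_Suc_has_derivative[of 0] simp: differentiable_on_def frechet_derivative_works)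
qed

lemma test_function_borel [measurable_dest]:
  "\<phi> \<in> test_functions S \<Longrightarrow> \<phi> \<in> borel_measurable borel"
  using test_function_continuous by (intro borel_measurable_continuous_onI)

lemma test_function_deriv_borel:
  "\<phi> \<in> test_functions S \<Longrightarrow> (\<lambda>x. frechet_derivative \<phi> (at x) v) \<in> borel_measurable borel"
  using test_function_deriv_continuous by (intro borel_measurable_continuous_onI)

lemma test_function_zero_outside:
  assumes "x \<notin> closure {x. \<phi> x \<noteq> 0}"
  shows "\<phi> x = 0" and "frechet_derivative \<phi> (at x) v = 0"
proof -
  show "\<phi> x = 0" using assms closure_subset by force
  have "((\<lambda>x. 0) has_derivative (\<lambda>v. 0)) (at x)" by simp
  then have "(\<phi> has_derivative (\<lambda>v. 0)) (at x)"
    by (rule has_derivative_transform_within_open[OF _ open_Compl[OF closed_closure, of "{x. \<phi> x \<noteq> 0}"]])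
      (use assms closure_subset[of "{x. \<phi> x \<noteq> 0}"] in auto)
  from frechet_derivative_at[OF this] show "frechet_derivative \<phi> (at x) v = 0" by metis
qed

lemma bounded_if_zero_outside_compact:
  fixes f :: "'a::metric_space \<Rightarrow> real"
  assumes "continuous_on UNIV f" "compact K" "\<And>x. x \<notin> K \<Longrightarrow> f x = 0"
  obtains B where "0 \<le> B" "\<And>x. \<bar>f x\<bar> \<le> B"
proof -
  have "compact (f ` K)"
    using assms by (intro compact_continuous_image) (auto intro: continuous_on_subset)
  then obtain B where "\<And>y. y \<in> f ` K \<Longrightarrow> norm y \<le> B"
    using compact_imp_bounded bounded_iff by metis
  then have "\<bar>f x\<bar> \<le> max 0 B" for x
    using assms(3)[of x] by (cases "x \<in> K") (auto simp: le_max_iff_disj)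
  then show thesis using that[of "max 0 B"] by simp
qed

lemma test_function_bounded:
  assumes "\<phi> \<in> test_functions S"
  obtains B where "0 \<le> B" "\<And>x. \<bar>\<phi> x\<bar> \<le> B"
proof (rule bounded_if_zero_outside_compact)
  show "continuous_on UNIV \<phi>" using assms by (rule test_function_continuous)
  show "compact (closure {x. \<phi> x \<noteq> 0})" using assms by (simp add: test_functions_def)
qed (auto intro: that test_function_zero_outside)

lemma test_function_deriv_bounded:
  assumes "\<phi> \<in> test_functions S"
  obtains B where "0 \<le> B" "\<And>x. \<bar>frechet_derivative \<phi> (at x) v\<bar> \<le> B"
proof (rule bounded_if_zero_outside_compact)
  show "continuous_on UNIV (\<lambda>x. frechet_derivative \<phi> (at x) v)"
    using assms by (rule test_function_deriv_continuous)
  show "compact (closure {x. \<phi> x \<noteq> 0})" using assms by (simp add: test_functions_def)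
qed (auto intro: that test_function_zero_outside)

text \<open>Translates of test functions are what connects the weak derivative at different points of a
  line.\<close>

lemma test_function_translate:
  assumes \<phi>: "\<phi> \<in> test_functions S" and sub: "\<And>x. x \<in> S \<Longrightarrow> x + c \<in> T"
  shows "(\<lambda>x. \<phi> (x - c)) \<in> test_functions T"
    and "frechet_derivative (\<lambda>x. \<phi> (x - c)) (at x) v = frechet_derivative \<phi> (at (x - c)) v"
proof -
  have supp: "{x. \<phi> (x - c) \<noteq> 0} = (+) c ` {x. \<phi> x \<noteq> 0}"
    by (auto simp: image_iff) (metis add_diff_cancel_left' diff_add_cancel add.commute)
  have "closure {x. \<phi> (x - c) \<noteq> 0} = (+) c ` closure {x. \<phi> x \<noteq> 0}"
    by (simp add: supp closure_translation)
  moreover have "bounded {x. \<phi> (x - c) \<noteq> 0}"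
    unfolding supp using \<phi> by (intro bounded_translation) (simp add: test_functions_def)
  ultimately show "(\<lambda>x. \<phi> (x - c)) \<in> test_functions T"
    using \<phi> sub by (auto simp: test_functions_def Ck_translate add.commute[of c])
  have "((\<lambda>x. \<phi> (x - c)) has_derivative (\<lambda>v. frechet_derivative \<phi> (at (x - c)) v)) (at x)"
    by (rule has_derivative_compose[OF _ test_function_has_derivative[OF \<phi>], of "\<lambda>x. x - c" "\<lambda>v. v" x UNIV])
      (auto intro!: derivative_eq_intros)
  from frechet_derivative_at[OF this]
  show "frechet_derivative (\<lambda>x. \<phi> (x - c)) (at x) v = frechet_derivative \<phi> (at (x - c)) v" by metis
qed

lemma integrable_mult_bounded:
  fixes f g :: "'a \<Rightarrow> real"
  assumes f: "integrable M f" and [measurable]: "g \<in> borel_measurable M" and B: "\<And>x. \<bar>g x\<bar> \<le> B"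
  shows "integrable M (\<lambda>x. f x * g x)"
proof (rule Bochner_Integration.integrable_bound)
  show "integrable M (\<lambda>x. B * f x)" using f by simp
  show "(\<lambda>x. f x * g x) \<in> borel_measurable M" using f by measurable
  show "AE x in M. norm (f x * g x) \<le> norm (B * f x)"
    using B by (intro AE_I2) (auto simp: abs_mult mult.commute[of B] intro!: mult_left_mono order_trans[OF B])
qed

text \<open>The open boxes form an intersection-stable generator of the Borel sets, so by Dynkin's theorem
  the integral of \<open>f\<close> vanishes over every Borel set.\<close>

lemma AE_zero_if_integral_boxes_zero:
  fixes f :: "'a::euclidean_space \<Rightarrow> real"
  assumes f: "integrable lborel f"
    and box: "\<And>a b. (LINT x|lborel. indicator (box a b) x * f x) = 0"
  shows "AE x in lborel. f x = 0"
proof (rule density_unique_real[OF f])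
  have [measurable]: "f \<in> borel_measurable borel" using f by auto
  show "integrable lborel (\<lambda>x. 0::real)" by simp
  have total: "(LINT x|lborel. f x) = 0"
  proof -
    have "(\<lambda>n::nat. LINT x|lborel. indicator (box (- real n *\<^sub>R One) (real n *\<^sub>R One)) x * f x) \<longlonglongrightarrow> (LINT x|lborel. f x)"
    proof (rule integral_dominated_convergence[where w = "\<lambda>x. \<bar>f x\<bar>"])
      show "AE x in lborel. (\<lambda>n::nat. indicator (box (- real n *\<^sub>R One) (real n *\<^sub>R One)) x * f x) \<longlonglongrightarrow> f x"
      proof (intro AE_I2)
        fix x :: 'a
        obtain N :: nat where N: "norm x < N" using reals_Archimedean2 by blast
        have "x \<in> box (- real n *\<^sub>R One) (real n *\<^sub>R One)" if "n \<ge> N" for n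
        proof -
          have "norm x < real n" using N that by simp
          then have "\<bar>x \<bullet> i\<bar> < real n" if "i \<in> Basis" for i
            using Basis_le_norm[OF that, of x] by simp
          then show ?thesis by (fastforce simp: mem_box abs_less_iff)
        qed
        then have "\<forall>\<^sub>F n in sequentially. indicator (box (- real n *\<^sub>R One) (real n *\<^sub>R One)) x * f x = f x"
          by (intro eventually_sequentiallyI[of N]) simp
        then show "(\<lambda>n::nat. indicator (box (- real n *\<^sub>R One) (real n *\<^sub>R One)) x * f x) \<longlonglongrightarrow> f x"
          by (rule tendsto_eventually)
      qed
    qed (use f in \<open>auto intro!: AE_I2 split: split_indicator\<close>)
    then have "(\<lambda>n::nat. 0::real) \<longlonglongrightarrow> (LINT x|lborel. f x)" by (simp only: box)
    then show ?thesis by (simp add: LIMSEQ_const_iff)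
  qed
  fix A :: "'a set" assume "A \<in> sets lborel"
  then have A: "A \<in> sigma_sets UNIV (range (\<lambda>(a, b). box a b))"
    by (simp add: borel_eq_box)
  have stable: "Int_stable (range (\<lambda>(a, b). box a b :: 'a set))"
    by (auto simp: Int_stable_def box_Int_box)
  have "range (\<lambda>(a, b). box a b :: 'a set) \<subseteq> Pow UNIV" by simp
  from stable this A have "(LINT x|lborel. indicator A x * f x) = 0"
  proof (induction rule: sigma_sets_induct_disjoint)
    case (basic A)
    then show ?case using box by auto
  next
    case empty
    then show ?case by simp
  next
    case (compl A)
    then have [measurable]: "A \<in> sets borel" by (simp add: borel_eq_box)
    have "(LINT x|lborel. indicator (UNIV - A) x * f x) = (LINT x|lborel. f x - indicator A x * f x)"
      by (intro Bochner_Integration.integral_cong) (auto split: split_indicator)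
    also have "\<dots> = (LINT x|lborel. f x) - (LINT x|lborel. indicator A x * f x)"
      using f integrable_real_mult_indicator[of A lborel f]
      by (intro Bochner_Integration.integral_diff) (auto simp: mult.commute)
    finally show ?case using compl total by simp
  next
    case (union A)
    then have [measurable]: "A i \<in> sets borel" for i by (auto simp: borel_eq_box)
    have "(LINT x:(\<Union>i. A i)|lborel. f x) = (\<Sum>i. LINT x:A i|lborel. f x)"
    proof (rule lebesgue_integral_countable_add)
      show "set_integrable lborel (\<Union>i. A i) f"
        using integrable_real_mult_indicator[OF _ f, of "\<Union>i. A i"]
        by (simp add: set_integrable_def mult.commute)
      show "A i \<inter> A j = {}" if "i \<noteq> j" for i j
        using union.hyps(1) that by (auto simp: disjoint_family_on_def)
    qed simp
    then show ?case using union by (simp add: set_lebesgue_integral_def)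
  qed
  then show "(LINT x:A|lborel. f x) = (LINT x:A|lborel. 0)"
    by (simp add: set_lebesgue_integral_def)
qed

text \<open>The fundamental lemma of the calculus of variations. Bumps converge to indicators of boxes,
  hence the integral of \<open>f\<close> vanishes over all boxes inside \<open>S\<close>, and \<open>S\<close> is a countable union of
  boxes.\<close>

theorem AE_zero_if_test_integrals_zero:
  fixes f :: "'a::euclidean_space \<Rightarrow> real"
  assumes S: "open S" and f: "integrable lborel f"
    and zero: "\<And>\<phi>. \<phi> \<in> test_functions S \<Longrightarrow> (LINT x|lborel. f x * \<phi> x) = 0"
  shows "AE x in lborel. x \<in> S \<longrightarrow> f x = 0"
proof -
  have [measurable]: "f \<in> borel_measurable borel" using f by auto
  have box: "(LINT x|lborel. indicator (box a b) x * f x) = 0" if ab: "cbox a b \<subseteq> S" for a b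
  proof -
    have [measurable]: "box_bump a b (Suc n) \<in> borel_measurable borel" for n
      using box_bump_test_function[OF _ ab, of "Suc n"] by (intro test_function_borel) auto
    have "(\<lambda>n. LINT x|lborel. f x * box_bump a b (Suc n) x) \<longlonglongrightarrow> (LINT x|lborel. f x * indicator (box a b) x)"
    proof (rule integral_dominated_convergence[where w = "\<lambda>x. \<bar>f x\<bar>"])
      show "AE x in lborel. norm (f x * box_bump a b (Suc n) x) \<le> \<bar>f x\<bar>" for n
        using box_bump_bounds[of a b "Suc n"] by (intro AE_I2) (auto simp: abs_mult intro!: mult_left_le)
      show "AE x in lborel. (\<lambda>n. f x * box_bump a b (Suc n) x) \<longlonglongrightarrow> f x * indicator (box a b) x"
        by (intro AE_I2 tendsto_mult tendsto_const box_bump_tendsto)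
      show "(\<lambda>x. f x * box_bump a b (Suc n) x) \<in> borel_measurable lborel" for n
        by measurable
    qed (use f in auto)
    then show ?thesis
      by (simp add: zero[OF box_bump_test_function[OF _ ab]] LIMSEQ_const_iff mult.commute)
  qed
  obtain D where D: "countable D" "\<And>X. X \<in> D \<Longrightarrow> \<exists>a b. X = cbox a b" "\<Union>D = S"
    using open_countable_Union_open_cbox[OF S] by metis
  have "AE x in lborel. x \<in> X \<longrightarrow> f x = 0" if "X \<in> D" for X
  proof -
    obtain c d where X: "X = cbox c d" using D(2)[OF \<open>X \<in> D\<close>] by blast
    then have sub: "cbox c d \<subseteq> S" using D(3) \<open>X \<in> D\<close> by auto
    have "AE x in lborel. indicator (box c d) x * f x = 0"
    proof (rule AE_zero_if_integral_boxes_zero)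
      show "integrable lborel (\<lambda>x. indicator (box c d) x * f x)"
        using integrable_real_mult_indicator[OF _ f, of "box c d"] by (simp add: mult.commute)
      fix a b :: 'a
      obtain a' b' where ab: "box a b \<inter> box c d = box a' b'" by (simp add: box_Int_box)
      have "(LINT x|lborel. indicator (box a b) x * (indicator (box c d) x * f x))
          = (LINT x|lborel. indicator (box a' b') x * f x)"
        by (simp flip: ab add: indicator_inter_arith mult.assoc)
      also have "\<dots> = 0"
      proof (cases "box a' b' = {}")
        case False
        then have "cbox a' b' = closure (box a' b')" by (simp add: closure_box)
        also have "\<dots> \<subseteq> closure (box c d)" using ab by (intro closure_mono) auto
        also have "\<dots> \<subseteq> cbox c d" using box_subset_cbox by (rule closure_minimal) (rule closed_cbox)
        finally show ?thesis using sub by (intro box) auto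
      qed simp
      finally show "(LINT x|lborel. indicator (box a b) x * (indicator (box c d) x * f x)) = 0" .
    qed
    moreover have "AE x in lborel. x \<notin> cbox c d - box c d"
    proof (rule AE_not_in)
      show "cbox c d - box c d \<in> null_sets lborel"
        using negligible_frontier_interval[of c d] by (auto simp: negligible_iff_null_sets null_sets_def)
    qed
    ultimately show ?thesis
      by eventually_elim (auto simp: X indicator_eq_0_iff)
  qed
  then have "AE x in lborel. \<forall>X\<in>D. x \<in> X \<longrightarrow> f x = 0"
    using D(1) by (subst AE_ball_countable) auto
  then show ?thesis by eventually_elim (use D(3) in auto)
qed

section \<open>Weak derivatives along lines\<close>

text \<open>Square-integrable Borel functions on the domain, extended by zero. On the whole space
  translation invariance and Fubini apply directly, and no completion of measures interferes
  with product measurability.\<close>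

definition extended_L2 :: "'a::euclidean_space set \<Rightarrow> ('a \<Rightarrow> 'b::euclidean_space) set" where
  "extended_L2 \<Omega> = {u. sq_integrable lborel u \<and> (\<forall>x. x \<notin> \<Omega> \<longrightarrow> u x = 0)}"

lemma extended_L2_sq_integrable: "u \<in> extended_L2 \<Omega> \<Longrightarrow> sq_integrable lborel u"
  by (simp add: extended_L2_def)

lemma extended_L2_borel [measurable_dest]: "u \<in> extended_L2 \<Omega> \<Longrightarrow> u \<in> borel_measurable borel"
  by (auto simp: extended_L2_def sq_integrable_def)

lemma extended_L2_outside: "u \<in> extended_L2 \<Omega> \<Longrightarrow> x \<notin> \<Omega> \<Longrightarrow> u x = 0"
  by (simp add: extended_L2_def)

lemma extended_L2_add: "u \<in> extended_L2 \<Omega> \<Longrightarrow> v \<in> extended_L2 \<Omega> \<Longrightarrow> (\<lambda>x. u x + v x) \<in> extended_L2 \<Omega>"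
  by (simp add: extended_L2_def sq_integrable_add)

lemma extended_L2_diff: "u \<in> extended_L2 \<Omega> \<Longrightarrow> v \<in> extended_L2 \<Omega> \<Longrightarrow> (\<lambda>x. u x - v x) \<in> extended_L2 \<Omega>"
  by (simp add: extended_L2_def sq_integrable_diff)

lemma extended_L2_scaleR: "u \<in> extended_L2 \<Omega> \<Longrightarrow> (\<lambda>x. c *\<^sub>R u x) \<in> extended_L2 \<Omega>"
  by (simp add: extended_L2_def sq_integrable_scaleR)

lemma integral_translate:
  fixes f :: "'a::euclidean_space \<Rightarrow> real"
  assumes [measurable]: "f \<in> borel_measurable borel"
  shows "(LINT x|lborel. f (x + c)) = (LINT x|lborel. f x)"
    and "integrable lborel (\<lambda>x. f (x + c)) \<longleftrightarrow> integrable lborel f"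
proof -
  have "(LINT x|lborel. f x) = (LINT x|distr lborel borel ((+) c). f x)"
    by (simp add: lborel_distr_plus)
  also have "\<dots> = (LINT x|lborel. f (x + c))"
    by (subst integral_distr) (auto simp: add.commute)
  finally show "(LINT x|lborel. f (x + c)) = (LINT x|lborel. f x)" by simp
  have "integrable lborel f \<longleftrightarrow> integrable (distr lborel borel ((+) c)) f"
    by (simp add: lborel_distr_plus)
  also have "\<dots> \<longleftrightarrow> integrable lborel (\<lambda>x. f (x + c))"
    by (subst integrable_distr_eq) (auto simp: add.commute)
  finally show "integrable lborel (\<lambda>x. f (x + c)) \<longleftrightarrow> integrable lborel f" by simp
qed

lemma integrable_sheared_product:
  fixes f :: "'a::euclidean_space \<Rightarrow> real" and g :: "real \<Rightarrow> real"
  assumes f: "integrable lborel f" and g: "integrable lborel g"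
  shows "integrable (lborel \<Otimes>\<^sub>M lborel) (\<lambda>(t, x). g t * f (x + t *\<^sub>R c))"
proof (rule lborel_pair.Fubini_integrable)
  have [measurable]: "f \<in> borel_measurable borel" "g \<in> borel_measurable borel" using f g by auto
  show "(\<lambda>(t, x). g t * f (x + t *\<^sub>R c)) \<in> borel_measurable (lborel \<Otimes>\<^sub>M lborel)" by measurable
  have "(LINT x|lborel. norm (g t * f (x + t *\<^sub>R c))) = norm (g t) * (LINT x|lborel. norm (f x))" for t
    using integral_translate(1)[of "\<lambda>x. norm (f x)" "t *\<^sub>R c"] by (simp add: abs_mult)
  then show "integrable lborel (\<lambda>t. LINT x|lborel. norm (case (t, x) of (t, x) \<Rightarrow> g t * f (x + t *\<^sub>R c)))"
    using g by simp
  show "AE t in lborel. integrable lborel (\<lambda>x. case (t, x) of (t, x) \<Rightarrow> g t * f (x + t *\<^sub>R c))"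
    using f by (intro AE_I2) (simp add: integral_translate(2))
qed

context bounded_domain
begin

lemma extended_L2_integrable:
  fixes u :: "'a \<Rightarrow> 'b::euclidean_space"
  assumes "u \<in> extended_L2 \<Omega>" shows "integrable lborel u"
proof (rule Bochner_Integration.integrable_bound)
  show "integrable lborel (\<lambda>x. indicator \<Omega> x + (norm (u x))\<^sup>2)"
    using assms emeasure_domain_finite
    by (intro Bochner_Integration.integrable_add) (auto simp: extended_L2_def sq_integrable_def)
  have "norm (u x) \<le> indicator \<Omega> x + (norm (u x))\<^sup>2" for x
  proof (cases "x \<in> \<Omega>")
    case True
    have "0 \<le> (norm (u x) - 1)\<^sup>2" by simp
    then have "2 * norm (u x) \<le> 1 + (norm (u x))\<^sup>2" by (simp add: power2_diff)
    then have "norm (u x) \<le> 1 + (norm (u x))\<^sup>2" using norm_ge_zero[of "u x"] by linarith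
    then show ?thesis using True by simp
  qed (use assms in \<open>simp add: extended_L2_outside\<close>)
  then show "AE x in lborel. norm (u x) \<le> norm (indicator \<Omega> x + (norm (u x))\<^sup>2)"
    by (auto intro!: AE_I2 order_trans[OF _ abs_ge_self])
qed (use assms in \<open>simp add: extended_L2_borel\<close>)

lemma integral_lebesgue_on_domain:
  fixes f :: "'a \<Rightarrow> real"
  assumes [measurable]: "f \<in> borel_measurable borel" and zero: "\<And>x. x \<notin> \<Omega> \<Longrightarrow> f x = 0"
  shows "(LINT x|lebesgue_on \<Omega>. f x) = (LINT x|lborel. f x)"
    and "integrable (lebesgue_on \<Omega>) f \<longleftrightarrow> integrable lborel f"
proof -
  have ind: "(\<lambda>x. indicator \<Omega> x * f x) = f" using zero by (auto simp: fun_eq_iff indicator_def)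
  show "(LINT x|lebesgue_on \<Omega>. f x) = (LINT x|lborel. f x)"
    by (subst integral_restrict_space) (simp_all add: ind domain_lebesgue integral_completion)
  show "integrable (lebesgue_on \<Omega>) f \<longleftrightarrow> integrable lborel f"
    by (subst integrable_restrict_space) (simp_all add: ind domain_lebesgue integrable_completion)
qed

lemma borel_measurable_lebesgue_on_domain:
  "f \<in> borel_measurable borel \<Longrightarrow> f \<in> borel_measurable (lebesgue_on \<Omega>)"
  by (intro measurable_restrict_space1 measurable_completion) simp

lemma extended_L2_L2_fun:
  fixes u :: "'a \<Rightarrow> real"
  assumes u: "u \<in> extended_L2 \<Omega>" shows "u \<in> L2_fun (lebesgue_on \<Omega>)"
proof -
  have [measurable]: "u \<in> borel_measurable borel" using u by (rule extended_L2_borel)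
  have "integrable (lebesgue_on \<Omega>) (\<lambda>x. (u x)\<^sup>2) \<longleftrightarrow> integrable lborel (\<lambda>x. (u x)\<^sup>2)"
    by (rule integral_lebesgue_on_domain(2)) (use u in \<open>auto simp: extended_L2_outside\<close>)
  then show ?thesis
    using u by (auto simp: L2_fun_def extended_L2_def sq_integrable_def
        intro: borel_measurable_lebesgue_on_domain)
qed

lemma L2_fun_borel_version:
  assumes u: "u \<in> L2_fun (lebesgue_on \<Omega>)"
  obtains u' where "u' \<in> extended_L2 \<Omega>" "AE x in lebesgue_on \<Omega>. u' x = u x"
proof -
  have meas: "u \<in> borel_measurable (lebesgue_on \<Omega>)" and int: "integrable (lebesgue_on \<Omega>) (\<lambda>x. (u x)\<^sup>2)"
    using u by (auto simp: L2_fun_def)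
  have "(\<lambda>x. u x * indicator \<Omega> x) \<in> borel_measurable lebesgue"
    using meas domain_lebesgue by (subst (asm) borel_measurable_restrict_space_iff) (auto simp: mult.commute)
  then obtain g where g[measurable]: "g \<in> borel_measurable lborel"
    and ae: "AE x in lborel. u x * indicator \<Omega> x = g x"
    using completion_ex_borel_measurable_real by blast
  define u' where "u' x = indicator \<Omega> x * g x" for x
  have u'[measurable]: "u' \<in> borel_measurable borel" unfolding u'_def using g by measurable
  have eq: "AE x in lebesgue_on \<Omega>. u' x = u x"
    unfolding AE_lebesgue_on_domain using ae by eventually_elim (auto simp: u'_def)
  have "integrable (lebesgue_on \<Omega>) (\<lambda>x. (u' x)\<^sup>2)"
  proof (rule integrable_cong_AE_imp[OF int])
    show "(\<lambda>x. (u' x)\<^sup>2) \<in> borel_measurable (lebesgue_on \<Omega>)"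
      by (rule borel_measurable_lebesgue_on_domain) measurable
    show "AE x in lebesgue_on \<Omega>. (u x)\<^sup>2 = (u' x)\<^sup>2" using eq by eventually_elim simp
  qed
  then have "integrable lborel (\<lambda>x. (u' x)\<^sup>2)"
    by (subst (asm) integral_lebesgue_on_domain(2)) (auto simp: u'_def)
  then have "u' \<in> extended_L2 \<Omega>"
    using u' by (auto simp: extended_L2_def sq_integrable_def u'_def)
  then show thesis using eq by (rule that)
qed

lemma has_weak_deriv_iff:
  assumes u: "u \<in> extended_L2 \<Omega>" and v: "v \<in> extended_L2 \<Omega>"
  shows "has_weak_deriv \<Omega> e u v \<longleftrightarrow>
    (\<forall>\<phi>\<in>test_functions \<Omega>. (LINT x|lborel. u x * frechet_derivative \<phi> (at x) e) = - (LINT x|lborel. v x * \<phi> x))"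
  unfolding has_weak_deriv_def
proof (rule ball_cong[OF refl])
  fix \<phi> assume \<phi>: "\<phi> \<in> test_functions \<Omega>"
  note [measurable] = extended_L2_borel[OF u] extended_L2_borel[OF v]
    test_function_borel[OF \<phi>] test_function_deriv_borel[OF \<phi>]
  have "(LINT x|lebesgue_on \<Omega>. u x * frechet_derivative \<phi> (at x) e) = (LINT x|lborel. u x * frechet_derivative \<phi> (at x) e)"
    by (rule integral_lebesgue_on_domain) (simp_all add: extended_L2_outside[OF u])
  moreover have "(LINT x|lebesgue_on \<Omega>. v x * \<phi> x) = (LINT x|lborel. v x * \<phi> x)"
    by (rule integral_lebesgue_on_domain) (simp_all add: extended_L2_outside[OF v])
  ultimately show "(LINT x|lebesgue_on \<Omega>. u x * frechet_derivative \<phi> (at x) e) = - (LINT x|lebesgue_on \<Omega>. v x * \<phi> x)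
      \<longleftrightarrow> (LINT x|lborel. u x * frechet_derivative \<phi> (at x) e) = - (LINT x|lborel. v x * \<phi> x)"
    by simp
qed

lemma has_weak_deriv_AE_cong:
  assumes "u \<in> L2_fun (lebesgue_on \<Omega>)" "u' \<in> L2_fun (lebesgue_on \<Omega>)" "AE x in lebesgue_on \<Omega>. u x = u' x"
    and "v \<in> L2_fun (lebesgue_on \<Omega>)" "v' \<in> L2_fun (lebesgue_on \<Omega>)" "AE x in lebesgue_on \<Omega>. v x = v' x"
  shows "has_weak_deriv \<Omega> e u v \<longleftrightarrow> has_weak_deriv \<Omega> e u' v'"
  unfolding has_weak_deriv_def
proof (rule ball_cong[OF refl])
  fix \<phi> assume \<phi>: "\<phi> \<in> test_functions \<Omega>"
  have [measurable]: "u \<in> borel_measurable (lebesgue_on \<Omega>)" "u' \<in> borel_measurable (lebesgue_on \<Omega>)"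
    "v \<in> borel_measurable (lebesgue_on \<Omega>)" "v' \<in> borel_measurable (lebesgue_on \<Omega>)"
    using assms by (auto simp: L2_fun_def)
  note [measurable] = test_function_borel[OF \<phi>, THEN borel_measurable_lebesgue_on_domain]
    test_function_deriv_borel[OF \<phi>, THEN borel_measurable_lebesgue_on_domain]
  have "(LINT x|lebesgue_on \<Omega>. u x * frechet_derivative \<phi> (at x) e) = (LINT x|lebesgue_on \<Omega>. u' x * frechet_derivative \<phi> (at x) e)"
    by (rule integral_cong_AE) (measurable, use assms(3) in \<open>eventually_elim, simp\<close>)
  moreover have "(LINT x|lebesgue_on \<Omega>. v x * \<phi> x) = (LINT x|lebesgue_on \<Omega>. v' x * \<phi> x)"
    by (rule integral_cong_AE) (measurable, use assms(6) in \<open>eventually_elim, simp\<close>)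
  ultimately show "(LINT x|lebesgue_on \<Omega>. u x * frechet_derivative \<phi> (at x) e) = - (LINT x|lebesgue_on \<Omega>. v x * \<phi> x)
      \<longleftrightarrow> (LINT x|lebesgue_on \<Omega>. u' x * frechet_derivative \<phi> (at x) e) = - (LINT x|lebesgue_on \<Omega>. v' x * \<phi> x)"
    by simp
qed

lemma integrable_mult_test_function:
  assumes u: "u \<in> extended_L2 \<Omega>" and \<phi>: "\<phi> \<in> test_functions S"
  shows "integrable lborel (\<lambda>x. u x * \<phi> x)"
    and "integrable lborel (\<lambda>x. u x * frechet_derivative \<phi> (at x) e)"
proof -
  obtain B B' where "\<And>x. \<bar>\<phi> x\<bar> \<le> B" "\<And>x. \<bar>frechet_derivative \<phi> (at x) e\<bar> \<le> B'"
    using test_function_bounded[OF \<phi>] test_function_deriv_bounded[OF \<phi>] by metis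
  then show "integrable lborel (\<lambda>x. u x * \<phi> x)"
    "integrable lborel (\<lambda>x. u x * frechet_derivative \<phi> (at x) e)"
    using test_function_borel[OF \<phi>] test_function_deriv_borel[OF \<phi>]
    by (auto intro!: integrable_mult_bounded extended_L2_integrable[OF u])
qed

lemma extended_weak_deriv_unique:
  assumes v: "v \<in> extended_L2 \<Omega>" "v' \<in> extended_L2 \<Omega>"
    and eq: "\<And>\<phi>. \<phi> \<in> test_functions \<Omega> \<Longrightarrow> (LINT x|lborel. v x * \<phi> x) = (LINT x|lborel. v' x * \<phi> x)"
  shows "AE x in lborel. v x = v' x"
proof -
  have "AE x in lborel. x \<in> \<Omega> \<longrightarrow> v x - v' x = 0"
  proof (rule AE_zero_if_test_integrals_zero[OF open_domain])
    show "integrable lborel (\<lambda>x. v x - v' x)"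
      by (intro extended_L2_integrable extended_L2_diff v)
    fix \<phi> assume \<phi>: "\<phi> \<in> test_functions \<Omega>"
    have "(LINT x|lborel. (v x - v' x) * \<phi> x) = (LINT x|lborel. v x * \<phi> x) - (LINT x|lborel. v' x * \<phi> x)"
      unfolding left_diff_distrib
      by (rule Bochner_Integration.integral_diff[OF integrable_mult_test_function(1)[OF v(1) \<phi>]
            integrable_mult_test_function(1)[OF v(2) \<phi>]])
    then show "(LINT x|lborel. (v x - v' x) * \<phi> x) = 0" using eq[OF \<phi>] by simp
  qed
  then show ?thesis
    by eventually_elim (use v in \<open>auto simp: extended_L2_outside\<close>)
qed

lemma weak_deriv_unique:
  assumes v: "v \<in> L2_fun (lebesgue_on \<Omega>)" "v' \<in> L2_fun (lebesgue_on \<Omega>)"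
    and u: "u \<in> L2_fun (lebesgue_on \<Omega>)" "u' \<in> L2_fun (lebesgue_on \<Omega>)"
    and eq: "AE x in lebesgue_on \<Omega>. u x = u' x"
    and wd: "has_weak_deriv \<Omega> e u v" "has_weak_deriv \<Omega> e u' v'"
  shows "AE x in lebesgue_on \<Omega>. v x = v' x"
proof -
  obtain w where w: "w \<in> extended_L2 \<Omega>" "AE x in lebesgue_on \<Omega>. w x = u x"
    using L2_fun_borel_version[OF u(1)] .
  obtain z where z: "z \<in> extended_L2 \<Omega>" "AE x in lebesgue_on \<Omega>. z x = v x"
    using L2_fun_borel_version[OF v(1)] .
  obtain z' where z': "z' \<in> extended_L2 \<Omega>" "AE x in lebesgue_on \<Omega>. z' x = v' x"
    using L2_fun_borel_version[OF v(2)] .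
  have "AE x in lebesgue_on \<Omega>. w x = u' x" using w(2) eq by eventually_elim simp
  then have "has_weak_deriv \<Omega> e w z" "has_weak_deriv \<Omega> e w z'"
    using wd has_weak_deriv_AE_cong[OF extended_L2_L2_fun[OF w(1)] u(1) w(2) extended_L2_L2_fun[OF z(1)] v(1) z(2)]
      has_weak_deriv_AE_cong[OF extended_L2_L2_fun[OF w(1)] u(2) _ extended_L2_L2_fun[OF z'(1)] v(2) z'(2)]
    by auto
  then have "AE x in lborel. z x = z' x"
    using w(1) z(1) z'(1) by (intro extended_weak_deriv_unique) (auto simp: has_weak_deriv_iff)
  then have "AE x in lebesgue_on \<Omega>. z x = z' x"
    unfolding AE_lebesgue_on_domain by eventually_elim simp
  with z(2) z'(2) show ?thesis by eventually_elim simp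
qed

lemma norm_snd_le_norm: "norm (snd p) \<le> norm p" for p :: "real \<times> 'a::euclidean_space"
  using norm_snd_le[of "snd p" "fst p"] by simp

lemma extended_L2_components:
  fixes F :: "'a \<Rightarrow> real \<times> 'a"
  assumes F: "F \<in> extended_L2 \<Omega>"
  shows "(\<lambda>x. fst (F x)) \<in> extended_L2 \<Omega>" "(\<lambda>x. snd (F x)) \<in> extended_L2 \<Omega>"
proof -
  note [measurable] = extended_L2_borel[OF F]
  have le: "norm (fst p) \<le> norm p" "norm (snd p) \<le> norm p" for p :: "real \<times> 'a"
    using norm_fst_le[of "fst p" "snd p"] norm_snd_le_norm[of p] by simp_all
  have meas: "(\<lambda>x. fst (F x)) \<in> borel_measurable lborel" "(\<lambda>x. snd (F x)) \<in> borel_measurable lborel"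
    using measurable_compose[OF extended_L2_borel[OF F] borel_measurable_continuous_onI[OF continuous_on_fst[OF continuous_on_id]]]
      measurable_compose[OF extended_L2_borel[OF F] borel_measurable_continuous_onI[OF continuous_on_snd[OF continuous_on_id]]]
    by simp_all
  have "sq_integrable lborel (\<lambda>x. fst (F x))" "sq_integrable lborel (\<lambda>x. snd (F x))"
    by (rule sq_integrable_dominated(1)[OF extended_L2_sq_integrable[OF F] meas(1) le(1)]
        sq_integrable_dominated(1)[OF extended_L2_sq_integrable[OF F] meas(2) le(2)])+
  then show "(\<lambda>x. fst (F x)) \<in> extended_L2 \<Omega>" "(\<lambda>x. snd (F x)) \<in> extended_L2 \<Omega>"
    using F by (auto simp: extended_L2_def)
qed

lemma extended_L2_inner:
  fixes v :: "'a \<Rightarrow> 'b::euclidean_space"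
  assumes v: "v \<in> extended_L2 \<Omega>"
  shows "(\<lambda>x. v x \<bullet> e) \<in> extended_L2 \<Omega>"
proof -
  note [measurable] = extended_L2_borel[OF v]
  have "sq_integrable lborel (\<lambda>x. v x \<bullet> e)"
  proof (rule sq_integrable_dominated(1))
    show "sq_integrable lborel (\<lambda>x. norm e *\<^sub>R v x)"
      using v by (intro sq_integrable_scaleR extended_L2_sq_integrable)
    show "norm (v x \<bullet> e) \<le> norm (norm e *\<^sub>R v x)" for x
      using Cauchy_Schwarz_ineq2[of "v x" e] by (simp add: mult.commute)
  qed measurable
  then show ?thesis using v by (auto simp: extended_L2_def)
qed

text \<open>Directional derivatives of a test function depend linearly on the direction, so the weak
  partial derivatives determine all weak directional derivatives.\<close>

lemma has_weak_deriv_direction: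
  assumes u: "u \<in> extended_L2 \<Omega>" and v: "v \<in> extended_L2 \<Omega>"
    and partial: "\<And>b. b \<in> Basis \<Longrightarrow> has_weak_deriv \<Omega> b u (\<lambda>x. v x \<bullet> b)"
  shows "has_weak_deriv \<Omega> e u (\<lambda>x. v x \<bullet> e)"
proof -
  note ext = extended_L2_inner[OF v]
  show ?thesis
    unfolding has_weak_deriv_iff[OF u ext]
  proof
    fix \<phi> assume \<phi>: "\<phi> \<in> test_functions \<Omega>"
    have lin: "frechet_derivative \<phi> (at x) e = (\<Sum>b\<in>Basis. (e \<bullet> b) * frechet_derivative \<phi> (at x) b)" for x
    proof -
      have "linear (frechet_derivative \<phi> (at x))"
        using test_function_has_derivative[OF \<phi>, of x] by (rule has_derivative_linear)
      then have "frechet_derivative \<phi> (at x) (\<Sum>b\<in>Basis. (e \<bullet> b) *\<^sub>R b)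
          = (\<Sum>b\<in>Basis. (e \<bullet> b) * frechet_derivative \<phi> (at x) b)"
        by (simp add: linear_sum linear_cmul)
      then show ?thesis by (simp add: euclidean_representation)
    qed
    have "(LINT x|lborel. u x * frechet_derivative \<phi> (at x) e)
        = (LINT x|lborel. (\<Sum>b\<in>Basis. (e \<bullet> b) * (u x * frechet_derivative \<phi> (at x) b)))"
      by (simp add: lin sum_distrib_left mult.left_commute)
    also have "\<dots> = (\<Sum>b\<in>Basis. (e \<bullet> b) * (LINT x|lborel. u x * frechet_derivative \<phi> (at x) b))"
      using integrable_mult_test_function(2)[OF u \<phi>] by (subst Bochner_Integration.integral_sum) auto
    also have "\<dots> = (\<Sum>b\<in>Basis. (e \<bullet> b) * (- (LINT x|lborel. (v x \<bullet> b) * \<phi> x)))"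
      using partial \<phi> by (intro sum.cong refl) (simp add: has_weak_deriv_iff[OF u ext])
    also have "\<dots> = - (LINT x|lborel. (\<Sum>b\<in>Basis. (e \<bullet> b) * ((v x \<bullet> b) * \<phi> x)))"
      using integrable_mult_test_function(1)[OF ext \<phi>]
      by (subst Bochner_Integration.integral_sum) (auto simp: sum_negf)
    also have "(\<lambda>x. \<Sum>b\<in>Basis. (e \<bullet> b) * ((v x \<bullet> b) * \<phi> x)) = (\<lambda>x. (v x \<bullet> e) * \<phi> x)"
      by (simp add: euclidean_inner[of "v _" e] sum_distrib_left mult_ac)
    finally show "(LINT x|lborel. u x * frechet_derivative \<phi> (at x) e) = - (LINT x|lborel. (v x \<bullet> e) * \<phi> x)" .
  qed
qed

end

context directed_domain
begin

text \<open>For a test function \<open>\<psi>\<close> supported where the segment of length \<open>h\<close> stays inside the domain, all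
  translates \<open>x \<mapsto> \<psi> (x - t *\<^sub>R \<theta>)\<close> with \<open>t \<in> {0..h}\<close> are test functions of the domain.
  Integrating the definition of the weak derivative for these translates over \<open>t\<close> gives, by the
  fundamental theorem of calculus for \<open>\<psi>\<close> and Fubini, that \<open>u (x + h *\<^sub>R \<theta>) - u x\<close> and the
  integral of \<open>v\<close> over the segment have the same integral against \<open>\<psi>\<close>.\<close>

lemma weak_deriv_increment:
  assumes u: "u \<in> extended_L2 \<Omega>" and v: "v \<in> extended_L2 \<Omega>"
    and wd: "has_weak_deriv \<Omega> \<theta> u v" and h: "0 \<le> h"
  shows "AE x in lborel. h < \<delta> x \<longrightarrow>
    u (x + h *\<^sub>R \<theta>) - u x = (LINT t|lborel. indicator {0..h} t * v (x + t *\<^sub>R \<theta>))"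
proof -
  define S where "S = {x. h < \<delta> x}"
  define F where "F x = u (x + h *\<^sub>R \<theta>) - u x - (LINT t|lborel. indicator {0..h} t * v (x + t *\<^sub>R \<theta>))" for x
  note [measurable] = extended_L2_borel[OF u] extended_L2_borel[OF v]
  have iu: "integrable lborel u" and iv: "integrable lborel v"
    using u v by (auto intro: extended_L2_integrable)
  have i1: "integrable lborel (indicator {0..h} :: real \<Rightarrow> real)"
    by (simp add: emeasure_lborel_Icc_eq)
  have iuh: "integrable lborel (\<lambda>x. u (x + h *\<^sub>R \<theta>))"
    using iu by (subst integral_translate(2)) auto
  have ivh: "integrable lborel (\<lambda>x. LINT t|lborel. indicator {0..h} t * v (x + t *\<^sub>R \<theta>))"
    by (rule lborel_pair.integrable_snd[OF integrable_sheared_product[OF iv i1]])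
  have "AE x in lborel. x \<in> S \<longrightarrow> F x = 0"
  proof (rule AE_zero_if_test_integrals_zero)
    show "open S" unfolding S_def using h by (rule open_less_exit_time)
    show "integrable lborel F"
      unfolding F_def using iu iuh ivh by (intro Bochner_Integration.integrable_diff)
    fix \<psi> assume \<psi>: "\<psi> \<in> test_functions S"
    note [measurable] = test_function_borel[OF \<psi>] test_function_deriv_borel[OF \<psi>]
    obtain B where B: "\<And>x. \<bar>\<psi> x\<bar> \<le> B" using test_function_bounded[OF \<psi>] by metis
    obtain B' where B': "\<And>x. \<bar>frechet_derivative \<psi> (at x) \<theta>\<bar> \<le> B'"
      using test_function_deriv_bounded[OF \<psi>] by metis
    have weak: "(LINT x|lborel. u x * frechet_derivative \<psi> (at (x - t *\<^sub>R \<theta>)) \<theta>)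
        = - (LINT x|lborel. v (x + t *\<^sub>R \<theta>) * \<psi> x)" if t: "t \<in> {0..h}" for t
    proof -
      have sub: "x + t *\<^sub>R \<theta> \<in> \<Omega>" if "x \<in> S" for x
        using that t by (intro mem_domain_before_exit) (auto simp: S_def)
      have "(LINT x|lborel. u x * frechet_derivative (\<lambda>x. \<psi> (x - t *\<^sub>R \<theta>)) (at x) \<theta>)
          = - (LINT x|lborel. v x * \<psi> (x - t *\<^sub>R \<theta>))"
        using wd test_function_translate(1)[OF \<psi> sub] by (simp add: has_weak_deriv_iff[OF u v])
      also have "(LINT x|lborel. v x * \<psi> (x - t *\<^sub>R \<theta>)) = (LINT x|lborel. v (x + t *\<^sub>R \<theta>) * \<psi> (x + t *\<^sub>R \<theta> - t *\<^sub>R \<theta>))"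
        by (rule integral_translate(1)[symmetric]) measurable
      finally show ?thesis
        by (simp add: test_function_translate(2)[OF \<psi> sub])
    qed
    have ftc: "\<psi> (x - h *\<^sub>R \<theta>) - \<psi> x = - (LINT t|lborel. indicator {0..h} t * frechet_derivative \<psi> (at (x - t *\<^sub>R \<theta>)) \<theta>)" for x
    proof -
      have "((\<lambda>t. \<psi> (x - t *\<^sub>R \<theta>)) has_vector_derivative - frechet_derivative \<psi> (at (x - t *\<^sub>R \<theta>)) \<theta>) (at t within {0..h})" for t
      proof -
        have "((\<lambda>t. \<psi> (x - t *\<^sub>R \<theta>)) has_derivative (\<lambda>s. frechet_derivative \<psi> (at (x - t *\<^sub>R \<theta>)) (- (s *\<^sub>R \<theta>)))) (at t within {0..h})"
          by (rule has_derivative_compose[OF _ test_function_has_derivative[OF \<psi>],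
                of "\<lambda>t. x - t *\<^sub>R \<theta>" "\<lambda>s. - (s *\<^sub>R \<theta>)" t "{0..h}"])
            (auto intro!: derivative_eq_intros)
        moreover have "linear (frechet_derivative \<psi> (at (x - t *\<^sub>R \<theta>)))"
          using test_function_has_derivative[OF \<psi>] by (rule has_derivative_linear)
        ultimately show ?thesis
          by (simp add: has_vector_derivative_def linear_neg linear_cmul)
      qed
      then have "(LINT t|lborel. indicator {0..h} t *\<^sub>R - frechet_derivative \<psi> (at (x - t *\<^sub>R \<theta>)) \<theta>)
          = \<psi> (x - h *\<^sub>R \<theta>) - \<psi> (x - 0 *\<^sub>R \<theta>)"
        using h by (intro integral_FTC_Icc)
          (auto intro!: continuous_intros continuous_on_compose2[OF test_function_deriv_continuous[OF \<psi>]])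
      then show ?thesis by simp
    qed
    have pair1: "integrable (lborel \<Otimes>\<^sub>M lborel) (\<lambda>(t, x). indicator {0..h} t * (u x * frechet_derivative \<psi> (at (x - t *\<^sub>R \<theta>)) \<theta>))"
      using integrable_mult_bounded[OF integrable_sheared_product[OF iu i1, of 0],
          of "\<lambda>(t, x). frechet_derivative \<psi> (at (x - t *\<^sub>R \<theta>)) \<theta>" B'] B'
      by (simp add: case_prod_unfold mult.assoc)
    have pair2: "integrable (lborel \<Otimes>\<^sub>M lborel) (\<lambda>(t, x). indicator {0..h} t * (v (x + t *\<^sub>R \<theta>) * \<psi> x))"
      using integrable_mult_bounded[OF integrable_sheared_product[OF iv i1, of \<theta>], of "\<lambda>(t, x). \<psi> x" B] B
      by (simp add: case_prod_unfold mult.assoc)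
    have "(LINT x|lborel. u (x + h *\<^sub>R \<theta>) * \<psi> x) - (LINT x|lborel. u x * \<psi> x)
        = (LINT x|lborel. u x * \<psi> (x - h *\<^sub>R \<theta>)) - (LINT x|lborel. u x * \<psi> x)"
      using integral_translate(1)[of "\<lambda>x. u x * \<psi> (x - h *\<^sub>R \<theta>)" "h *\<^sub>R \<theta>"] by simp
    also have "\<dots> = (LINT x|lborel. u x * (\<psi> (x - h *\<^sub>R \<theta>) - \<psi> x))"
    proof -
      have "integrable lborel (\<lambda>x. u x * \<psi> (x - h *\<^sub>R \<theta>))"
        by (rule integrable_mult_bounded[OF iu _ B]) measurable
      then show ?thesis
        using integrable_mult_test_function(1)[OF u \<psi>]
        by (simp add: right_diff_distrib Bochner_Integration.integral_diff)
    qed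
    also have "\<dots> = - (LINT x|lborel. LINT t|lborel. indicator {0..h} t * (u x * frechet_derivative \<psi> (at (x - t *\<^sub>R \<theta>)) \<theta>))"
      unfolding ftc by (simp add: mult.left_commute[of _ "u _"])
    also have "\<dots> = - (LINT t|lborel. LINT x|lborel. indicator {0..h} t * (u x * frechet_derivative \<psi> (at (x - t *\<^sub>R \<theta>)) \<theta>))"
      using lborel_pair.Fubini_integral[OF pair1] by simp
    also have "\<dots> = (LINT t|lborel. LINT x|lborel. indicator {0..h} t * (v (x + t *\<^sub>R \<theta>) * \<psi> x))"
    proof -
      have "(LINT x|lborel. indicator {0..h} t * (u x * frechet_derivative \<psi> (at (x - t *\<^sub>R \<theta>)) \<theta>))
          = - (LINT x|lborel. indicator {0..h} t * (v (x + t *\<^sub>R \<theta>) * \<psi> x))" for t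
        using weak[of t] by (cases "t \<in> {0..h}") auto
      then show ?thesis by simp
    qed
    also have "\<dots> = (LINT x|lborel. LINT t|lborel. indicator {0..h} t * (v (x + t *\<^sub>R \<theta>) * \<psi> x))"
      by (rule lborel_pair.Fubini_integral[OF pair2, symmetric])
    also have "\<dots> = (LINT x|lborel. (LINT t|lborel. indicator {0..h} t * v (x + t *\<^sub>R \<theta>)) * \<psi> x)"
      by (simp flip: mult.assoc)
    finally have *: "(LINT x|lborel. u (x + h *\<^sub>R \<theta>) * \<psi> x) - (LINT x|lborel. u x * \<psi> x)
      = (LINT x|lborel. (LINT t|lborel. indicator {0..h} t * v (x + t *\<^sub>R \<theta>)) * \<psi> x)" .
    have a: "integrable lborel (\<lambda>x. u (x + h *\<^sub>R \<theta>) * \<psi> x)"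
      and b: "integrable lborel (\<lambda>x. u x * \<psi> x)"
      and c: "integrable lborel (\<lambda>x. (LINT t|lborel. indicator {0..h} t * v (x + t *\<^sub>R \<theta>)) * \<psi> x)"
      using iuh iu ivh B by (auto intro!: integrable_mult_bounded)
    have "(LINT x|lborel. F x * \<psi> x) = (LINT x|lborel. u (x + h *\<^sub>R \<theta>) * \<psi> x) - (LINT x|lborel. u x * \<psi> x)
      - (LINT x|lborel. (LINT t|lborel. indicator {0..h} t * v (x + t *\<^sub>R \<theta>)) * \<psi> x)"
      unfolding F_def left_diff_distrib
      by (subst Bochner_Integration.integral_diff[OF Bochner_Integration.integrable_diff[OF a b] c])
        (subst Bochner_Integration.integral_diff[OF a b], rule refl)
    with * show "(LINT x|lborel. F x * \<psi> x) = 0" by simp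
  qed
  then show ?thesis by eventually_elim (auto simp: S_def F_def)
qed

text \<open>On almost every line, \<open>u\<close> is a primitive of \<open>v\<close>: the exceptional set of base points for each
  \<open>h\<close> is null, so by Fubini almost every base point is good for almost every \<open>h\<close>.\<close>

theorem weak_deriv_on_lines:
  assumes u: "u \<in> extended_L2 \<Omega>" and v: "v \<in> extended_L2 \<Omega>" and wd: "has_weak_deriv \<Omega> \<theta> u v"
  shows "AE x in lborel. AE h in lborel. 0 \<le> h \<and> h < \<delta> x \<longrightarrow>
    u (x + h *\<^sub>R \<theta>) - u x = (LINT t|lborel. indicator {0..h} t * v (x + t *\<^sub>R \<theta>))"
proof -
  note [measurable] = extended_L2_borel[OF u] extended_L2_borel[OF v]
  have "AE h in lborel. AE x in lborel. 0 \<le> h \<and> h < \<delta> x \<longrightarrow>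
    u (x + h *\<^sub>R \<theta>) - u x = (LINT t|lborel. indicator {0..h} t * v (x + t *\<^sub>R \<theta>))"
  proof (rule AE_I2)
    fix h :: real
    show "AE x in lborel. 0 \<le> h \<and> h < \<delta> x \<longrightarrow>
      u (x + h *\<^sub>R \<theta>) - u x = (LINT t|lborel. indicator {0..h} t * v (x + t *\<^sub>R \<theta>))"
    proof (cases "0 \<le> h")
      case True
      from weak_deriv_increment[OF u v wd True] show ?thesis by eventually_elim simp
    qed simp
  qed
  moreover have "{p \<in> space (lborel \<Otimes>\<^sub>M lborel). 0 \<le> fst p \<and> fst p < \<delta> (snd p) \<longrightarrow>
      u (snd p + fst p *\<^sub>R \<theta>) - u (snd p) = (LINT t|lborel. indicator {0..fst p} t * v (snd p + t *\<^sub>R \<theta>))}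
    \<in> sets (lborel \<Otimes>\<^sub>M lborel)"
  proof -
    have [measurable]: "(\<lambda>p. LINT t|lborel. indicator {0..fst p} t * v (snd p + t *\<^sub>R \<theta>))
        \<in> borel_measurable (lborel \<Otimes>\<^sub>M lborel)"
    proof (rule lborel.borel_measurable_lebesgue_integral)
      have "(\<lambda>q. (if 0 \<le> snd q \<and> snd q \<le> fst (fst q) then 1 else 0) * v (snd (fst q) + snd q *\<^sub>R \<theta>))
          \<in> borel_measurable ((lborel \<Otimes>\<^sub>M lborel) \<Otimes>\<^sub>M lborel)"
        by measurable
      then show "(\<lambda>(p, t). indicator {0..fst p} t * v (snd p + t *\<^sub>R \<theta>))
          \<in> borel_measurable ((lborel \<Otimes>\<^sub>M lborel) \<Otimes>\<^sub>M lborel)"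
        by (simp add: split_beta' indicator_def of_bool_def)
    qed
    show ?thesis by measurable
  qed
  ultimately show ?thesis
    by (subst lborel_pair.AE_commute[symmetric])
qed

end

section \<open>Directional traces as exit integrals\<close>

lemma AE_lborel_translate:
  fixes c :: "'a::euclidean_space"
  assumes "AE x in lborel. P x" shows "AE x in lborel. P (c + x)"
proof -
  have "AE x in distr lborel borel ((+) c). P x"
    unfolding lborel_distr_plus by (rule assms)
  then show ?thesis by (rule AE_distrD[rotated]) simp
qed

text \<open>The value of a trace at the end of an interval is reached through this continuity argument,
  since the equations inside the interval only hold almost everywhere.\<close>

lemma zero_at_endpoint:
  fixes f :: "real \<Rightarrow> real"
  assumes cont: "continuous_on {a<..b} f" and "a < b"
    and ae: "AE s in lborel. s \<in> {a<..<b} \<longrightarrow> f s = 0"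
  shows "f b = 0"
proof (rule ccontr)
  assume "f b \<noteq> 0"
  then obtain d where d: "d > 0" "\<And>s. s \<in> {a<..b} \<Longrightarrow> dist s b < d \<Longrightarrow> dist (f s) (f b) < \<bar>f b\<bar>"
    using cont \<open>a < b\<close> unfolding continuous_on_iff
    by (metis greaterThanAtMost_iff order_refl zero_less_abs_iff)
  define a' where "a' = max a (b - d)"
  have "a' < b" using d(1) \<open>a < b\<close> by (simp add: a'_def)
  have "AE s in lborel. s \<notin> {a'<..<b}"
    using ae
  proof eventually_elim
    case (elim s)
    show ?case
    proof
      assume s: "s \<in> {a'<..<b}"
      then have "dist s b < d" by (auto simp: a'_def dist_real_def)
      with s have "dist (f s) (f b) < \<bar>f b\<bar>" by (intro d(2)) (auto simp: a'_def)
      moreover have "f s = 0" using s elim by (auto simp: a'_def)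
      ultimately show False by (simp add: dist_real_def)
    qed
  qed
  then have "{a'<..<b} \<in> null_sets lborel"
    by (subst AE_iff_null_sets) auto
  then have "emeasure lborel {a'<..<b} = 0" by (rule null_setsD1)
  then show False using \<open>a' < b\<close> by simp
qed

lemma continuous_on_primitive:
  fixes g :: "real \<Rightarrow> real"
  assumes "set_integrable lborel {a..b} g"
  shows "continuous_on {a..b} (\<lambda>t. LINT s|lborel. indicator {a..t} s * g s)"
    and "continuous_on {a..b} (\<lambda>t. LINT s|lborel. indicator {t..b} s * g s)"
proof -
  have eq: "(LINT s|lborel. indicator {c..d} s * g s) = integral {c..d} g" if "{c..d} \<subseteq> {a..b}" for c d
  proof -
    have "set_integrable lborel {c..d} g" using that by (intro set_integrable_subset[OF assms]) auto
    from set_borel_integral_eq_integral(2)[OF this] show ?thesis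
      by (simp add: set_lebesgue_integral_def)
  qed
  have "g integrable_on {a..b}" by (rule set_borel_integral_eq_integral(1)[OF assms])
  note cont = indefinite_integral_continuous_1[OF this] indefinite_integral_continuous_1'[OF this]
  show "continuous_on {a..b} (\<lambda>t. LINT s|lborel. indicator {a..t} s * g s)"
    by (rule continuous_on_eq[OF cont(1)]) (simp add: eq)
  show "continuous_on {a..b} (\<lambda>t. LINT s|lborel. indicator {t..b} s * g s)"
    by (rule continuous_on_eq[OF cont(2)]) (simp add: eq)
qed

lemma component_bounded_open_real:
  fixes S :: "real set"
  assumes S: "open S" "bounded S" and C: "C \<in> components S"
  obtains \<alpha> \<beta> where "\<alpha> < \<beta>" "C = {\<alpha><..<\<beta>}"
proof -
  have "open C" by (rule open_components[OF S(1) C])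
  have "connected C" by (rule in_components_connected[OF C])
  have "C \<noteq> {}" by (rule in_components_nonempty[OF C])
  have "bounded C" by (rule bounded_subset[OF S(2) in_components_subset[OF C]])
  have bdd: "bdd_below C" "bdd_above C"
    using \<open>bounded C\<close> bounded_imp_bdd_below bounded_imp_bdd_above by auto
  have "C = {Inf C<..<Sup C}"
  proof (intro set_eqI iffI)
    fix s assume "s \<in> C"
    then obtain e where e: "e > 0" "cball s e \<subseteq> C"
      using \<open>open C\<close> open_contains_cball by blast
    then have "s - e \<in> C" "s + e \<in> C" by (auto simp: dist_real_def)
    then show "s \<in> {Inf C<..<Sup C}"
      using e cInf_lower[OF _ bdd(1)] cSup_upper[OF _ bdd(2)] by fastforce
  next
    fix s assume "s \<in> {Inf C<..<Sup C}"
    then obtain c d where "c \<in> C" "c < s" "d \<in> C" "s < d"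
      using cInf_less_iff[OF \<open>C \<noteq> {}\<close> bdd(1)] less_cSup_iff[OF \<open>C \<noteq> {}\<close> bdd(2)] by auto
    then show "s \<in> C"
      using connectedD_interval[OF \<open>connected C\<close>, of c d s] by simp
  qed
  moreover from this have "Inf C < Sup C" using \<open>C \<noteq> {}\<close> by (metis greaterThanLessThan_empty_iff not_le)
  ultimately show thesis using that by blast
qed

lemma component_endpoints_notin:
  fixes S :: "real set"
  assumes C: "{\<alpha><..<\<beta>} \<in> components S" and "\<alpha> < \<beta>"
  shows "\<alpha> \<notin> S" "\<beta> \<notin> S"
proof -
  have sub: "{\<alpha><..<\<beta>} \<subseteq> S" using C in_components_subset by blast
  have max: "T \<subseteq> {\<alpha><..<\<beta>}" if "connected T" "T \<subseteq> S" "{\<alpha><..<\<beta>} \<subseteq> T" for T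
  proof -
    have "{\<alpha><..<\<beta>} \<inter> T \<noteq> {}" using that \<open>\<alpha> < \<beta>\<close> by (auto simp: Int_absorb2)
    then show ?thesis using components_maximal[OF C that(1,2)] by blast
  qed
  show "\<alpha> \<notin> S"
  proof
    assume "\<alpha> \<in> S"
    then have "{\<alpha>..<\<beta>} \<subseteq> S" using sub by (auto simp: le_less)
    then have "{\<alpha>..<\<beta>} \<subseteq> {\<alpha><..<\<beta>}" by (intro max connected_Ico) auto
    then show False using \<open>\<alpha> < \<beta>\<close> by auto
  qed
  show "\<beta> \<notin> S"
  proof
    assume "\<beta> \<in> S"
    then have "{\<alpha><..\<beta>} \<subseteq> S" using sub by (auto simp: le_less)
    then have "{\<alpha><..\<beta>} \<subseteq> {\<alpha><..<\<beta>}" by (intro max connected_Ioc) auto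
    then show False using \<open>\<alpha> < \<beta>\<close> by auto
  qed
qed

text \<open>Integration by parts for a primitive of an integrable function, which need not be
  differentiable anywhere: after inserting the primitive as an integral, Fubini leaves the
  integral of \<open>\<phi>'\<close> over \<open>{\<alpha>..t}\<close>, and this is \<open>\<phi> t\<close> because \<open>\<phi>\<close> vanishes at \<open>\<alpha>\<close>.\<close>

lemma weak_deriv_interval:
  fixes \<phi> u v :: "real \<Rightarrow> real"
  assumes "\<alpha> < \<beta>" and v: "integrable lborel v" and \<phi>: "\<phi> \<in> test_functions S"
    and ends: "\<alpha> \<notin> S" "\<beta> \<notin> S"
    and u: "AE s in lborel. s \<in> {\<alpha><..<\<beta>} \<longrightarrow> u s = c - (LINT t|lborel. indicator {s..\<beta>} t * v t)"
    and [measurable]: "u \<in> borel_measurable borel"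
  shows "(LINT s|lborel. indicator {\<alpha><..<\<beta>} s * (u s * frechet_derivative \<phi> (at s) 1))
    = - (LINT s|lborel. indicator {\<alpha><..<\<beta>} s * (v s * \<phi> s))"
proof -
  have [measurable]: "v \<in> borel_measurable borel" using v by auto
  define \<phi>' where "\<phi>' s = frechet_derivative \<phi> (at s) 1" for s
  have [measurable]: "\<phi>' \<in> borel_measurable borel" "\<phi> \<in> borel_measurable borel"
    unfolding \<phi>'_def using \<phi> by (auto intro: test_function_borel test_function_deriv_borel)
  obtain B where B: "\<And>s. \<bar>\<phi>' s\<bar> \<le> B" using test_function_deriv_bounded[OF \<phi>, of 1] by (auto simp: \<phi>'_def)
  have "B \<ge> 0" using B[of 0] by simp
  have out: "s \<notin> closure {x. \<phi> x \<noteq> 0}" if "s \<notin> S" for s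
    using \<phi> that by (auto simp: test_functions_def)
  have zero: "\<phi> \<alpha> = 0" "\<phi> \<beta> = 0" "\<phi>' \<alpha> = 0" "\<phi>' \<beta> = 0"
    unfolding \<phi>'_def
    by (rule test_function_zero_outside[OF out[OF ends(1)]] test_function_zero_outside[OF out[OF ends(2)]])+
  have "(\<phi> has_vector_derivative \<phi>' s) (at s)" for s
  proof -
    have "linear (frechet_derivative \<phi> (at s))"
      using test_function_has_derivative[OF \<phi>] by (rule has_derivative_linear)
    then have "frechet_derivative \<phi> (at s) h = h *\<^sub>R \<phi>' s" for h
      using linear_cmul[of "frechet_derivative \<phi> (at s)" h 1] by (simp add: \<phi>'_def)
    then have "frechet_derivative \<phi> (at s) = (\<lambda>h. h *\<^sub>R \<phi>' s)" by (rule ext)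
    then show ?thesis
      using test_function_has_derivative[OF \<phi>, of s] by (simp add: has_vector_derivative_def)
  qed
  then have ftc: "(LINT s|lborel. indicator {\<alpha>..\<tau>} s * \<phi>' s) = \<phi> \<tau>" if "\<alpha> \<le> \<tau>" for \<tau>
    using integral_FTC_Icc[OF that, of \<phi> \<phi>'] zero continuous_on_subset[OF test_function_deriv_continuous[OF \<phi>, of 1]]
    by (auto simp: \<phi>'_def intro: has_vector_derivative_at_within)
  define V where "V s = (LINT t|lborel. indicator {s..\<beta>} t * v t)" for s
  have i1: "integrable lborel (indicator {\<alpha>..\<beta>} :: real \<Rightarrow> real)"
    by (simp add: emeasure_lborel_Icc_eq)
  have pair: "integrable (lborel \<Otimes>\<^sub>M lborel) (\<lambda>(s, t). indicator {\<alpha>..\<beta>} s * v t * (if s \<le> t \<and> t \<le> \<beta> then \<phi>' s else 0))"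
    using integrable_mult_bounded[OF integrable_sheared_product[OF v i1, of 0],
        of "\<lambda>(s, t). if s \<le> t \<and> t \<le> \<beta> then \<phi>' s else 0" B] B \<open>B \<ge> 0\<close>
    by (simp add: case_prod_unfold)
  have inner_t: "(LINT t|lborel. indicator {\<alpha>..\<beta>} s * v t * (if s \<le> t \<and> t \<le> \<beta> then \<phi>' s else 0))
      = indicator {\<alpha>..\<beta>} s * (V s * \<phi>' s)" for s
  proof -
    have "(LINT t|lborel. indicator {\<alpha>..\<beta>} s * v t * (if s \<le> t \<and> t \<le> \<beta> then \<phi>' s else 0))
      = (LINT t|lborel. (indicator {s..\<beta>} t * v t) * (indicator {\<alpha>..\<beta>} s * \<phi>' s))"
      by (intro Bochner_Integration.integral_cong) (auto split: split_indicator)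
    then show ?thesis by (simp add: V_def)
  qed
  have inner_s: "(LINT s|lborel. indicator {\<alpha>..\<beta>} s * v t * (if s \<le> t \<and> t \<le> \<beta> then \<phi>' s else 0))
      = indicator {\<alpha><..<\<beta>} t * (v t * \<phi> t)" for t
  proof (cases "t \<in> {\<alpha>..\<beta>}")
    case True
    then have "(LINT s|lborel. indicator {\<alpha>..\<beta>} s * v t * (if s \<le> t \<and> t \<le> \<beta> then \<phi>' s else 0))
      = (LINT s|lborel. v t * (indicator {\<alpha>..t} s * \<phi>' s))"
      by (intro Bochner_Integration.integral_cong) (auto split: split_indicator)
    also have "\<dots> = v t * \<phi> t" using True ftc[of t] by simp
    finally show ?thesis using True zero by (cases "t = \<alpha> \<or> t = \<beta>") auto
  next
    case False
    then have "(\<lambda>s. indicator {\<alpha>..\<beta>} s * v t * (if s \<le> t \<and> t \<le> \<beta> then \<phi>' s else 0)) = (\<lambda>s. 0)"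
      by (auto simp: fun_eq_iff split: split_indicator)
    then show ?thesis using False by auto
  qed
  have closed: "indicator {\<alpha><..<\<beta>} s * (h * \<phi>' s) = indicator {\<alpha>..\<beta>} s * (h * \<phi>' s)" for s h
    using zero by (cases "s = \<alpha> \<or> s = \<beta>") (auto split: split_indicator)
  have iphi: "integrable lborel (\<lambda>s. indicator {\<alpha>..\<beta>} s * \<phi>' s)"
    by (rule integrable_mult_bounded[OF i1 _ B]) measurable
  have iV: "integrable lborel (\<lambda>s. indicator {\<alpha>..\<beta>} s * (V s * \<phi>' s))"
    using lborel_pair.integrable_fst[OF pair] by (simp add: inner_t)
  have [measurable]: "(\<lambda>s. indicator {\<alpha>..\<beta>} s * (V s * \<phi>' s)) \<in> borel_measurable borel"
    using iV by auto
  have "(LINT s|lborel. indicator {\<alpha><..<\<beta>} s * (u s * \<phi>' s))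
      = (LINT s|lborel. c * (indicator {\<alpha>..\<beta>} s * \<phi>' s) - indicator {\<alpha>..\<beta>} s * (V s * \<phi>' s))"
  proof (rule integral_cong_AE)
    show "AE s in lborel. indicator {\<alpha><..<\<beta>} s * (u s * \<phi>' s)
        = c * (indicator {\<alpha>..\<beta>} s * \<phi>' s) - indicator {\<alpha>..\<beta>} s * (V s * \<phi>' s)"
      using u
    proof eventually_elim
      case (elim s)
      have "indicator {\<alpha><..<\<beta>} s * (u s * \<phi>' s) = indicator {\<alpha><..<\<beta>} s * ((c - V s) * \<phi>' s)"
        using elim by (auto simp: V_def split: split_indicator)
      also have "\<dots> = indicator {\<alpha>..\<beta>} s * ((c - V s) * \<phi>' s)" by (rule closed)
      finally show ?case by (simp add: algebra_simps)
    qed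
  qed measurable
  also have "\<dots> = c * (LINT s|lborel. indicator {\<alpha>..\<beta>} s * \<phi>' s) - (LINT s|lborel. indicator {\<alpha>..\<beta>} s * (V s * \<phi>' s))"
    using iphi iV by simp
  also have "\<dots> = - (LINT s|lborel. indicator {\<alpha>..\<beta>} s * (V s * \<phi>' s))"
    using ftc[of \<beta>] zero \<open>\<alpha> < \<beta>\<close> by simp
  also have "\<dots> = - (LINT t|lborel. indicator {\<alpha><..<\<beta>} t * (v t * \<phi> t))"
    using lborel_pair.Fubini_integral[OF pair] by (simp add: inner_t inner_s)
  finally show ?thesis by (simp add: \<phi>'_def)
qed

text \<open>A test function has compact support, which meets only finitely many components; the integrals
  split into a finite sum over these components.\<close>

lemma H1_fun_real_if_primitive:
  fixes S :: "real set" and u v :: "real \<Rightarrow> real"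
  assumes S: "open S" "bounded S" and u: "u \<in> extended_L2 S" and v: "v \<in> extended_L2 S"
    and prim: "\<And>\<alpha> \<beta>. {\<alpha><..<\<beta>} \<in> components S \<Longrightarrow> \<exists>c. AE s in lborel. s \<in> {\<alpha><..<\<beta>} \<longrightarrow>
      u s = c - (LINT t|lborel. indicator {s..\<beta>} t * v t)"
  shows "u \<in> H1_fun S"
proof -
  interpret bounded_domain S using S by unfold_locales
  have "has_weak_deriv S 1 u v"
    unfolding has_weak_deriv_iff[OF u v]
  proof
    fix \<phi> assume \<phi>: "\<phi> \<in> test_functions S"
    define K where "K = closure {x. \<phi> x \<noteq> 0}"
    have "compact K" "K \<subseteq> \<Union>(components S)"
      using \<phi> by (auto simp: K_def test_functions_def Union_components)
    then obtain \<C> where \<C>: "\<C> \<subseteq> components S" "finite \<C>" "K \<subseteq> \<Union>\<C>"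
      using compactE[of K "components S"] open_components[OF S(1)] by metis
    have [measurable]: "C \<in> sets borel" if "C \<in> \<C>" for C
      using open_components[OF S(1)] \<C>(1) that by (intro borel_open) auto
    define f where "f x = u x * frechet_derivative \<phi> (at x) 1" for x
    define g where "g x = v x * \<phi> x" for x
    have int: "integrable lborel f" "integrable lborel g"
      unfolding f_def g_def
      by (rule integrable_mult_test_function(2)[OF u \<phi>] integrable_mult_test_function(1)[OF v \<phi>])+
    have split: "(LINT x|lborel. h x) = (\<Sum>C\<in>\<C>. LINT x|lborel. indicator C x * h x)"
      if "integrable lborel h" "\<And>x. x \<notin> K \<Longrightarrow> h x = 0" for h :: "real \<Rightarrow> real"
    proof -
      have "h x = (\<Sum>C\<in>\<C>. indicator C x * h x)" for x
      proof (cases "x \<in> K")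
        case True
        then obtain C0 where C0: "C0 \<in> \<C>" "x \<in> C0" using \<C>(3) by auto
        then have "indicator C x = (if C = C0 then 1 else 0 :: real)" if "C \<in> \<C>" for C
          using components_nonoverlap[of C S C0] \<C>(1) that by (auto split: split_indicator)
        then have "(\<Sum>C\<in>\<C>. indicator C x * h x) = (\<Sum>C\<in>\<C>. if C = C0 then h x else 0)"
          by (intro sum.cong) auto
        then show ?thesis using C0 \<C>(2) by (simp add: sum.delta)
      qed (use that in simp)
      then have "(LINT x|lborel. h x) = (LINT x|lborel. (\<Sum>C\<in>\<C>. indicator C x * h x))"
        by (intro Bochner_Integration.integral_cong) auto
      also have "\<dots> = (\<Sum>C\<in>\<C>. LINT x|lborel. indicator C x * h x)"
        using integrable_real_mult_indicator[OF _ that(1)]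
        by (intro Bochner_Integration.integral_sum) (auto simp: mult.commute)
      finally show ?thesis .
    qed
    have "(LINT x|lborel. indicator C x * f x) = - (LINT x|lborel. indicator C x * g x)" if "C \<in> \<C>" for C
    proof -
      have C: "C \<in> components S" using that \<C>(1) by auto
      obtain \<alpha> \<beta> where ab: "\<alpha> < \<beta>" "C = {\<alpha><..<\<beta>}"
        using component_bounded_open_real[OF S C] .
      then obtain c where "AE s in lborel. s \<in> {\<alpha><..<\<beta>} \<longrightarrow> u s = c - (LINT t|lborel. indicator {s..\<beta>} t * v t)"
        using prim C by blast
      then show ?thesis
        unfolding f_def g_def ab(2) using component_endpoints_notin[of \<alpha> \<beta> S] ab C
        by (intro weak_deriv_interval[OF _ extended_L2_integrable[OF v] \<phi>]) (auto intro: extended_L2_borel[OF u])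
    qed
    then have "(\<Sum>C\<in>\<C>. LINT x|lborel. indicator C x * f x) = - (\<Sum>C\<in>\<C>. LINT x|lborel. indicator C x * g x)"
      by (simp add: sum_negf)
    moreover have "f x = 0" "g x = 0" if "x \<notin> K" for x
      unfolding f_def g_def
      using test_function_zero_outside[of x \<phi>] that by (simp_all add: K_def)
    ultimately have "(LINT x|lborel. f x) = - (LINT x|lborel. g x)"
      using split[OF int(1)] split[OF int(2)] by simp
    then show "(LINT x|lborel. u x * frechet_derivative \<phi> (at x) 1) = - (LINT x|lborel. v x * \<phi> x)"
      by (simp add: f_def g_def)
  qed
  then show ?thesis
    using extended_L2_L2_fun[OF u] extended_L2_L2_fun[OF v] by (auto simp: H1_fun_def)
qed

text \<open>On a line on which \<open>u\<close> is a primitive of \<open>v\<close>, this is the increment of \<open>u\<close> from \<open>x\<close> to its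
  exit point.\<close>

definition exit_integral :: "'a::euclidean_space set \<Rightarrow> 'a \<Rightarrow> ('a \<Rightarrow> real) \<Rightarrow> 'a \<Rightarrow> real" where
  "exit_integral \<Omega> \<theta> v x = (LINT t|lborel. indicator {0..exit_time \<Omega> \<theta> x} t * v (x + t *\<^sub>R \<theta>))"

context directed_domain
begin

lemma bounded_slice: "bounded (slice \<Omega> \<theta> y)"
proof -
  obtain R where R: "\<And>x. x \<in> \<Omega> \<Longrightarrow> norm x \<le> R" using bounded_domain by (auto simp: bounded_iff)
  have "norm s \<le> R + norm y" if "s \<in> slice \<Omega> \<theta> y" for s
  proof -
    have "norm (s *\<^sub>R \<theta>) \<le> norm (s *\<^sub>R \<theta> + y) + norm y" by (metis add_diff_cancel norm_triangle_ineq4)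
    also have "norm (s *\<^sub>R \<theta> + y) \<le> R" using that by (intro R) (simp add: slice_def)
    finally show ?thesis by simp
  qed
  then show ?thesis by (auto simp: bounded_iff)
qed

text \<open>The component of a slice through a point ends where the point exits.\<close>

lemma exit_time_component:
  assumes C: "{\<alpha><..<\<beta>} \<in> components (slice \<Omega> \<theta> y)" and s: "s \<in> {\<alpha><..<\<beta>}"
  shows "\<delta> (s *\<^sub>R \<theta> + y) = \<beta> - s" and "\<Phi> (s *\<^sub>R \<theta> + y) = \<beta> *\<^sub>R \<theta> + y"
proof -
  have sub: "{\<alpha><..<\<beta>} \<subseteq> slice \<Omega> \<theta> y" using C in_components_subset by blast
  have line: "s *\<^sub>R \<theta> + y + t *\<^sub>R \<theta> \<in> \<Omega> \<longleftrightarrow> s + t \<in> slice \<Omega> \<theta> y" for t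
    by (simp add: slice_def scaleR_add_left algebra_simps)
  have lt: "a < \<delta> (s *\<^sub>R \<theta> + y)" if "0 \<le> a" "a < \<beta> - s" for a
    unfolding less_exit_time_iff[OF that(1)] line using that s sub by auto
  have "\<not> \<beta> - s < \<delta> (s *\<^sub>R \<theta> + y)"
  proof
    assume "\<beta> - s < \<delta> (s *\<^sub>R \<theta> + y)"
    then have "\<beta> \<in> slice \<Omega> \<theta> y"
      using mem_domain_before_exit[of "\<beta> - s" "s *\<^sub>R \<theta> + y"] s line[of "\<beta> - s"] by auto
    then show False using component_endpoints_notin[OF C] s by auto
  qed
  moreover have "\<not> \<delta> (s *\<^sub>R \<theta> + y) < \<beta> - s"
    using lt[of "\<delta> (s *\<^sub>R \<theta> + y)"] by auto
  ultimately show eq: "\<delta> (s *\<^sub>R \<theta> + y) = \<beta> - s" by simp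
  show "\<Phi> (s *\<^sub>R \<theta> + y) = \<beta> *\<^sub>R \<theta> + y"
    unfolding exit_point_def eq by (simp add: algebra_simps)
qed

lemma component_through_point:
  assumes "x \<in> \<Omega>"
  obtains \<alpha> where "\<alpha> < x \<bullet> \<theta>" "{\<alpha><..<x \<bullet> \<theta> + \<delta> x} \<in> components (slice \<Omega> \<theta> (proj \<theta> x))"
proof -
  have "x \<bullet> \<theta> \<in> slice \<Omega> \<theta> (proj \<theta> x)" using assms by (simp add: slice_def proj_decomp)
  then obtain C where C: "C \<in> components (slice \<Omega> \<theta> (proj \<theta> x))" "x \<bullet> \<theta> \<in> C"
    using Union_components[of "slice \<Omega> \<theta> (proj \<theta> x)"] by blast
  obtain \<alpha> \<beta> where ab: "C = {\<alpha><..<\<beta>}"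
    using component_bounded_open_real[OF open_slice bounded_slice C(1)] by metis
  then have "\<delta> x = \<beta> - x \<bullet> \<theta>"
    using exit_time_component(1)[of \<alpha> \<beta> "proj \<theta> x" "x \<bullet> \<theta>"] C by (simp add: proj_decomp)
  then show thesis using that[of \<alpha>] C ab by simp
qed

text \<open>Exit times are bounded by the diameter, so integrability over \<open>{0..diameter \<Omega>}\<close> is enough.\<close>

lemma AE_integrable_to_exit:
  fixes v :: "'a \<Rightarrow> real"
  assumes v: "v \<in> extended_L2 \<Omega>"
  shows "AE x in lborel. integrable lborel (\<lambda>t. indicator {0..\<delta> x} t * v (x + t *\<^sub>R \<theta>))"
proof -
  have i1: "integrable lborel (indicator {0..diameter \<Omega>} :: real \<Rightarrow> real)"
    by (simp add: emeasure_lborel_Icc_eq)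
  show ?thesis
    using lborel_pair.AE_integrable_snd[OF integrable_sheared_product[OF extended_L2_integrable[OF v] i1, of \<theta>]]
  proof eventually_elim
    case (elim x)
    have "integrable lborel (\<lambda>t. (indicator {0..diameter \<Omega>} t * v (x + t *\<^sub>R \<theta>)) * indicator {0..\<delta> x} t)"
      using integrable_real_mult_indicator[OF _ elim, of "{0..\<delta> x}"] by simp
    moreover have "(indicator {0..diameter \<Omega>} t * v (x + t *\<^sub>R \<theta>)) * indicator {0..\<delta> x} t
        = indicator {0..\<delta> x} t * v (x + t *\<^sub>R \<theta>)" for t
      using exit_time_le_diameter[of x] by (auto split: split_indicator)
    ultimately show ?case by simp
  qed
qed

text \<open>For almost every \<open>x\<close>, three things hold at once: \<open>u\<close> is a primitive of \<open>v\<close> on the line through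
  \<open>x\<close>, the representative used by the trace agrees with \<open>u\<close> on this line, and the line belongs
  to the good set of the trace. Then the continuous representative on the component of \<open>x\<close>
  equals the primitive, and so do the values of both at the end of the component.\<close>

theorem directional_trace_eq_exit_integral:
  assumes u: "u \<in> extended_L2 \<Omega>" and v: "v \<in> extended_L2 \<Omega>" and wd: "has_weak_deriv \<Omega> \<theta> u v"
    and uU: "u \<in> U" and trace: "is_directional_trace \<Omega> \<theta> U h"
  shows "AE x in lebesgue_on \<Omega>. h (\<Phi> x) = u x + exit_integral \<Omega> \<theta> v x"
proof -
  obtain u0 A where UW: "U \<in> W \<Omega> \<theta>" and u0: "u0 \<in> U" and A: "A \<subseteq> proj \<theta> ` \<Omega>"
    "proj \<theta> ` \<Omega> - A \<in> null_sets (completion (hyperplane_measure \<theta>))"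
    and on_lines: "\<And>y \<alpha> \<beta>. y \<in> A \<Longrightarrow> {\<alpha><..<\<beta>} \<in> components (slice \<Omega> \<theta> y) \<Longrightarrow>
      \<exists>w. continuous_on {\<alpha><..\<beta>} w \<and> (AE s in lebesgue_on {\<alpha><..<\<beta>}. w s = u0 (s *\<^sub>R \<theta> + y)) \<and>
        h (\<beta> *\<^sub>R \<theta> + y) = w \<beta>"
    using trace unfolding is_directional_trace_def by blast
  obtain w0 where "U = L2_rel (lebesgue_on \<Omega>) `` {w0}"
    using UW unfolding W_def by (rule quotientE)
  then have "AE x in lebesgue_on \<Omega>. w0 x = u x" "AE x in lebesgue_on \<Omega>. w0 x = u0 x"
    using uU u0 by (auto simp: L2_rel_def)
  then have "AE x in lebesgue_on \<Omega>. u x = u0 x" by eventually_elim simp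
  then have same: "AE x in lborel. AE t in lborel. x + t *\<^sub>R \<theta> \<in> \<Omega> \<longrightarrow> u (x + t *\<^sub>R \<theta>) = u0 (x + t *\<^sub>R \<theta>)"
    unfolding AE_lebesgue_on_domain by (rule AE_lines)
  have inA: "AE x in lborel. x \<in> \<Omega> \<longrightarrow> proj \<theta> x \<in> A"
    using AE_proj_notin_null[OF A(2)] by eventually_elim auto
  show ?thesis
    unfolding AE_lebesgue_on_domain
    using weak_deriv_on_lines[OF u v wd] same inA AE_integrable_to_exit[OF v]
  proof eventually_elim
    case (elim x)
    show ?case
    proof
      assume x: "x \<in> \<Omega>"
      then have "0 < \<delta> x" by (simp add: exit_time_pos_iff)
      define y s0 where "y = proj \<theta> x" and "s0 = x \<bullet> \<theta>"
      have xy: "s0 *\<^sub>R \<theta> + y = x" by (simp add: y_def s0_def proj_decomp)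
      have line: "(s0 + t) *\<^sub>R \<theta> + y = x + t *\<^sub>R \<theta>" for t
        by (simp add: scaleR_add_left flip: xy)
      obtain \<alpha> where \<alpha>: "\<alpha> < s0" "{\<alpha><..<s0 + \<delta> x} \<in> components (slice \<Omega> \<theta> y)"
        using component_through_point[OF x] unfolding y_def s0_def .
      obtain w where w: "continuous_on {\<alpha><..s0 + \<delta> x} w"
        "AE s in lebesgue_on {\<alpha><..<s0 + \<delta> x}. w s = u0 (s *\<^sub>R \<theta> + y)"
        "h ((s0 + \<delta> x) *\<^sub>R \<theta> + y) = w (s0 + \<delta> x)"
        using on_lines[OF _ \<alpha>(2)] elim x by (auto simp: y_def)
      define f where "f t = w (s0 + t) - (u x + (LINT r|lborel. indicator {0..t} r * v (x + r *\<^sub>R \<theta>)))" for t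
      have "f (\<delta> x) = 0"
      proof (rule zero_at_endpoint[where f = f and a = 0 and b = "\<delta> x"])
        have "set_integrable lborel {0..\<delta> x} (\<lambda>t. v (x + t *\<^sub>R \<theta>))"
          using elim by (simp add: set_integrable_def)
        from continuous_on_primitive(1)[OF this]
        have "continuous_on {0<..\<delta> x} (\<lambda>t. LINT r|lborel. indicator {0..t} r * v (x + r *\<^sub>R \<theta>))"
          by (rule continuous_on_subset) auto
        moreover have "continuous_on {0<..\<delta> x} (\<lambda>t. w (s0 + t))"
          using \<alpha>(1) by (intro continuous_on_compose2[OF w(1)] continuous_intros) auto
        ultimately show "continuous_on {0<..\<delta> x} f"
          unfolding f_def by (intro continuous_intros)
        have "AE s in lborel. s \<in> {\<alpha><..<s0 + \<delta> x} \<longrightarrow> w s = u0 (s *\<^sub>R \<theta> + y)"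
          using w(2) by (subst (asm) AE_restrict_space_iff) (simp_all add: AE_completion_iff)
        then have "AE t in lborel. s0 + t \<in> {\<alpha><..<s0 + \<delta> x} \<longrightarrow> w (s0 + t) = u0 ((s0 + t) *\<^sub>R \<theta> + y)"
          by (rule AE_lborel_translate)
        moreover have "AE h in lborel. 0 \<le> h \<and> h < \<delta> x \<longrightarrow>
            u (x + h *\<^sub>R \<theta>) - u x = (LINT t|lborel. indicator {0..h} t * v (x + t *\<^sub>R \<theta>))"
          and "AE t in lborel. x + t *\<^sub>R \<theta> \<in> \<Omega> \<longrightarrow> u (x + t *\<^sub>R \<theta>) = u0 (x + t *\<^sub>R \<theta>)"
          using elim by auto
        ultimately show "AE t in lborel. t \<in> {0<..<\<delta> x} \<longrightarrow> f t = 0"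
        proof eventually_elim
          case (elim t)
          show ?case
          proof
            assume t: "t \<in> {0<..<\<delta> x}"
            then have "x + t *\<^sub>R \<theta> \<in> \<Omega>" by (intro mem_domain_before_exit) auto
            then show "f t = 0" using elim t \<alpha>(1) by (simp add: f_def line)
          qed
        qed
      qed fact
      moreover have "h (\<Phi> x) = w (s0 + \<delta> x)"
        using w(3) by (simp add: line exit_point_def)
      ultimately show "h (\<Phi> x) = u x + exit_integral \<Omega> \<theta> v x"
        by (simp add: f_def exit_integral_def)
    qed
  qed
qed

text \<open>The slice through a point of the domain lies within distance \<open>diameter \<Omega>\<close> of that point, so
  integrating along lines over \<open>{- diameter \<Omega>..diameter \<Omega>}\<close> sees the whole slice.\<close>

lemma AE_sq_integrable_slice:
  fixes u :: "'a \<Rightarrow> real"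
  assumes u: "u \<in> extended_L2 \<Omega>"
  shows "AE x in lebesgue_on \<Omega>. (\<lambda>s. u (s *\<^sub>R \<theta> + proj \<theta> x)) \<in> extended_L2 (slice \<Omega> \<theta> (proj \<theta> x))"
proof -
  let ?D = "diameter \<Omega>"
  note [measurable] = extended_L2_borel[OF u]
  have i1: "integrable lborel (indicator {-?D..?D} :: real \<Rightarrow> real)"
    by (simp add: emeasure_lborel_Icc_eq)
  have i2: "integrable lborel (\<lambda>x. (norm (u x))\<^sup>2)"
    using u by (simp add: extended_L2_def sq_integrable_def)
  show ?thesis
    unfolding AE_lebesgue_on_domain
    using lborel_pair.AE_integrable_snd[OF integrable_sheared_product[OF i2 i1, of \<theta>]]
  proof eventually_elim
    case (elim x)
    show ?case
    proof
      assume x: "x \<in> \<Omega>"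
      have restrict: "indicator {-?D..?D} t * (norm (u (x + t *\<^sub>R \<theta>)))\<^sup>2 = (norm (u (x + t *\<^sub>R \<theta>)))\<^sup>2" for t
      proof (cases "x + t *\<^sub>R \<theta> \<in> \<Omega>")
        case True
        then have "dist (x + t *\<^sub>R \<theta>) x \<le> ?D" using x by (intro diameter_bounded_bound bounded_domain)
        then show ?thesis by (auto simp: dist_norm split: split_indicator)
      qed (use u in \<open>simp add: extended_L2_outside\<close>)
      have int: "integrable lborel (\<lambda>t. (norm (u (x + t *\<^sub>R \<theta>)))\<^sup>2)"
        using elim by (simp only: restrict)
      have "x + (s + - (x \<bullet> \<theta>)) *\<^sub>R \<theta> = s *\<^sub>R \<theta> + proj \<theta> x" for s
        by (simp add: proj_def algebra_simps)
      then have "integrable lborel (\<lambda>s. (norm (u (s *\<^sub>R \<theta> + proj \<theta> x)))\<^sup>2)"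
        using int integral_translate(2)[of "\<lambda>t. (norm (u (x + t *\<^sub>R \<theta>)))\<^sup>2" "- (x \<bullet> \<theta>)"] by simp
      then show "(\<lambda>s. u (s *\<^sub>R \<theta> + proj \<theta> x)) \<in> extended_L2 (slice \<Omega> \<theta> (proj \<theta> x))"
        using u by (auto simp: extended_L2_def sq_integrable_def slice_def)
    qed
  qed
qed

text \<open>The exit point is the same for all points of a component. Therefore the formula for \<open>g\<close>
  exhibits \<open>u\<close> on almost every line as a constant minus the integral of \<open>v\<close> up to the end of the
  component; this is the continuous representative required of a directional trace, and a
  primitive of a square-integrable function lies in the Sobolev space of the slice. The
  existence of a representative of \<open>u\<close> that is well behaved on lines is thus read off from \<open>g\<close>.\<close>

theorem directional_traceI:
  assumes UW: "U \<in> W \<Omega> \<theta>" and uU: "u \<in> U" and u: "u \<in> extended_L2 \<Omega>" and v: "v \<in> extended_L2 \<Omega>"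
    and g: "AE x in lebesgue_on \<Omega>. g (\<Phi> x) = u x + exit_integral \<Omega> \<theta> v x"
  shows "is_directional_trace \<Omega> \<theta> U g"
proof -
  define R where "R x \<longleftrightarrow> (\<lambda>s. u (s *\<^sub>R \<theta> + proj \<theta> x)) \<in> extended_L2 (slice \<Omega> \<theta> (proj \<theta> x)) \<and>
    (\<lambda>s. v (s *\<^sub>R \<theta> + proj \<theta> x)) \<in> extended_L2 (slice \<Omega> \<theta> (proj \<theta> x)) \<and>
    g (\<Phi> x) = u x + exit_integral \<Omega> \<theta> v x" for x
  have "AE x in lebesgue_on \<Omega>. R x"
    using AE_sq_integrable_slice[OF u] AE_sq_integrable_slice[OF v] g
    by eventually_elim (simp add: R_def)
  note null = almost_every_slice[OF this]
  define A where "A = proj \<theta> ` \<Omega> \<inter> {y. AE s in lebesgue_on (slice \<Omega> \<theta> y). R (s *\<^sub>R \<theta> + y)}"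
  have on_line: "(\<lambda>s. u (s *\<^sub>R \<theta> + y)) \<in> H1_fun (slice \<Omega> \<theta> y) \<and>
      (\<forall>\<alpha> \<beta>. {\<alpha><..<\<beta>} \<in> components (slice \<Omega> \<theta> y) \<longrightarrow>
        (\<exists>w. continuous_on {\<alpha><..\<beta>} w \<and> (AE s in lebesgue_on {\<alpha><..<\<beta>}. w s = u (s *\<^sub>R \<theta> + y)) \<and>
          g (\<beta> *\<^sub>R \<theta> + y) = w \<beta>))" if y: "y \<in> A" for y
  proof -
    have hyp: "y \<in> hyperplane \<theta>" using y proj_hyperplane by (auto simp: A_def)
    define S where "S = slice \<Omega> \<theta> y"
    have S: "open S" "bounded S" by (simp_all add: S_def open_slice bounded_slice)
    obtain x where "x \<in> \<Omega>" "y = proj \<theta> x" using y by (auto simp: A_def)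
    then have "x \<bullet> \<theta> \<in> S" by (simp add: S_def slice_def proj_decomp)
    then have "S \<noteq> {}" by auto
    have ae: "AE s in lborel. s \<in> S \<longrightarrow> R (s *\<^sub>R \<theta> + y)"
      using y AE_lebesgue_on_slice by (simp add: A_def S_def)
    \<comment> \<open>The first two parts of \<open>R\<close> depend only on the line, and a nonempty open slice is not
      null; so one good point on the line suffices for them.\<close>
    have "\<exists>s. R (s *\<^sub>R \<theta> + y)"
    proof (rule ccontr)
      assume "\<not> ?thesis"
      then have "AE s in lborel. s \<notin> S" using ae by simp
      then have "S \<in> null_sets lborel"
        using S(1) by (subst AE_iff_null_sets) auto
      then show False using S(1) \<open>S \<noteq> {}\<close> open_not_negligible[of S]
        by (auto simp: negligible_iff_null_sets null_sets_completionI)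
    qed
    then have u_slice: "(\<lambda>s. u (s *\<^sub>R \<theta> + y)) \<in> extended_L2 S" and v_slice: "(\<lambda>s. v (s *\<^sub>R \<theta> + y)) \<in> extended_L2 S"
      by (auto simp: R_def proj_line[OF hyp] S_def)
    have prim: "AE s in lborel. s \<in> {\<alpha><..<\<beta>} \<longrightarrow>
        u (s *\<^sub>R \<theta> + y) = g (\<beta> *\<^sub>R \<theta> + y) - (LINT t|lborel. indicator {s..\<beta>} t * v (t *\<^sub>R \<theta> + y))"
      if C: "{\<alpha><..<\<beta>} \<in> components S" for \<alpha> \<beta>
      using ae
    proof eventually_elim
      case (elim s)
      show ?case
      proof
        assume s: "s \<in> {\<alpha><..<\<beta>}"
        then have "R (s *\<^sub>R \<theta> + y)" using elim in_components_subset[OF C] by auto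
        moreover note exit = exit_time_component[OF C[unfolded S_def] s]
        moreover have "exit_integral \<Omega> \<theta> v (s *\<^sub>R \<theta> + y) = (LINT t|lborel. indicator {s..\<beta>} t * v (t *\<^sub>R \<theta> + y))"
        proof -
          have [measurable]: "v \<in> borel_measurable borel" using v by (rule extended_L2_borel)
          have "(LINT t|lborel. indicator {s..\<beta>} t * v (t *\<^sub>R \<theta> + y))
              = (LINT t|lborel. indicator {s..\<beta>} (t + s) * v ((t + s) *\<^sub>R \<theta> + y))"
            by (rule integral_translate(1)[symmetric]) measurable
          also have "\<dots> = (LINT t|lborel. indicator {0..\<beta> - s} t * v (s *\<^sub>R \<theta> + y + t *\<^sub>R \<theta>))"
            by (intro Bochner_Integration.integral_cong) (auto simp: algebra_simps split: split_indicator)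
          finally show ?thesis by (simp add: exit_integral_def exit)
        qed
        ultimately show "u (s *\<^sub>R \<theta> + y) = g (\<beta> *\<^sub>R \<theta> + y) - (LINT t|lborel. indicator {s..\<beta>} t * v (t *\<^sub>R \<theta> + y))"
          by (simp add: R_def)
      qed
    qed
    have "(\<lambda>s. u (s *\<^sub>R \<theta> + y)) \<in> H1_fun S"
      using prim by (intro H1_fun_real_if_primitive[OF S u_slice v_slice]) blast
    moreover have "\<exists>w. continuous_on {\<alpha><..\<beta>} w \<and> (AE s in lebesgue_on {\<alpha><..<\<beta>}. w s = u (s *\<^sub>R \<theta> + y)) \<and>
          g (\<beta> *\<^sub>R \<theta> + y) = w \<beta>" if C: "{\<alpha><..<\<beta>} \<in> components S" for \<alpha> \<beta>
    proof (intro exI conjI)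
      let ?w = "\<lambda>s. g (\<beta> *\<^sub>R \<theta> + y) - (LINT t|lborel. indicator {s..\<beta>} t * v (t *\<^sub>R \<theta> + y))"
      interpret S: bounded_domain S using S by unfold_locales
      have "set_integrable lborel {\<alpha>..\<beta>} (\<lambda>t. v (t *\<^sub>R \<theta> + y))"
        using S.extended_L2_integrable[OF v_slice] unfolding set_integrable_def
        by (intro integrable_mult_indicator) auto
      from continuous_on_primitive(2)[OF this]
      show "continuous_on {\<alpha><..\<beta>} ?w"
        by (intro continuous_intros) (auto elim: continuous_on_subset)
      show "AE s in lebesgue_on {\<alpha><..<\<beta>}. ?w s = u (s *\<^sub>R \<theta> + y)"
        using prim[OF C] by (subst AE_restrict_space_iff) (auto simp: AE_completion_iff elim: eventually_mono)
      have "(LINT t|lborel. indicator {\<beta>..\<beta>} t * v (t *\<^sub>R \<theta> + y)) = 0"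
      proof (rule integral_eq_zero_AE)
        have "AE t in lborel. t \<notin> {\<beta>}" by (rule AE_not_in) auto
        then show "AE t in lborel. indicator {\<beta>..\<beta>} t * v (t *\<^sub>R \<theta> + y) = 0"
          by eventually_elim auto
      qed
      then show "g (\<beta> *\<^sub>R \<theta> + y) = ?w \<beta>" by simp
    qed
    ultimately show ?thesis unfolding S_def by blast
  qed
  have "proj \<theta> ` \<Omega> - A \<in> null_sets (completion (hyperplane_measure \<theta>))"
    using null by (simp add: A_def Diff_Int)
  moreover have "A \<subseteq> proj \<theta> ` \<Omega>" by (auto simp: A_def)
  ultimately show ?thesis
    unfolding is_directional_trace_def using UW uU on_line by blast
qed

end

section \<open>Jets and their boundary values\<close>

text \<open>The first component is a function in \<open>H\<^sup>1\<close>, the second one its weak gradient.\<close>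

definition jets :: "'a::euclidean_space set \<Rightarrow> ('a \<Rightarrow> real \<times> 'a) set" where
  "jets \<Omega> = {F \<in> extended_L2 \<Omega>.
     \<forall>b\<in>Basis. has_weak_deriv \<Omega> b (\<lambda>x. fst (F x)) (\<lambda>x. snd (F x) \<bullet> b)}"

definition boundary_value :: "'a::euclidean_space set \<Rightarrow> 'a \<Rightarrow> ('a \<Rightarrow> real \<times> 'a) \<Rightarrow> 'a \<Rightarrow> real" where
  "boundary_value \<Omega> \<theta> F x = fst (F x) + exit_integral \<Omega> \<theta> (\<lambda>x. snd (F x) \<bullet> \<theta>) x"

text \<open>The omnidirectional trace, with the directional traces replaced by their values along the exit
  map; \<open>has_trace_iff\<close> below shows that this is the same notion.\<close>

definition has_boundary_trace ::
    "'a::euclidean_space set \<Rightarrow> ('a \<Rightarrow> real \<times> 'a) \<Rightarrow> ('a \<Rightarrow> real) \<Rightarrow> bool" where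
  "has_boundary_trace \<Omega> F g \<longleftrightarrow> g \<in> bdL2_fun \<Omega> \<and>
     (\<forall>\<theta>\<in>sphere 0 1. AE x in lebesgue_on \<Omega>. g (exit_point \<Omega> \<theta> x) = boundary_value \<Omega> \<theta> F x)"

context directed_domain
begin

lemma exit_integral_outside: "x \<notin> \<Omega> \<Longrightarrow> exit_integral \<Omega> \<theta> v x = 0"
proof -
  assume "x \<notin> \<Omega>"
  then have "\<delta> x = 0" using exit_time_pos_iff[of x] exit_time_nonneg[of x] by linarith
  moreover have "(LINT t|lborel. indicator {0..0} t * v (x + t *\<^sub>R \<theta>)) = 0"
  proof (rule integral_eq_zero_AE)
    have "AE t in lborel. t \<notin> {0::real}" by (rule AE_not_in) auto
    then show "AE t in lborel. indicator {0..0} t * v (x + t *\<^sub>R \<theta>) = 0" by eventually_elim auto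
  qed
  ultimately show ?thesis by (simp add: exit_integral_def)
qed

lemma exit_integral_borel:
  assumes [measurable]: "v \<in> borel_measurable borel"
  shows "exit_integral \<Omega> \<theta> v \<in> borel_measurable borel"
proof -
  have "(\<lambda>q. (if 0 \<le> snd q \<and> snd q \<le> \<delta> (fst q) then 1 else 0) * v (fst q + snd q *\<^sub>R \<theta>))
      \<in> borel_measurable (borel \<Otimes>\<^sub>M lborel)"
    by measurable
  then have "(\<lambda>(x, t). indicator {0..\<delta> x} t * v (x + t *\<^sub>R \<theta>)) \<in> borel_measurable (borel \<Otimes>\<^sub>M lborel)"
    by (simp add: split_beta' indicator_def of_bool_def)
  then have "(\<lambda>x. LINT t|lborel. indicator {0..\<delta> x} t * v (x + t *\<^sub>R \<theta>)) \<in> borel_measurable borel"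
    by (rule lborel.borel_measurable_lebesgue_integral)
  then show ?thesis by (simp add: exit_integral_def[abs_def])
qed

text \<open>By the Cauchy-Schwarz inequality on a segment of length at most \<open>D = diameter \<Omega>\<close>, the square
  of the exit integral at \<open>x\<close> is at most \<open>D\<close> times the integral of \<open>v\<^sup>2\<close> over the segment.
  Integrating the latter over all \<open>x\<close> gives another factor \<open>D\<close>, by translation invariance.\<close>

lemma exit_integral_bound:
  assumes v: "v \<in> extended_L2 \<Omega>"
  shows "exit_integral \<Omega> \<theta> v \<in> extended_L2 \<Omega>"
    and "(LINT x|lborel. (exit_integral \<Omega> \<theta> v x)\<^sup>2) \<le> (diameter \<Omega>)\<^sup>2 * (LINT x|lborel. (v x)\<^sup>2)"
proof -
  let ?D = "diameter \<Omega>"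
  note [measurable] = extended_L2_borel[OF v]
  have [measurable]: "exit_integral \<Omega> \<theta> v \<in> borel_measurable borel" by (rule exit_integral_borel) measurable
  have D: "0 \<le> ?D" by (rule diameter_ge_0[OF bounded_domain])
  have i1: "integrable lborel (indicator {0..?D} :: real \<Rightarrow> real)"
    by (simp add: emeasure_lborel_Icc_eq)
  have i2: "integrable lborel (\<lambda>x. (v x)\<^sup>2)" using v by (simp add: extended_L2_def sq_integrable_def)
  note pair = integrable_sheared_product[OF i2 i1, of \<theta>]
  define J where "J x = (LINT t|lborel. indicator {0..?D} t * (v (x + t *\<^sub>R \<theta>))\<^sup>2)" for x
  have iJ: "integrable lborel J" unfolding J_def by (rule lborel_pair.integrable_snd[OF pair])
  have "(LINT x|lborel. J x) = (LINT t|lborel. LINT x|lborel. indicator {0..?D} t * (v (x + t *\<^sub>R \<theta>))\<^sup>2)"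
    unfolding J_def by (rule lborel_pair.Fubini_integral[OF pair])
  also have "\<dots> = (LINT t|lborel. indicator {0..?D} t * (LINT x|lborel. (v x)\<^sup>2))"
    using integral_translate(1)[of "\<lambda>x. (v x)\<^sup>2"] by simp
  also have "\<dots> = ?D * (LINT x|lborel. (v x)\<^sup>2)" using D by simp
  finally have J: "(LINT x|lborel. J x) = ?D * (LINT x|lborel. (v x)\<^sup>2)" .
  have le: "AE x in lborel. (exit_integral \<Omega> \<theta> v x)\<^sup>2 \<le> ?D * J x"
    using lborel_pair.AE_integrable_snd[OF pair]
  proof eventually_elim
    case (elim x)
    have eq: "indicator {0..\<delta> x} t * (indicator {0..?D} t * (v (x + t *\<^sub>R \<theta>))\<^sup>2)
        = (indicator {0..\<delta> x} t * v (x + t *\<^sub>R \<theta>))\<^sup>2" for t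
      using exit_time_le_diameter[of x] by (auto split: split_indicator)
    have "integrable lborel (\<lambda>t. indicator {0..\<delta> x} t * (indicator {0..?D} t * (v (x + t *\<^sub>R \<theta>))\<^sup>2))"
      using integrable_real_mult_indicator[OF _ elim, of "{0..\<delta> x}"] by (simp add: mult.commute)
    then have sq: "integrable lborel (\<lambda>t. (indicator {0..\<delta> x} t * v (x + t *\<^sub>R \<theta>))\<^sup>2)"
      by (simp only: eq)
    have sq1: "(indicator {0..\<delta> x} t)\<^sup>2 = (indicator {0..\<delta> x} t :: real)" for t
      by (auto split: split_indicator)
    have prod: "indicator {0..\<delta> x} t \<bullet> (indicator {0..\<delta> x} t * v (x + t *\<^sub>R \<theta>)) = indicator {0..\<delta> x} t * v (x + t *\<^sub>R \<theta>)" for t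
      by (auto split: split_indicator)
    have "(LINT t|lborel. indicator {0..\<delta> x} t \<bullet> (indicator {0..\<delta> x} t * v (x + t *\<^sub>R \<theta>)))\<^sup>2
        \<le> (LINT t|lborel. (norm (indicator {0..\<delta> x} t :: real))\<^sup>2) * (LINT t|lborel. (norm (indicator {0..\<delta> x} t * v (x + t *\<^sub>R \<theta>)))\<^sup>2)"
      by (rule Cauchy_Schwarz_integral) (use sq in \<open>simp_all add: sq_integrable_def sq1 emeasure_lborel_Icc_eq\<close>)
    then have "(exit_integral \<Omega> \<theta> v x)\<^sup>2
        \<le> \<delta> x * (LINT t|lborel. (indicator {0..\<delta> x} t * v (x + t *\<^sub>R \<theta>))\<^sup>2)"
      by (simp only: prod) (simp add: exit_integral_def sq1)
    also have "\<dots> \<le> ?D * J x"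
    proof (rule mult_mono)
      show "(LINT t|lborel. (indicator {0..\<delta> x} t * v (x + t *\<^sub>R \<theta>))\<^sup>2) \<le> J x"
        unfolding J_def using sq elim exit_time_le_diameter[of x]
        by (intro integral_mono) (auto split: split_indicator)
    qed (use exit_time_le_diameter D in auto)
    finally show ?case .
  qed
  have int: "integrable lborel (\<lambda>x. (exit_integral \<Omega> \<theta> v x)\<^sup>2)"
  proof (rule Bochner_Integration.integrable_bound)
    show "integrable lborel (\<lambda>x. ?D * J x)" using iJ by simp
    show "AE x in lborel. norm ((exit_integral \<Omega> \<theta> v x)\<^sup>2) \<le> norm (?D * J x)"
      using le by eventually_elim auto
  qed measurable
  then show "exit_integral \<Omega> \<theta> v \<in> extended_L2 \<Omega>"
    by (auto simp: extended_L2_def sq_integrable_def exit_integral_outside)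
  have "(LINT x|lborel. (exit_integral \<Omega> \<theta> v x)\<^sup>2) \<le> (LINT x|lborel. ?D * J x)"
    using int iJ le by (intro integral_mono_AE) auto
  also have "\<dots> = ?D\<^sup>2 * (LINT x|lborel. (v x)\<^sup>2)" by (simp add: J power2_eq_square)
  finally show "(LINT x|lborel. (exit_integral \<Omega> \<theta> v x)\<^sup>2) \<le> ?D\<^sup>2 * (LINT x|lborel. (v x)\<^sup>2)" .
qed

lemma exit_integral_add:
  assumes v: "v \<in> extended_L2 \<Omega>" and w: "w \<in> extended_L2 \<Omega>"
  shows "AE x in lborel. exit_integral \<Omega> \<theta> (\<lambda>x. v x + w x) x = exit_integral \<Omega> \<theta> v x + exit_integral \<Omega> \<theta> w x"
  using AE_integrable_to_exit[OF v] AE_integrable_to_exit[OF w]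
  by eventually_elim (simp add: exit_integral_def distrib_left)

lemma exit_integral_scale: "exit_integral \<Omega> \<theta> (\<lambda>x. c * v x) x = c * exit_integral \<Omega> \<theta> v x"
  by (simp add: exit_integral_def mult.left_commute)

lemma exit_integral_AE_cong:
  assumes v: "v \<in> extended_L2 \<Omega>" and w: "w \<in> extended_L2 \<Omega>" and eq: "AE x in lborel. v x = w x"
  shows "AE x in lborel. exit_integral \<Omega> \<theta> v x = exit_integral \<Omega> \<theta> w x"
  using AE_lines[OF eq]
proof eventually_elim
  case (elim x)
  note [measurable] = extended_L2_borel[OF v] extended_L2_borel[OF w]
  show ?case unfolding exit_integral_def
    by (rule integral_cong_AE) (measurable, use elim in \<open>eventually_elim, simp\<close>)
qed

end

context bounded_domain
begin

lemma directed: "\<theta> \<in> sphere 0 1 \<Longrightarrow> directed_domain \<Omega> \<theta>"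
  by unfold_locales simp

lemma jets_extended_L2: "F \<in> jets \<Omega> \<Longrightarrow> F \<in> extended_L2 \<Omega>"
  by (simp add: jets_def)

lemma jet_weak_deriv:
  assumes "F \<in> jets \<Omega>" shows "has_weak_deriv \<Omega> e (\<lambda>x. fst (F x)) (\<lambda>x. snd (F x) \<bullet> e)"
proof (rule has_weak_deriv_direction[OF extended_L2_components[OF jets_extended_L2[OF assms]]])
  show "has_weak_deriv \<Omega> b (\<lambda>x. fst (F x)) (\<lambda>x. snd (F x) \<bullet> b)" if "b \<in> Basis" for b
    using assms that by (simp add: jets_def)
qed

lemma bounded_extended_L2:
  fixes f :: "'a \<Rightarrow> real"
  assumes [measurable]: "f \<in> borel_measurable borel" and B: "\<And>x. \<bar>f x\<bar> \<le> B"
  shows "(\<lambda>x. indicator \<Omega> x * f x) \<in> extended_L2 \<Omega>"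
proof -
  have "sq_integrable lborel (\<lambda>x. indicator \<Omega> x * f x)"
  proof (rule sq_integrable_dominated(1))
    show "sq_integrable lborel (\<lambda>x. B *\<^sub>R (indicator \<Omega> x :: real))"
    proof (rule sq_integrable_scaleR)
      have "(norm (indicator \<Omega> x :: real))\<^sup>2 = indicator \<Omega> x" for x :: 'a by (auto split: split_indicator)
      then show "sq_integrable lborel (indicator \<Omega> :: 'a \<Rightarrow> real)"
        using emeasure_domain_finite by (simp add: sq_integrable_def)
    qed
    show "norm (indicator \<Omega> x * f x) \<le> norm (B *\<^sub>R (indicator \<Omega> x :: real))" for x
      using B[of x] by (auto split: split_indicator)
  qed measurable
  then show ?thesis by (auto simp: extended_L2_def)
qed

lemma jets_lincomb:
  assumes F: "F \<in> jets \<Omega>" and G: "G \<in> jets \<Omega>"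
  shows "(\<lambda>x. F x + c *\<^sub>R G x) \<in> jets \<Omega>"
proof -
  have ext: "(\<lambda>x. F x + c *\<^sub>R G x) \<in> extended_L2 \<Omega>"
    by (intro extended_L2_add extended_L2_scaleR jets_extended_L2 F G)
  have "has_weak_deriv \<Omega> b (\<lambda>x. fst (F x + c *\<^sub>R G x)) (\<lambda>x. snd (F x + c *\<^sub>R G x) \<bullet> b)" if "b \<in> Basis" for b
  proof -
    note comp = extended_L2_components[OF jets_extended_L2[OF F]] extended_L2_components[OF jets_extended_L2[OF G]]
    note int = integrable_mult_test_function[OF comp(1)] integrable_mult_test_function[OF comp(3)]
      integrable_mult_test_function[OF extended_L2_inner[OF comp(2)]]
      integrable_mult_test_function[OF extended_L2_inner[OF comp(4)]]
    have wd: "has_weak_deriv \<Omega> b (\<lambda>x. fst (F x)) (\<lambda>x. snd (F x) \<bullet> b)" "has_weak_deriv \<Omega> b (\<lambda>x. fst (G x)) (\<lambda>x. snd (G x) \<bullet> b)"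
      using F G that by (auto simp: jets_def)
    note wd' = wd[unfolded has_weak_deriv_iff[OF comp(1) extended_L2_inner[OF comp(2)]]
        has_weak_deriv_iff[OF comp(3) extended_L2_inner[OF comp(4)]], rule_format]
    show ?thesis
      unfolding has_weak_deriv_iff[OF extended_L2_components(1)[OF ext] extended_L2_inner[OF extended_L2_components(2)[OF ext]]]
      using int wd' by (auto simp: algebra_simps inner_add_left)
  qed
  with ext show ?thesis by (simp add: jets_def)
qed

lemma jets_zero: "(\<lambda>x. 0) \<in> jets \<Omega>"
  by (simp add: jets_def extended_L2_def sq_integrable_def has_weak_deriv_def)

lemma jets_diff: "F \<in> jets \<Omega> \<Longrightarrow> G \<in> jets \<Omega> \<Longrightarrow> (\<lambda>x. F x - G x) \<in> jets \<Omega>"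
  using jets_lincomb[of F G "-1"] by simp

text \<open>The condition that defines a weak derivative is the vanishing of a scalar product in \<open>L\<^sup>2\<close>,
  between the jet and the pair formed by the derivative of the test function and the test
  function itself, and it therefore survives limits.\<close>

lemma jets_closed:
  assumes F: "\<And>n. F n \<in> jets \<Omega>" and G: "G \<in> extended_L2 \<Omega>"
    and lim: "(\<lambda>n. LINT x|lborel. (norm (F n x - G x))\<^sup>2) \<longlonglongrightarrow> 0"
  shows "G \<in> jets \<Omega>"
proof -
  have "has_weak_deriv \<Omega> b (\<lambda>x. fst (G x)) (\<lambda>x. snd (G x) \<bullet> b)" if b: "b \<in> Basis" for b
    unfolding has_weak_deriv_iff[OF extended_L2_components(1)[OF G] extended_L2_inner[OF extended_L2_components(2)[OF G]]]
  proof
    fix \<phi> assume \<phi>: "\<phi> \<in> test_functions \<Omega>"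
    define p where "p x = indicator \<Omega> x * \<phi> x" for x
    define q where "q x = indicator \<Omega> x * frechet_derivative \<phi> (at x) b" for x
    obtain B B' where "\<And>x. \<bar>\<phi> x\<bar> \<le> B" "\<And>x. \<bar>frechet_derivative \<phi> (at x) b\<bar> \<le> B'"
      using test_function_bounded[OF \<phi>] test_function_deriv_bounded[OF \<phi>] by metis
    then have pq: "p \<in> extended_L2 \<Omega>" "q \<in> extended_L2 \<Omega>"
      unfolding p_def q_def
      by (auto intro!: bounded_extended_L2 test_function_borel[OF \<phi>] test_function_deriv_borel[OF \<phi>])
    have [measurable]: "p \<in> borel_measurable borel" "q \<in> borel_measurable borel"
      using pq by (auto intro: extended_L2_borel)
    define h where "h x = (q x, p x *\<^sub>R b)" for x
    have h: "sq_integrable lborel h"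
    proof (rule sq_integrable_dominated(1))
      show "sq_integrable lborel (\<lambda>x. \<bar>q x\<bar> + \<bar>p x\<bar>)"
        using pq by (intro sq_integrable_add) (auto simp: extended_L2_def sq_integrable_def)
      show "norm (h x) \<le> norm (\<bar>q x\<bar> + \<bar>p x\<bar>)" for x
        using norm_Pair_le[of "q x" "p x *\<^sub>R b"] b by (simp add: h_def)
      show "h \<in> borel_measurable lborel" unfolding h_def by measurable
    qed
    have split: "(LINT x|lborel. H x \<bullet> h x) = (LINT x|lborel. fst (H x) * frechet_derivative \<phi> (at x) b)
        + (LINT x|lborel. (snd (H x) \<bullet> b) * \<phi> x)" if H: "H \<in> extended_L2 \<Omega>" for H :: "'a \<Rightarrow> real \<times> 'a"
    proof -
      have "H x \<bullet> h x = fst (H x) * frechet_derivative \<phi> (at x) b + (snd (H x) \<bullet> b) * \<phi> x" for x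
        using extended_L2_outside[OF H, of x] by (cases "x \<in> \<Omega>") (auto simp: inner_prod_def h_def p_def q_def)
      then show ?thesis
        using integrable_mult_test_function(2)[OF extended_L2_components(1)[OF H] \<phi>, of b]
          integrable_mult_test_function(1)[OF extended_L2_inner[OF extended_L2_components(2)[OF H]] \<phi>, of b]
        by simp
    qed
    have "(LINT x|lborel. F n x \<bullet> h x) = 0" for n
    proof -
      note ext = jets_extended_L2[OF F[of n]]
      have "has_weak_deriv \<Omega> b (\<lambda>x. fst (F n x)) (\<lambda>x. snd (F n x) \<bullet> b)"
        using F[of n] b by (simp add: jets_def)
      then show ?thesis
        using \<phi> by (simp add: split[OF ext]
            has_weak_deriv_iff[OF extended_L2_components(1)[OF ext] extended_L2_inner[OF extended_L2_components(2)[OF ext]]])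
    qed
    moreover have "(\<lambda>n. LINT x|lborel. F n x \<bullet> h x) \<longlonglongrightarrow> (LINT x|lborel. G x \<bullet> h x)"
      by (rule tendsto_integral_inner[OF extended_L2_sq_integrable[OF jets_extended_L2[OF F]]
            extended_L2_sq_integrable[OF G] h lim])
    ultimately have "(LINT x|lborel. G x \<bullet> h x) = 0" by (simp add: LIMSEQ_const_iff)
    then show "(LINT x|lborel. fst (G x) * frechet_derivative \<phi> (at x) b) = - (LINT x|lborel. (snd (G x) \<bullet> b) * \<phi> x)"
      by (simp add: split[OF G])
  qed
  then show ?thesis using G by (simp add: jets_def)
qed

lemma integral_norm_square_split:
  fixes F :: "'a \<Rightarrow> real \<times> 'a"
  assumes F: "F \<in> extended_L2 \<Omega>"
  shows "(LINT x|lborel. (norm (F x))\<^sup>2) = (LINT x|lborel. (fst (F x))\<^sup>2) + (LINT x|lborel. (norm (snd (F x)))\<^sup>2)"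
proof -
  have "(norm (F x))\<^sup>2 = (fst (F x))\<^sup>2 + (norm (snd (F x)))\<^sup>2" for x
    by (simp add: norm_prod_def)
  then show ?thesis
    using extended_L2_components[OF F] by (simp add: extended_L2_def sq_integrable_def)
qed

lemma boundary_value_extended_L2:
  assumes "F \<in> extended_L2 \<Omega>" "\<theta> \<in> sphere 0 1"
  shows "boundary_value \<Omega> \<theta> F \<in> extended_L2 \<Omega>"
proof -
  interpret directed_domain \<Omega> \<theta> using assms(2) by (rule directed)
  show ?thesis
    unfolding boundary_value_def[abs_def]
    by (intro extended_L2_add exit_integral_bound(1) extended_L2_inner extended_L2_components assms)
qed

lemma exit_integral_gradient_bound:
  fixes F :: "'a \<Rightarrow> real \<times> 'a"
  assumes F: "F \<in> extended_L2 \<Omega>" and \<theta>: "\<theta> \<in> sphere 0 1"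
  shows "(LINT x|lborel. (exit_integral \<Omega> \<theta> (\<lambda>x. snd (F x) \<bullet> \<theta>) x)\<^sup>2)
    \<le> (diameter \<Omega>)\<^sup>2 * (LINT x|lborel. (norm (snd (F x)))\<^sup>2)"
proof -
  interpret directed_domain \<Omega> \<theta> using \<theta> by (rule directed)
  note v = extended_L2_inner[OF extended_L2_components(2)[OF F], of \<theta>]
  have "(LINT x|lborel. (snd (F x) \<bullet> \<theta>)\<^sup>2) \<le> (LINT x|lborel. (norm (snd (F x)))\<^sup>2)"
    using sq_integrable_dominated(2)[of lborel "\<lambda>x. snd (F x)" "\<lambda>x. snd (F x) \<bullet> \<theta>"]
      extended_L2_components(2)[OF F] v Cauchy_Schwarz_ineq2[of _ \<theta>]
    by (simp add: extended_L2_def sq_integrable_def)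
  with exit_integral_bound(2)[OF v] show ?thesis
    by (meson mult_left_mono order_trans zero_le_power2)
qed

text \<open>The constant does not depend on the direction; this uniformity is what the definition of
  \<open>bdL2_fun\<close> asks for.\<close>

lemma boundary_value_bound:
  assumes F: "F \<in> extended_L2 \<Omega>" and \<theta>: "\<theta> \<in> sphere 0 1"
  shows "(LINT x|lborel. (boundary_value \<Omega> \<theta> F x)\<^sup>2)
    \<le> (2 + 2 * (diameter \<Omega>)\<^sup>2) * (LINT x|lborel. (norm (F x))\<^sup>2)"
proof -
  interpret directed_domain \<Omega> \<theta> using \<theta> by (rule directed)
  let ?w = "exit_integral \<Omega> \<theta> (\<lambda>x. snd (F x) \<bullet> \<theta>)"
  have w: "?w \<in> extended_L2 \<Omega>"
    by (intro exit_integral_bound(1) extended_L2_inner extended_L2_components F)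
  have "(LINT x|lborel. (boundary_value \<Omega> \<theta> F x)\<^sup>2) \<le> (LINT x|lborel. 2 * (fst (F x))\<^sup>2 + 2 * (?w x)\<^sup>2)"
  proof (rule integral_mono)
    show "integrable lborel (\<lambda>x. (boundary_value \<Omega> \<theta> F x)\<^sup>2)"
      using boundary_value_extended_L2[OF F \<theta>] by (simp add: extended_L2_def sq_integrable_def)
    show "integrable lborel (\<lambda>x. 2 * (fst (F x))\<^sup>2 + 2 * (?w x)\<^sup>2)"
      using extended_L2_components(1)[OF F] w by (simp add: extended_L2_def sq_integrable_def)
    show "(boundary_value \<Omega> \<theta> F x)\<^sup>2 \<le> 2 * (fst (F x))\<^sup>2 + 2 * (?w x)\<^sup>2" for x
      using sum_squares_bound[of "fst (F x)" "?w x"] by (simp add: boundary_value_def power2_sum)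
  qed
  also have "\<dots> = 2 * (LINT x|lborel. (fst (F x))\<^sup>2) + 2 * (LINT x|lborel. (?w x)\<^sup>2)"
    using extended_L2_components(1)[OF F] w by (simp add: extended_L2_def sq_integrable_def)
  also have "\<dots> \<le> 2 * (LINT x|lborel. (fst (F x))\<^sup>2) + 2 * ((diameter \<Omega>)\<^sup>2 * (LINT x|lborel. (norm (snd (F x)))\<^sup>2))"
    using exit_integral_gradient_bound[OF F \<theta>] by simp
  also have "\<dots> \<le> (2 + 2 * (diameter \<Omega>)\<^sup>2) * (LINT x|lborel. (norm (F x))\<^sup>2)"
  proof -
    have "0 \<le> (LINT x|lborel. (fst (F x))\<^sup>2)" "0 \<le> (LINT x|lborel. (norm (snd (F x)))\<^sup>2)" by simp_all
    then show ?thesis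
      by (simp add: integral_norm_square_split[OF F] algebra_simps)
  qed
  finally show ?thesis .
qed

lemma boundary_value_lincomb:
  assumes F: "F \<in> extended_L2 \<Omega>" and G: "G \<in> extended_L2 \<Omega>" and \<theta>: "\<theta> \<in> sphere 0 1"
  shows "AE x in lborel. boundary_value \<Omega> \<theta> (\<lambda>x. F x + c *\<^sub>R G x) x
    = boundary_value \<Omega> \<theta> F x + c * boundary_value \<Omega> \<theta> G x"
proof -
  interpret directed_domain \<Omega> \<theta> using \<theta> by (rule directed)
  have "(\<lambda>x. c * (snd (G x) \<bullet> \<theta>)) \<in> extended_L2 \<Omega>"
    using extended_L2_scaleR[OF extended_L2_inner[OF extended_L2_components(2)[OF G], of \<theta>], of c] by simp
  from exit_integral_add[OF extended_L2_inner[OF extended_L2_components(2)[OF F], of \<theta>] this]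
  show ?thesis
    by eventually_elim (simp add: boundary_value_def exit_integral_scale inner_add_left algebra_simps)
qed

lemma boundary_value_AE_cong:
  assumes F: "F \<in> extended_L2 \<Omega>" and G: "G \<in> extended_L2 \<Omega>" and \<theta>: "\<theta> \<in> sphere 0 1"
    and eq: "AE x in lborel. F x = G x"
  shows "AE x in lborel. boundary_value \<Omega> \<theta> F x = boundary_value \<Omega> \<theta> G x"
proof -
  interpret directed_domain \<Omega> \<theta> using \<theta> by (rule directed)
  have "AE x in lborel. snd (F x) \<bullet> \<theta> = snd (G x) \<bullet> \<theta>" using eq by eventually_elim simp
  from exit_integral_AE_cong[OF extended_L2_inner[OF extended_L2_components(2)[OF F]]
      extended_L2_inner[OF extended_L2_components(2)[OF G]] this] eq
  show ?thesis by eventually_elim (simp add: boundary_value_def)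
qed

section \<open>Boundary functions that are traces of a jet\<close>

lemma bdL2_fun_measurable:
  assumes "g \<in> bdL2_fun \<Omega>" "\<theta> \<in> sphere 0 1"
  obtains g' where "g' \<in> borel_measurable (directional_measure \<Omega> \<theta>)"
    "AE z in directional_measure \<Omega> \<theta>. g z = g' z"
proof -
  obtain C where "\<forall>\<theta>\<in>sphere 0 1. \<exists>g'\<in>L2_fun (directional_measure \<Omega> \<theta>).
      (AE z in directional_measure \<Omega> \<theta>. g z = g' z) \<and> (LINT z|directional_measure \<Omega> \<theta>. \<bar>g' z\<bar>\<^sup>2) \<le> C"
    using assms(1) unfolding bdL2_fun_def by blast
  from bspec[OF this assms(2)] obtain g' where g': "g' \<in> L2_fun (directional_measure \<Omega> \<theta>)"
    "AE z in directional_measure \<Omega> \<theta>. g z = g' z" by blast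
  show thesis by (rule that[of g']) (use g' in \<open>simp_all add: L2_fun_def\<close>)
qed

text \<open>A function with the right values along the exit maps is automatically square-integrable with a
  bound uniform in the direction, so only measurability has to be checked.\<close>

lemma has_boundary_traceI:
  assumes F: "F \<in> extended_L2 \<Omega>"
    and meas: "\<And>\<theta>. \<theta> \<in> sphere 0 1 \<Longrightarrow> \<exists>g'\<in>borel_measurable (directional_measure \<Omega> \<theta>).
      AE z in directional_measure \<Omega> \<theta>. g z = g' z"
    and eq: "\<And>\<theta>. \<theta> \<in> sphere 0 1 \<Longrightarrow> AE x in lebesgue_on \<Omega>. g (exit_point \<Omega> \<theta> x) = boundary_value \<Omega> \<theta> F x"
  shows "has_boundary_trace \<Omega> F g"
proof -
  let ?C = "(2 + 2 * (diameter \<Omega>)\<^sup>2) * (LINT x|lborel. (norm (F x))\<^sup>2)"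
  have "\<exists>g'\<in>L2_fun (directional_measure \<Omega> \<theta>). (AE z in directional_measure \<Omega> \<theta>. g z = g' z) \<and>
      (LINT z|directional_measure \<Omega> \<theta>. \<bar>g' z\<bar>\<^sup>2) \<le> ?C" if \<theta>: "\<theta> \<in> sphere 0 1" for \<theta>
  proof -
    interpret directed_domain \<Omega> \<theta> using \<theta> by (rule directed)
    obtain g' where g'[measurable]: "g' \<in> borel_measurable (directional_measure \<Omega> \<theta>)"
      and gg': "AE z in directional_measure \<Omega> \<theta>. g z = g' z" using meas[OF \<theta>] by blast
    have g'_borel: "g' \<in> borel_measurable (restrict_space borel (frontier \<Omega>))"
      using g' by (simp add: directional_measure_def)
    have "AE x in lebesgue_on \<Omega>. g (\<Phi> x) = g' (\<Phi> x)"
      using gg' by (simp add: AE_directional_measure_iff)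
    with eq[OF \<theta>] have ae: "AE x in lebesgue_on \<Omega>. (boundary_value \<Omega> \<theta> F x)\<^sup>2 = (g' (\<Phi> x))\<^sup>2"
      by eventually_elim simp
    note bv = boundary_value_extended_L2[OF F \<theta>]
    note [measurable] = extended_L2_borel[OF bv]
    have zero: "(boundary_value \<Omega> \<theta> F x)\<^sup>2 = 0" if "x \<notin> \<Omega>" for x
      using extended_L2_outside[OF bv that] by simp
    have bvm: "(\<lambda>x. (boundary_value \<Omega> \<theta> F x)\<^sup>2) \<in> borel_measurable (lebesgue_on \<Omega>)"
      by (rule borel_measurable_lebesgue_on_domain) measurable
    have gm: "(\<lambda>x. (g' (\<Phi> x))\<^sup>2) \<in> borel_measurable (lebesgue_on \<Omega>)"
      using measurable_compose[OF exit_point_measurable g'_borel] by measurable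
    have bvi: "integrable (lebesgue_on \<Omega>) (\<lambda>x. (boundary_value \<Omega> \<theta> F x)\<^sup>2)"
      using bv zero by (subst integral_lebesgue_on_domain(2)) (auto simp: extended_L2_def sq_integrable_def)
    have "integrable (lebesgue_on \<Omega>) (\<lambda>x. (g' (\<Phi> x))\<^sup>2)"
      by (rule integrable_cong_AE_imp[OF bvi gm ae])
    then have "integrable (directional_measure \<Omega> \<theta>) (\<lambda>z. (g' z)\<^sup>2)"
      unfolding directional_measure_def using g'_borel by (subst integrable_distr_eq[OF exit_point_measurable]) auto
    moreover have "(LINT z|directional_measure \<Omega> \<theta>. (g' z)\<^sup>2) = (LINT x|lebesgue_on \<Omega>. (g' (\<Phi> x))\<^sup>2)"
      unfolding directional_measure_def using g'_borel by (subst integral_distr[OF exit_point_measurable]) auto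
    moreover have "\<dots> = (LINT x|lebesgue_on \<Omega>. (boundary_value \<Omega> \<theta> F x)\<^sup>2)"
      by (rule integral_cong_AE[OF gm bvm]) (use ae in \<open>eventually_elim, simp\<close>)
    moreover have "\<dots> = (LINT x|lborel. (boundary_value \<Omega> \<theta> F x)\<^sup>2)"
      using zero by (intro integral_lebesgue_on_domain(1)) auto
    ultimately show ?thesis
      using gg' g' boundary_value_bound[OF F \<theta>] by (intro bexI[of _ g'] conjI) (simp_all add: L2_fun_def)
  qed
  then have "g \<in> bdL2_fun \<Omega>"
    unfolding bdL2_fun_def by (intro CollectI exI[of _ ?C]) auto
  with eq show ?thesis by (simp add: has_boundary_trace_def)
qed

lemma has_boundary_trace_zero: "has_boundary_trace \<Omega> (\<lambda>x. 0) (\<lambda>z. 0)"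
  by (rule has_boundary_traceI)
    (auto simp: boundary_value_def exit_integral_def extended_L2_def sq_integrable_def intro!: bexI[of _ "\<lambda>z. 0"])

lemma has_boundary_trace_lincomb:
  assumes F: "F \<in> jets \<Omega>" "has_boundary_trace \<Omega> F f" and G: "G \<in> jets \<Omega>" "has_boundary_trace \<Omega> G g"
  shows "has_boundary_trace \<Omega> (\<lambda>x. F x + c *\<^sub>R G x) (\<lambda>z. f z + c * g z)"
proof (rule has_boundary_traceI)
  show "(\<lambda>x. F x + c *\<^sub>R G x) \<in> extended_L2 \<Omega>" by (intro jets_extended_L2 jets_lincomb F G)
  fix \<theta> :: 'a assume \<theta>: "\<theta> \<in> sphere 0 1"
  obtain f' where f': "f' \<in> borel_measurable (directional_measure \<Omega> \<theta>)"
    "AE z in directional_measure \<Omega> \<theta>. f z = f' z"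
    using F(2) \<theta> by (auto simp: has_boundary_trace_def elim: bdL2_fun_measurable)
  obtain g' where g': "g' \<in> borel_measurable (directional_measure \<Omega> \<theta>)"
    "AE z in directional_measure \<Omega> \<theta>. g z = g' z"
    using G(2) \<theta> by (auto simp: has_boundary_trace_def elim: bdL2_fun_measurable)
  have "(\<lambda>z. f' z + c * g' z) \<in> borel_measurable (directional_measure \<Omega> \<theta>)"
    using f'(1) g'(1) by measurable
  moreover have "AE z in directional_measure \<Omega> \<theta>. f z + c * g z = f' z + c * g' z"
    using f'(2) g'(2) by eventually_elim simp
  ultimately show "\<exists>h\<in>borel_measurable (directional_measure \<Omega> \<theta>).
      AE z in directional_measure \<Omega> \<theta>. f z + c * g z = h z"
    by (intro bexI[of _ "\<lambda>z. f' z + c * g' z"])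
  have "AE x in lebesgue_on \<Omega>. boundary_value \<Omega> \<theta> (\<lambda>x. F x + c *\<^sub>R G x) x
      = boundary_value \<Omega> \<theta> F x + c * boundary_value \<Omega> \<theta> G x"
    unfolding AE_lebesgue_on_domain
    using boundary_value_lincomb[OF jets_extended_L2[OF F(1)] jets_extended_L2[OF G(1)] \<theta>, of c] by eventually_elim simp
  moreover have "AE x in lebesgue_on \<Omega>. f (exit_point \<Omega> \<theta> x) = boundary_value \<Omega> \<theta> F x"
    "AE x in lebesgue_on \<Omega>. g (exit_point \<Omega> \<theta> x) = boundary_value \<Omega> \<theta> G x"
    using F(2) G(2) \<theta> by (auto simp: has_boundary_trace_def)
  ultimately show "AE x in lebesgue_on \<Omega>. f (exit_point \<Omega> \<theta> x) + c * g (exit_point \<Omega> \<theta> x)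
      = boundary_value \<Omega> \<theta> (\<lambda>x. F x + c *\<^sub>R G x) x"
    by eventually_elim simp
qed

lemma has_boundary_trace_AE_cong:
  assumes F: "F \<in> jets \<Omega>" and G: "G \<in> jets \<Omega>" and eq: "AE x in lborel. F x = G x"
    and tr: "has_boundary_trace \<Omega> F g"
  shows "has_boundary_trace \<Omega> G g"
  unfolding has_boundary_trace_def
proof (intro conjI ballI)
  show "g \<in> bdL2_fun \<Omega>" using tr by (simp add: has_boundary_trace_def)
  fix \<theta> :: 'a assume \<theta>: "\<theta> \<in> sphere 0 1"
  have "AE x in lebesgue_on \<Omega>. boundary_value \<Omega> \<theta> F x = boundary_value \<Omega> \<theta> G x"
    unfolding AE_lebesgue_on_domain
    using boundary_value_AE_cong[OF jets_extended_L2[OF F] jets_extended_L2[OF G] \<theta> eq] by eventually_elim simp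
  moreover have "AE x in lebesgue_on \<Omega>. g (exit_point \<Omega> \<theta> x) = boundary_value \<Omega> \<theta> F x"
    using tr \<theta> by (simp add: has_boundary_trace_def)
  ultimately show "AE x in lebesgue_on \<Omega>. g (exit_point \<Omega> \<theta> x) = boundary_value \<Omega> \<theta> G x"
    by eventually_elim simp
qed

lemma has_boundary_trace_rel:
  assumes tr: "has_boundary_trace \<Omega> F g"
  shows "has_boundary_trace \<Omega> F g' \<longleftrightarrow> (g, g') \<in> bdL2_rel \<Omega>"
proof
  assume tr': "has_boundary_trace \<Omega> F g'"
  have "AE z in directional_measure \<Omega> \<theta>. g z = g' z" if \<theta>: "\<theta> \<in> sphere 0 1" for \<theta>
  proof -
    interpret directed_domain \<Omega> \<theta> using \<theta> by (rule directed)
    have "AE x in lebesgue_on \<Omega>. g (\<Phi> x) = boundary_value \<Omega> \<theta> F x"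
      "AE x in lebesgue_on \<Omega>. g' (\<Phi> x) = boundary_value \<Omega> \<theta> F x"
      using tr tr' \<theta> by (auto simp: has_boundary_trace_def)
    then show ?thesis unfolding AE_directional_measure_iff by eventually_elim simp
  qed
  then show "(g, g') \<in> bdL2_rel \<Omega>" using tr tr' by (auto simp: bdL2_rel_def has_boundary_trace_def)
next
  assume rel: "(g, g') \<in> bdL2_rel \<Omega>"
  have "AE x in lebesgue_on \<Omega>. g' (exit_point \<Omega> \<theta> x) = boundary_value \<Omega> \<theta> F x" if \<theta>: "\<theta> \<in> sphere 0 1" for \<theta>
  proof -
    interpret directed_domain \<Omega> \<theta> using \<theta> by (rule directed)
    have "AE z in directional_measure \<Omega> \<theta>. g z = g' z" using rel \<theta> by (simp add: bdL2_rel_def)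
    then have "AE x in lebesgue_on \<Omega>. g (\<Phi> x) = g' (\<Phi> x)" by (simp add: AE_directional_measure_iff)
    moreover have "AE x in lebesgue_on \<Omega>. g (\<Phi> x) = boundary_value \<Omega> \<theta> F x"
      using tr \<theta> by (simp add: has_boundary_trace_def)
    ultimately show ?thesis by eventually_elim simp
  qed
  then show "has_boundary_trace \<Omega> F g'" using rel by (simp add: has_boundary_trace_def bdL2_rel_def)
qed

text \<open>Where the boundary value in some direction vanishes, the function is minus its exit integral,
  which is bounded by the gradient.\<close>

lemma Poincare_zero_trace:
  assumes F: "F \<in> jets \<Omega>" and tr: "has_boundary_trace \<Omega> F (\<lambda>z. 0)"
  shows "(LINT x|lborel. (norm (F x))\<^sup>2) \<le> ((diameter \<Omega>)\<^sup>2 + 1) * (LINT x|lborel. (norm (snd (F x)))\<^sup>2)"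
proof -
  obtain \<theta> :: 'a where \<theta>: "\<theta> \<in> sphere 0 1"
    using SOME_Basis norm_Basis by (metis dist_0_norm mem_sphere)
  interpret directed_domain \<Omega> \<theta> using \<theta> by (rule directed)
  note ext = jets_extended_L2[OF F]
  let ?w = "exit_integral \<Omega> \<theta> (\<lambda>x. snd (F x) \<bullet> \<theta>)"
  have w: "?w \<in> extended_L2 \<Omega>"
    by (intro exit_integral_bound(1) extended_L2_inner extended_L2_components ext)
  have "AE x in lborel. x \<in> \<Omega> \<longrightarrow> 0 = boundary_value \<Omega> \<theta> F x"
    using tr \<theta> unfolding has_boundary_trace_def AE_lebesgue_on_domain by blast
  then have ae: "AE x in lborel. (fst (F x))\<^sup>2 = (?w x)\<^sup>2"
  proof eventually_elim
    case (elim x)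
    show ?case
    proof (cases "x \<in> \<Omega>")
      case True
      then have "fst (F x) = - ?w x" using elim by (simp add: boundary_value_def)
      then show ?thesis by simp
    qed (simp add: extended_L2_outside[OF ext] exit_integral_outside)
  qed
  note [measurable] = extended_L2_borel[OF w] extended_L2_borel[OF extended_L2_components(1)[OF ext]]
  have "(LINT x|lborel. (fst (F x))\<^sup>2) = (LINT x|lborel. (?w x)\<^sup>2)"
    by (rule integral_cong_AE[OF _ _ ae]) measurable
  then show ?thesis
    using exit_integral_gradient_bound[OF ext \<theta>]
    by (simp add: integral_norm_square_split[OF ext] algebra_simps)
qed

text \<open>The boundary values of the differences between the subsequence and the limit have
  geometrically decaying square integrals in every direction, so they tend to zero almost
  everywhere. Hence the traces converge at almost all exit points, and their pointwise limit,
  which does not refer to a direction, is the trace of the limit.\<close>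

theorem jets_with_trace_complete:
  assumes F: "\<And>n. F n \<in> jets \<Omega>" and tr: "\<And>n. has_boundary_trace \<Omega> (F n) (g n)"
    and Cauchy: "\<And>e. 0 < e \<Longrightarrow> \<exists>N. \<forall>m\<ge>N. \<forall>n\<ge>N. (LINT x|lborel. (norm (F m x - F n x))\<^sup>2) < e"
  obtains G and r :: "nat \<Rightarrow> nat" where "G \<in> jets \<Omega>" "has_boundary_trace \<Omega> G (\<lambda>z. lim (\<lambda>k. g (r k) z))"
    "(\<lambda>n. LINT x|lborel. (norm (F n x - G x))\<^sup>2) \<longlonglongrightarrow> 0"
proof -
  note ext = jets_extended_L2[OF F]
  obtain r :: "nat \<Rightarrow> nat" and G where G_def: "G = (\<lambda>x. lim (\<lambda>k. F (r k) x))"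
    and sqG: "sq_integrable lborel G" and "AE x in lborel. (\<lambda>k. F (r k) x) \<longlonglongrightarrow> G x"
    and rate: "\<And>k. (LINT x|lborel. (norm (F (r k) x - G x))\<^sup>2) \<le> (1/4)^k"
    and lim: "(\<lambda>n. LINT x|lborel. (norm (F n x - G x))\<^sup>2) \<longlonglongrightarrow> 0"
    by (rule L2_complete[OF extended_L2_sq_integrable[OF ext] Cauchy]) (assumption, blast)
  have extG: "G \<in> extended_L2 \<Omega>"
    using sqG ext by (auto simp: extended_L2_def G_def)
  have G: "G \<in> jets \<Omega>" by (rule jets_closed[OF F extG lim])
  have conv: "AE x in lebesgue_on \<Omega>. (\<lambda>k. g (r k) (exit_point \<Omega> \<theta> x)) \<longlonglongrightarrow> boundary_value \<Omega> \<theta> G x"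
    if \<theta>: "\<theta> \<in> sphere 0 1" for \<theta>
  proof -
    define H where "H k x = F (r k) x + (-1) *\<^sub>R G x" for k x
    have extH: "H k \<in> extended_L2 \<Omega>" for k
      unfolding H_def[abs_def] by (intro extended_L2_add extended_L2_scaleR ext extG)
    have "AE x in lborel. (\<lambda>k. (boundary_value \<Omega> \<theta> (H k) x)\<^sup>2) \<longlonglongrightarrow> 0"
    proof (rule AE_tendsto_0_if_integral_geometric)
      fix k
      show "integrable lborel (\<lambda>x. (boundary_value \<Omega> \<theta> (H k) x)\<^sup>2)"
        using boundary_value_extended_L2[OF extH \<theta>] by (simp add: extended_L2_def sq_integrable_def)
      have "(LINT x|lborel. (boundary_value \<Omega> \<theta> (H k) x)\<^sup>2) \<le> (2 + 2 * (diameter \<Omega>)\<^sup>2) * (LINT x|lborel. (norm (H k x))\<^sup>2)"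
        by (rule boundary_value_bound[OF extH \<theta>])
      also have "\<dots> \<le> (2 + 2 * (diameter \<Omega>)\<^sup>2) * (1/4)^k"
        using rate[of k] by (intro mult_left_mono) (simp_all add: H_def)
      finally show "(LINT x|lborel. (boundary_value \<Omega> \<theta> (H k) x)\<^sup>2) \<le> (2 + 2 * (diameter \<Omega>)\<^sup>2) * (1/4)^k" .
    qed simp
    moreover have "AE x in lborel. \<forall>k. boundary_value \<Omega> \<theta> (H k) x
        = boundary_value \<Omega> \<theta> (F (r k)) x + (-1) * boundary_value \<Omega> \<theta> G x"
      unfolding AE_all_countable H_def[abs_def] by (intro allI boundary_value_lincomb ext extG \<theta>)
    moreover have "AE x in lborel. \<forall>k. x \<in> \<Omega> \<longrightarrow> g (r k) (exit_point \<Omega> \<theta> x) = boundary_value \<Omega> \<theta> (F (r k)) x"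
      unfolding AE_all_countable
      using tr \<theta> by (auto simp: has_boundary_trace_def AE_lebesgue_on_domain)
    ultimately show ?thesis
      unfolding AE_lebesgue_on_domain
    proof eventually_elim
      case (elim x)
      show ?case
      proof
        assume x: "x \<in> \<Omega>"
        have "(\<lambda>k. sqrt ((boundary_value \<Omega> \<theta> (H k) x)\<^sup>2)) \<longlonglongrightarrow> sqrt 0"
          using elim by (intro tendsto_real_sqrt) auto
        then have "(\<lambda>k. boundary_value \<Omega> \<theta> (H k) x) \<longlonglongrightarrow> 0"
          by (simp add: tendsto_rabs_zero_iff)
        then have "(\<lambda>k. g (r k) (exit_point \<Omega> \<theta> x) - boundary_value \<Omega> \<theta> G x) \<longlonglongrightarrow> 0"
          using elim x by simp
        then show "(\<lambda>k. g (r k) (exit_point \<Omega> \<theta> x)) \<longlonglongrightarrow> boundary_value \<Omega> \<theta> G x"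
          by (simp add: LIM_zero_iff)
      qed
    qed
  qed
  have "has_boundary_trace \<Omega> G (\<lambda>z. lim (\<lambda>k. g (r k) z))"
  proof (rule has_boundary_traceI[OF extG])
    fix \<theta> :: 'a assume \<theta>: "\<theta> \<in> sphere 0 1"
    have "\<exists>g'. g' \<in> borel_measurable (directional_measure \<Omega> \<theta>) \<and> (AE z in directional_measure \<Omega> \<theta>. g (r k) z = g' z)" for k
      using tr[of "r k"] \<theta> by (auto simp: has_boundary_trace_def elim: bdL2_fun_measurable)
    then obtain g' where g'[measurable]: "\<And>k. g' k \<in> borel_measurable (directional_measure \<Omega> \<theta>)"
      and gg': "\<And>k. AE z in directional_measure \<Omega> \<theta>. g (r k) z = g' k z"
      by metis
    have "AE z in directional_measure \<Omega> \<theta>. \<forall>k. g (r k) z = g' k z"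
      unfolding AE_all_countable using gg' by blast
    then have "AE z in directional_measure \<Omega> \<theta>. lim (\<lambda>k. g (r k) z) = lim (\<lambda>k. g' k z)"
      by eventually_elim simp
    moreover have "(\<lambda>z. lim (\<lambda>k. g' k z)) \<in> borel_measurable (directional_measure \<Omega> \<theta>)"
      by (rule borel_measurable_lim_metric) measurable
    ultimately show "\<exists>h\<in>borel_measurable (directional_measure \<Omega> \<theta>).
        AE z in directional_measure \<Omega> \<theta>. lim (\<lambda>k. g (r k) z) = h z"
      by (intro bexI[of _ "\<lambda>z. lim (\<lambda>k. g' k z)"])
    show "AE x in lebesgue_on \<Omega>. lim (\<lambda>k. g (r k) (exit_point \<Omega> \<theta> x)) = boundary_value \<Omega> \<theta> G x"
      using conv[OF \<theta>] by eventually_elim (rule limI)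
  qed
  with G lim show thesis using that by blast
qed

end

section \<open>Classes of functions and classes of jets\<close>

definition jet_class :: "'a::euclidean_space set \<Rightarrow> ('a \<Rightarrow> real \<times> 'a) \<Rightarrow> ('a \<Rightarrow> real) set" where
  "jet_class \<Omega> F = L2_rel (lebesgue_on \<Omega>) `` {\<lambda>x. fst (F x)}"

definition trace_class :: "'a::euclidean_space set \<Rightarrow> ('a \<Rightarrow> real) \<Rightarrow> ('a \<Rightarrow> real) set" where
  "trace_class \<Omega> g = bdL2_rel \<Omega> `` {g}"

text \<open>The second clause names the trace by a function instead of a class, so that sums and multiples
  of traces are sums and multiples of functions.\<close>

definition harmonic_jet :: "'a::euclidean_space set \<Rightarrow> ('a \<Rightarrow> real \<times> 'a) \<Rightarrow> ('a \<Rightarrow> real) \<Rightarrow> bool" where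
  "harmonic_jet \<Omega> F g \<longleftrightarrow> F \<in> jets \<Omega> \<and> has_boundary_trace \<Omega> F g \<and>
     (\<forall>N\<in>jets \<Omega>. has_boundary_trace \<Omega> N (\<lambda>z. 0) \<longrightarrow> (LINT x|lborel. snd (F x) \<bullet> snd (N x)) = 0)"

lemma equiv_L2_rel: "equiv (L2_fun M) (L2_rel M)"
proof (rule equivI)
  show "L2_rel M \<subseteq> L2_fun M \<times> L2_fun M" by (auto simp: L2_rel_def)
  show "refl_on (L2_fun M) (L2_rel M)" by (auto simp: refl_on_def L2_rel_def)
  show "sym (L2_rel M)" by (auto simp: sym_def L2_rel_def elim: eventually_mono)
  show "trans (L2_rel M)"
  proof (rule transI)
    fix f g h assume "(f, g) \<in> L2_rel M" "(g, h) \<in> L2_rel M"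
    moreover from this have "AE x in M. f x = g x" "AE x in M. g x = h x" by (auto simp: L2_rel_def)
    then have "AE x in M. f x = h x" by eventually_elim simp
    ultimately show "(f, h) \<in> L2_rel M" by (auto simp: L2_rel_def)
  qed
qed

lemma equiv_bdL2_rel: "equiv (bdL2_fun \<Omega>) (bdL2_rel \<Omega>)"
proof (rule equivI)
  show "bdL2_rel \<Omega> \<subseteq> bdL2_fun \<Omega> \<times> bdL2_fun \<Omega>" by (auto simp: bdL2_rel_def)
  show "refl_on (bdL2_fun \<Omega>) (bdL2_rel \<Omega>)" by (auto simp: refl_on_def bdL2_rel_def)
  show "sym (bdL2_rel \<Omega>)"
  proof (rule symI)
    fix f g assume fg: "(f, g) \<in> bdL2_rel \<Omega>"
    have "AE z in directional_measure \<Omega> \<theta>. g z = f z" if "\<theta> \<in> sphere 0 1" for \<theta>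
    proof -
      have "AE z in directional_measure \<Omega> \<theta>. f z = g z" using fg that by (simp add: bdL2_rel_def)
      then show ?thesis by eventually_elim simp
    qed
    then show "(g, f) \<in> bdL2_rel \<Omega>" using fg by (simp add: bdL2_rel_def)
  qed
  show "trans (bdL2_rel \<Omega>)"
  proof (rule transI)
    fix f g h assume fgh: "(f, g) \<in> bdL2_rel \<Omega>" "(g, h) \<in> bdL2_rel \<Omega>"
    have "AE z in directional_measure \<Omega> \<theta>. f z = h z" if "\<theta> \<in> sphere 0 1" for \<theta>
    proof -
      have "AE z in directional_measure \<Omega> \<theta>. f z = g z" "AE z in directional_measure \<Omega> \<theta>. g z = h z"
        using fgh that by (simp_all add: bdL2_rel_def)
      then show ?thesis by eventually_elim simp
    qed
    then show "(f, h) \<in> bdL2_rel \<Omega>" using fgh by (simp add: bdL2_rel_def)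
  qed
qed

context bounded_domain
begin

lemma jet_fst_L2_fun: "F \<in> jets \<Omega> \<Longrightarrow> (\<lambda>x. fst (F x)) \<in> L2_fun (lebesgue_on \<Omega>)"
  by (intro extended_L2_L2_fun extended_L2_components jets_extended_L2)

lemma jet_snd_L2_fun: "F \<in> jets \<Omega> \<Longrightarrow> (\<lambda>x. snd (F x) \<bullet> e) \<in> L2_fun (lebesgue_on \<Omega>)"
  by (intro extended_L2_L2_fun extended_L2_inner extended_L2_components jets_extended_L2)

lemma mem_jet_class:
  "F \<in> jets \<Omega> \<Longrightarrow> u \<in> jet_class \<Omega> F \<longleftrightarrow>
    u \<in> L2_fun (lebesgue_on \<Omega>) \<and> (AE x in lebesgue_on \<Omega>. fst (F x) = u x)"
  using jet_fst_L2_fun[of F] by (auto simp: jet_class_def L2_rel_def)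

lemma jet_class_cong:
  assumes F: "F \<in> jets \<Omega>" and G: "G \<in> jets \<Omega>" and eq: "AE x in lborel. F x = G x"
  shows "jet_class \<Omega> F = jet_class \<Omega> G"
proof -
  have "AE x in lebesgue_on \<Omega>. fst (F x) = fst (G x)"
    unfolding AE_lebesgue_on_domain using eq by eventually_elim simp
  then show ?thesis
    unfolding jet_class_def using jet_fst_L2_fun[OF F] jet_fst_L2_fun[OF G]
    by (intro equiv_class_eq[OF equiv_L2_rel]) (simp add: L2_rel_def)
qed

lemma jet_class_in_W: "F \<in> jets \<Omega> \<Longrightarrow> jet_class \<Omega> F \<in> W \<Omega> \<theta>"
  unfolding W_def jet_class_def W_fun_def
  using jet_fst_L2_fun[of F] jet_snd_L2_fun[of F \<theta>] jet_weak_deriv[of F \<theta>] by (intro quotientI) blast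

lemma jet_class_in_H1: "F \<in> jets \<Omega> \<Longrightarrow> jet_class \<Omega> F \<in> H1 \<Omega>"
  unfolding H1_def jet_class_def H1_fun_def
  using jet_fst_L2_fun[of F] jet_snd_L2_fun[of F] jet_weak_deriv[of F] by (intro quotientI) blast

text \<open>A Borel version of the function and Borel versions of its weak partial derivatives.\<close>

lemma H1_has_jet:
  assumes "U \<in> H1 \<Omega>"
  obtains F where "F \<in> jets \<Omega>" "U = jet_class \<Omega> F"
proof -
  obtain u where U: "U = L2_rel (lebesgue_on \<Omega>) `` {u}" and u: "u \<in> H1_fun \<Omega>"
    using assms unfolding H1_def by (rule quotientE)
  then have uL2: "u \<in> L2_fun (lebesgue_on \<Omega>)" by (simp add: H1_fun_def)
  obtain u' where u': "u' \<in> extended_L2 \<Omega>" "AE x in lebesgue_on \<Omega>. u' x = u x"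
    using L2_fun_borel_version[OF uL2] .
  have "\<exists>v'. v' \<in> extended_L2 \<Omega> \<and> has_weak_deriv \<Omega> b u' v'" if b: "b \<in> Basis" for b
  proof -
    obtain v where v: "v \<in> L2_fun (lebesgue_on \<Omega>)" "has_weak_deriv \<Omega> b u v"
      using u b unfolding H1_fun_def by blast
    obtain v' where v': "v' \<in> extended_L2 \<Omega>" "AE x in lebesgue_on \<Omega>. v' x = v x"
      using L2_fun_borel_version[OF v(1)] .
    then show ?thesis
      using v has_weak_deriv_AE_cong[OF extended_L2_L2_fun[OF u'(1)] uL2 u'(2) extended_L2_L2_fun[OF v'(1)] v(1) v'(2)]
      by blast
  qed
  then obtain v where v: "\<And>b. b \<in> Basis \<Longrightarrow> v b \<in> extended_L2 \<Omega>" "\<And>b. b \<in> Basis \<Longrightarrow> has_weak_deriv \<Omega> b u' (v b)"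
    by metis
  define F where "F x = (u' x, \<Sum>b\<in>Basis. v b x *\<^sub>R b)" for x
  have comp: "snd (F x) \<bullet> b = v b x" if "b \<in> Basis" for x b
    using that by (simp add: F_def inner_sum_left inner_Basis if_distrib sum.delta cong: if_cong)
  have "sq_integrable lborel F"
  proof (rule sq_integrable_dominated(1))
    have sqv: "sq_integrable lborel (\<lambda>x. \<bar>v b x\<bar>)" if "b \<in> Basis" for b
      using v(1)[OF that] by (auto simp: extended_L2_def sq_integrable_def)
    have "sq_integrable lborel (\<lambda>x. \<Sum>b\<in>B. \<bar>v b x\<bar>)" if sub: "B \<subseteq> Basis" for B
      using finite_subset[OF sub finite_Basis] sub
    proof (induction B rule: finite_induct)
      case empty
      show ?case by (simp add: sq_integrable_def)
    next
      case (insert b B)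
      then have "sq_integrable lborel (\<lambda>x. \<bar>v b x\<bar> + (\<Sum>b\<in>B. \<bar>v b x\<bar>))"
        by (intro sq_integrable_add sqv) auto
      then show ?case using insert by simp
    qed
    then show "sq_integrable lborel (\<lambda>x. \<bar>u' x\<bar> + (\<Sum>b\<in>Basis. \<bar>v b x\<bar>))"
      using u'(1) by (intro sq_integrable_add) (auto simp: extended_L2_def sq_integrable_def)
    have [measurable]: "u' \<in> borel_measurable borel" "\<And>b. b \<in> Basis \<Longrightarrow> v b \<in> borel_measurable borel"
      using u' v(1) by (auto intro: extended_L2_borel)
    show "F \<in> borel_measurable lborel" unfolding F_def by measurable
    fix x
    have "norm (F x) \<le> \<bar>u' x\<bar> + norm (\<Sum>b\<in>Basis. v b x *\<^sub>R b)"
      unfolding F_def using norm_Pair_le[of "u' x"] by simp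
    also have "\<dots> \<le> \<bar>u' x\<bar> + (\<Sum>b\<in>Basis. \<bar>v b x\<bar>)"
      using norm_sum[of "\<lambda>b. v b x *\<^sub>R b" Basis] by simp
    finally show "norm (F x) \<le> norm (\<bar>u' x\<bar> + (\<Sum>b\<in>Basis. \<bar>v b x\<bar>))" by simp
  qed
  then have "F \<in> extended_L2 \<Omega>"
    using u'(1) v(1) by (simp add: extended_L2_def F_def zero_prod_def)
  moreover have "has_weak_deriv \<Omega> b (\<lambda>x. fst (F x)) (\<lambda>x. snd (F x) \<bullet> b)" if "b \<in> Basis" for b
    using v(2)[OF that] by (simp add: comp[OF that]) (simp add: F_def)
  ultimately have F: "F \<in> jets \<Omega>" by (simp add: jets_def)
  have "AE x in lebesgue_on \<Omega>. u x = fst (F x)" using u'(2) by eventually_elim (simp add: F_def)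
  then have "U = jet_class \<Omega> F"
    unfolding U jet_class_def using uL2 jet_fst_L2_fun[OF F]
    by (intro equiv_class_eq[OF equiv_L2_rel]) (simp add: L2_rel_def)
  with F show thesis by (rule that)
qed

text \<open>The representatives and weak derivatives chosen by \<open>H1_inner\<close> agree almost everywhere with the
  components of the jet, because weak derivatives are unique.\<close>

lemma rep_jet_class:
  assumes F: "F \<in> jets \<Omega>"
  shows "rep (jet_class \<Omega> F) \<in> borel_measurable (lebesgue_on \<Omega>)"
    and "weak_grad \<Omega> (rep (jet_class \<Omega> F)) \<in> borel_measurable (lebesgue_on \<Omega>)"
    and "AE x in lebesgue_on \<Omega>. rep (jet_class \<Omega> F) x = fst (F x) \<and> weak_grad \<Omega> (rep (jet_class \<Omega> F)) x = snd (F x)"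
proof -
  define u where "u = rep (jet_class \<Omega> F)"
  have "(\<lambda>x. fst (F x)) \<in> jet_class \<Omega> F" by (simp add: mem_jet_class[OF F] jet_fst_L2_fun[OF F])
  then have "u \<in> jet_class \<Omega> F" unfolding u_def rep_def by (rule someI[of "\<lambda>u. u \<in> jet_class \<Omega> F"])
  then have u: "u \<in> L2_fun (lebesgue_on \<Omega>)" "AE x in lebesgue_on \<Omega>. fst (F x) = u x"
    by (simp_all add: mem_jet_class[OF F])
  have wd: "weak_deriv \<Omega> b u \<in> L2_fun (lebesgue_on \<Omega>) \<and> has_weak_deriv \<Omega> b u (weak_deriv \<Omega> b u)" for b
    unfolding weak_deriv_def
  proof (rule someI[of "\<lambda>v. v \<in> L2_fun (lebesgue_on \<Omega>) \<and> has_weak_deriv \<Omega> b u v"])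
    show "(\<lambda>x. snd (F x) \<bullet> b) \<in> L2_fun (lebesgue_on \<Omega>) \<and> has_weak_deriv \<Omega> b u (\<lambda>x. snd (F x) \<bullet> b)"
      using jet_weak_deriv[OF F, of b] jet_snd_L2_fun[OF F, of b]
        has_weak_deriv_AE_cong[OF jet_fst_L2_fun[OF F] u(1) u(2) jet_snd_L2_fun[OF F, of b] jet_snd_L2_fun[OF F, of b]]
      by simp
  qed
  have "AE x in lebesgue_on \<Omega>. weak_deriv \<Omega> b u x = snd (F x) \<bullet> b" for b
    by (rule weak_deriv_unique[OF conjunct1[OF wd] jet_snd_L2_fun[OF F] u(1) jet_fst_L2_fun[OF F]
          _ conjunct2[OF wd] jet_weak_deriv[OF F]])
      (use u(2) in \<open>eventually_elim, simp\<close>)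
  then have "AE x in lebesgue_on \<Omega>. \<forall>b\<in>Basis. weak_deriv \<Omega> b u x = snd (F x) \<bullet> b"
    by (subst AE_ball_countable) (auto intro: countable_finite)
  with u(2) have "AE x in lebesgue_on \<Omega>. u x = fst (F x) \<and> weak_grad \<Omega> u x = snd (F x)"
    by eventually_elim (simp add: weak_grad_def euclidean_representation)
  moreover have "weak_deriv \<Omega> b u \<in> borel_measurable (lebesgue_on \<Omega>)" for b
    using wd[of b] by (simp add: L2_fun_def)
  then have "weak_grad \<Omega> u \<in> borel_measurable (lebesgue_on \<Omega>)"
    unfolding weak_grad_def[abs_def] by measurable
  ultimately show "rep (jet_class \<Omega> F) \<in> borel_measurable (lebesgue_on \<Omega>)"
    and "weak_grad \<Omega> (rep (jet_class \<Omega> F)) \<in> borel_measurable (lebesgue_on \<Omega>)"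
    and "AE x in lebesgue_on \<Omega>. rep (jet_class \<Omega> F) x = fst (F x) \<and> weak_grad \<Omega> (rep (jet_class \<Omega> F)) x = snd (F x)"
    using u(1) by (simp_all add: L2_fun_def u_def)
qed

lemma inner_jet_class:
  assumes F: "F \<in> jets \<Omega>" and G: "G \<in> jets \<Omega>"
  shows "H1_inner \<Omega> (jet_class \<Omega> F) (jet_class \<Omega> G) = (LINT x|lborel. F x \<bullet> G x)"
    and "grad_inner \<Omega> (jet_class \<Omega> F) (jet_class \<Omega> G) = (LINT x|lborel. snd (F x) \<bullet> snd (G x))"
proof -
  note ext = jets_extended_L2[OF F] jets_extended_L2[OF G]
  note [measurable] = rep_jet_class(1,2)[OF F] rep_jet_class(1,2)[OF G]
    extended_L2_borel[OF ext(1)] extended_L2_borel[OF ext(2)]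
    extended_L2_borel[OF extended_L2_components(2)[OF ext(1)]] extended_L2_borel[OF extended_L2_components(2)[OF ext(2)]]
  have ae: "AE x in lebesgue_on \<Omega>. rep (jet_class \<Omega> F) x * rep (jet_class \<Omega> G) x
        + weak_grad \<Omega> (rep (jet_class \<Omega> F)) x \<bullet> weak_grad \<Omega> (rep (jet_class \<Omega> G)) x = F x \<bullet> G x"
    "AE x in lebesgue_on \<Omega>. weak_grad \<Omega> (rep (jet_class \<Omega> F)) x \<bullet> weak_grad \<Omega> (rep (jet_class \<Omega> G)) x
      = snd (F x) \<bullet> snd (G x)"
    using rep_jet_class(3)[OF F] rep_jet_class(3)[OF G]
    by (eventually_elim, simp add: inner_prod_def)+
  have meas: "(\<lambda>x. F x \<bullet> G x) \<in> borel_measurable borel" "(\<lambda>x. snd (F x) \<bullet> snd (G x)) \<in> borel_measurable borel"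
    by measurable
  have "H1_inner \<Omega> (jet_class \<Omega> F) (jet_class \<Omega> G) = (LINT x|lebesgue_on \<Omega>. F x \<bullet> G x)"
    unfolding H1_inner_def
    by (rule integral_cong_AE[OF _ borel_measurable_lebesgue_on_domain[OF meas(1)] ae(1)]) measurable
  also have "\<dots> = (LINT x|lborel. F x \<bullet> G x)"
    by (rule integral_lebesgue_on_domain(1)[OF meas(1)]) (simp add: extended_L2_outside[OF ext(1)])
  finally show "H1_inner \<Omega> (jet_class \<Omega> F) (jet_class \<Omega> G) = (LINT x|lborel. F x \<bullet> G x)" .
  have "grad_inner \<Omega> (jet_class \<Omega> F) (jet_class \<Omega> G) = (LINT x|lebesgue_on \<Omega>. snd (F x) \<bullet> snd (G x))"
    unfolding grad_inner_def
    by (rule integral_cong_AE[OF _ borel_measurable_lebesgue_on_domain[OF meas(2)] ae(2)]) measurable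
  also have "\<dots> = (LINT x|lborel. snd (F x) \<bullet> snd (G x))"
    by (rule integral_lebesgue_on_domain(1)[OF meas(2)]) (simp add: extended_L2_outside[OF ext(1)])
  finally show "grad_inner \<Omega> (jet_class \<Omega> F) (jet_class \<Omega> G) = (LINT x|lborel. snd (F x) \<bullet> snd (G x))" .
qed

lemma has_boundary_trace_bdL2_fun: "has_boundary_trace \<Omega> F g \<Longrightarrow> g \<in> bdL2_fun \<Omega>"
  by (simp add: has_boundary_trace_def)

lemma trace_class_eq_iff:
  assumes "has_boundary_trace \<Omega> F g" and "g' \<in> bdL2_fun \<Omega>"
  shows "trace_class \<Omega> g' = trace_class \<Omega> g \<longleftrightarrow> has_boundary_trace \<Omega> F g'"
proof -
  have "trace_class \<Omega> g = trace_class \<Omega> g' \<longleftrightarrow> (g, g') \<in> bdL2_rel \<Omega>"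
    unfolding trace_class_def
    by (rule eq_equiv_class_iff[OF equiv_bdL2_rel has_boundary_trace_bdL2_fun[OF assms(1)] assms(2)])
  then show ?thesis using has_boundary_trace_rel[OF assms(1), of g'] by auto
qed

lemma mem_trace_class:
  "has_boundary_trace \<Omega> F g \<Longrightarrow> g' \<in> trace_class \<Omega> g \<longleftrightarrow> has_boundary_trace \<Omega> F g'"
  using has_boundary_trace_rel[of F g g'] by (simp add: trace_class_def)

text \<open>In the direction from left to right, the trace formula for some directional trace passes to
  all elements of \<open>G\<close>. Conversely, \<open>g\<close> itself is a directional trace in every direction.\<close>

lemma has_trace_iff:
  assumes F: "F \<in> jets \<Omega>"
  shows "has_trace \<Omega> (jet_class \<Omega> F) G \<longleftrightarrow> (\<exists>g. has_boundary_trace \<Omega> F g \<and> G = trace_class \<Omega> g)"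
proof
  note u = extended_L2_components(1)[OF jets_extended_L2[OF F]]
  have v: "(\<lambda>x. snd (F x) \<bullet> \<theta>) \<in> extended_L2 \<Omega>" for \<theta>
    by (rule extended_L2_inner[OF extended_L2_components(2)[OF jets_extended_L2[OF F]]])
  have uU: "(\<lambda>x. fst (F x)) \<in> jet_class \<Omega> F" by (simp add: mem_jet_class[OF F] jet_fst_L2_fun[OF F])
  {
    assume tr: "has_trace \<Omega> (jet_class \<Omega> F) G"
    then obtain g where g: "g \<in> bdL2_fun \<Omega>" "G = trace_class \<Omega> g"
      unfolding has_trace_def bdL2_def trace_class_def by (auto elim: quotientE)
    then have "g \<in> G" unfolding trace_class_def using equiv_class_self[OF equiv_bdL2_rel] by metis
    have "AE x in lebesgue_on \<Omega>. g (exit_point \<Omega> \<theta> x) = boundary_value \<Omega> \<theta> F x" if \<theta>: "\<theta> \<in> sphere 0 1" for \<theta>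
    proof -
      interpret directed_domain \<Omega> \<theta> using \<theta> by (rule directed)
      obtain h where h: "is_directional_trace \<Omega> \<theta> (jet_class \<Omega> F) h" "AE z in directional_measure \<Omega> \<theta>. h z = g z"
        using tr \<theta> \<open>g \<in> G\<close> unfolding has_trace_def directional_traces_def by blast
      have "AE x in lebesgue_on \<Omega>. h (\<Phi> x) = g (\<Phi> x)"
        using h(2) by (simp add: AE_directional_measure_iff)
      with directional_trace_eq_exit_integral[OF u v[of \<theta>] jet_weak_deriv[OF F] uU h(1)]
      show ?thesis by eventually_elim (simp add: boundary_value_def)
    qed
    with g show "\<exists>g. has_boundary_trace \<Omega> F g \<and> G = trace_class \<Omega> g"
      by (auto simp: has_boundary_trace_def)
  }
  {
    assume "\<exists>g. has_boundary_trace \<Omega> F g \<and> G = trace_class \<Omega> g"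
    then obtain g where g: "has_boundary_trace \<Omega> F g" and G: "G = trace_class \<Omega> g" by blast
    have "g \<in> directional_traces \<Omega> \<theta> (jet_class \<Omega> F)" if \<theta>: "\<theta> \<in> sphere 0 1" for \<theta>
    proof -
      interpret directed_domain \<Omega> \<theta> using \<theta> by (rule directed)
      have "is_directional_trace \<Omega> \<theta> (jet_class \<Omega> F) g"
        by (rule directional_traceI[OF jet_class_in_W[OF F] uU u v[of \<theta>]])
          (use g \<theta> in \<open>simp add: has_boundary_trace_def boundary_value_def\<close>)
      then show ?thesis by (simp add: directional_traces_def)
    qed
    moreover have "AE z in directional_measure \<Omega> \<theta>. g z = g' z" if "\<theta> \<in> sphere 0 1" "g' \<in> G" for \<theta> g'
      using that by (simp add: G trace_class_def bdL2_rel_def)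
    moreover have "G \<in> bdL2 \<Omega>"
      unfolding G trace_class_def bdL2_def by (rule quotientI[OF has_boundary_trace_bdL2_fun[OF g]])
    ultimately show "has_trace \<Omega> (jet_class \<Omega> F) G" unfolding has_trace_def by blast
  }
qed

lemma tr_jet_class:
  assumes F: "F \<in> jets \<Omega>" and g: "has_boundary_trace \<Omega> F g"
  shows "tr \<Omega> (jet_class \<Omega> F) = trace_class \<Omega> g"
  unfolding tr_def has_trace_iff[OF F]
proof (rule the_equality)
  fix G assume "\<exists>g. has_boundary_trace \<Omega> F g \<and> G = trace_class \<Omega> g"
  then show "G = trace_class \<Omega> g"
    using trace_class_eq_iff[OF g] has_boundary_trace_bdL2_fun by blast
qed (use g in blast)

lemma H1_tr_iff: "U \<in> H1_tr \<Omega> \<longleftrightarrow> (\<exists>F g. F \<in> jets \<Omega> \<and> has_boundary_trace \<Omega> F g \<and> U = jet_class \<Omega> F)"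
proof
  assume "U \<in> H1_tr \<Omega>"
  then obtain G where U: "U \<in> H1 \<Omega>" "has_trace \<Omega> U G" by (auto simp: H1_tr_def)
  obtain F where F: "F \<in> jets \<Omega>" "U = jet_class \<Omega> F" using H1_has_jet[OF U(1)] .
  then show "\<exists>F g. F \<in> jets \<Omega> \<and> has_boundary_trace \<Omega> F g \<and> U = jet_class \<Omega> F"
    using U(2) has_trace_iff[OF F(1)] by blast
next
  assume "\<exists>F g. F \<in> jets \<Omega> \<and> has_boundary_trace \<Omega> F g \<and> U = jet_class \<Omega> F"
  then obtain F g where F: "F \<in> jets \<Omega>" "has_boundary_trace \<Omega> F g" and U: "U = jet_class \<Omega> F" by blast
  show "U \<in> H1_tr \<Omega>"
    unfolding H1_tr_def U using jet_class_in_H1[OF F(1)] has_trace_iff[OF F(1)] F(2) by blast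
qed

lemma bd_zero_eq: "bd_zero \<Omega> = trace_class \<Omega> (\<lambda>z. 0)"
  by (simp add: bd_zero_def trace_class_def)

lemma H1_tr0_iff: "V \<in> H1_tr0 \<Omega> \<longleftrightarrow> (\<exists>N\<in>jets \<Omega>. has_boundary_trace \<Omega> N (\<lambda>z. 0) \<and> V = jet_class \<Omega> N)"
proof
  assume V: "V \<in> H1_tr0 \<Omega>"
  then obtain N g where N: "N \<in> jets \<Omega>" "has_boundary_trace \<Omega> N g" "V = jet_class \<Omega> N"
    by (auto simp: H1_tr0_def H1_tr_iff)
  then have "trace_class \<Omega> (\<lambda>z. 0) = trace_class \<Omega> g"
    using V tr_jet_class[OF N(1,2)] by (simp add: H1_tr0_def bd_zero_eq)
  then have "has_boundary_trace \<Omega> N (\<lambda>z. 0)"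
    using trace_class_eq_iff[OF N(2) has_boundary_trace_bdL2_fun[OF has_boundary_trace_zero]] by simp
  with N show "\<exists>N\<in>jets \<Omega>. has_boundary_trace \<Omega> N (\<lambda>z. 0) \<and> V = jet_class \<Omega> N" by blast
next
  assume "\<exists>N\<in>jets \<Omega>. has_boundary_trace \<Omega> N (\<lambda>z. 0) \<and> V = jet_class \<Omega> N"
  then show "V \<in> H1_tr0 \<Omega>"
    by (auto simp: H1_tr0_def H1_tr_iff tr_jet_class bd_zero_eq)
qed

lemma is_harmonic_lifting_iff:
  assumes g: "g \<in> bdL2_fun \<Omega>"
  shows "is_harmonic_lifting \<Omega> (trace_class \<Omega> g) U \<longleftrightarrow> (\<exists>F. harmonic_jet \<Omega> F g \<and> U = jet_class \<Omega> F)"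
proof
  assume lift: "is_harmonic_lifting \<Omega> (trace_class \<Omega> g) U"
  then obtain F g' where F: "F \<in> jets \<Omega>" "has_boundary_trace \<Omega> F g'" "U = jet_class \<Omega> F"
    by (auto simp: is_harmonic_lifting_def H1_tr_iff)
  then have "trace_class \<Omega> g = trace_class \<Omega> g'"
    using lift tr_jet_class[OF F(1,2)] by (simp add: is_harmonic_lifting_def)
  then have "has_boundary_trace \<Omega> F g" using trace_class_eq_iff[OF F(2) g] by simp
  moreover have "(LINT x|lborel. snd (F x) \<bullet> snd (N x)) = 0"
    if N: "N \<in> jets \<Omega>" "has_boundary_trace \<Omega> N (\<lambda>z. 0)" for N
  proof -
    have "jet_class \<Omega> N \<in> H1_tr0 \<Omega>" using N H1_tr0_iff by blast
    then have "grad_inner \<Omega> U (jet_class \<Omega> N) = 0" using lift by (simp add: is_harmonic_lifting_def)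
    then show ?thesis using inner_jet_class(2)[OF F(1) N(1)] F(3) by simp
  qed
  ultimately show "\<exists>F. harmonic_jet \<Omega> F g \<and> U = jet_class \<Omega> F"
    using F unfolding harmonic_jet_def by blast
next
  assume "\<exists>F. harmonic_jet \<Omega> F g \<and> U = jet_class \<Omega> F"
  then obtain F where harm: "harmonic_jet \<Omega> F g" and U: "U = jet_class \<Omega> F" by blast
  have F: "F \<in> jets \<Omega>" "has_boundary_trace \<Omega> F g"
    and orth: "\<And>N. N \<in> jets \<Omega> \<Longrightarrow> has_boundary_trace \<Omega> N (\<lambda>z. 0) \<Longrightarrow> (LINT x|lborel. snd (F x) \<bullet> snd (N x)) = 0"
    using harm by (simp_all add: harmonic_jet_def)
  have "grad_inner \<Omega> U V = 0" if V: "V \<in> H1_tr0 \<Omega>" for V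
  proof -
    obtain N where N: "N \<in> jets \<Omega>" "has_boundary_trace \<Omega> N (\<lambda>z. 0)" "V = jet_class \<Omega> N"
      using V unfolding H1_tr0_iff by blast
    then show ?thesis using inner_jet_class(2)[OF F(1) N(1)] orth by (simp add: U)
  qed
  moreover have "U \<in> H1_tr \<Omega>" using F U H1_tr_iff by blast
  ultimately show "is_harmonic_lifting \<Omega> (trace_class \<Omega> g) U"
    using tr_jet_class[OF F] by (simp add: is_harmonic_lifting_def U)
qed

section \<open>Harmonic liftings\<close>

lemma jet_snd_sq_integrable: "F \<in> jets \<Omega> \<Longrightarrow> sq_integrable lborel (\<lambda>x. snd (F x))"
  by (rule extended_L2_sq_integrable[OF extended_L2_components(2)[OF jets_extended_L2]])

lemma jet_sq_integrable: "F \<in> jets \<Omega> \<Longrightarrow> sq_integrable lborel F"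
  by (rule extended_L2_sq_integrable[OF jets_extended_L2])

text \<open>The energy along a line of jets is a quadratic polynomial; this yields the parallelogram law
  and the first variation.\<close>

lemma gradient_square_lincomb:
  assumes "F \<in> jets \<Omega>" "G \<in> jets \<Omega>"
  shows "(LINT x|lborel. (norm (snd (F x + t *\<^sub>R G x)))\<^sup>2) = (LINT x|lborel. (norm (snd (F x)))\<^sup>2)
    + 2 * t * (LINT x|lborel. snd (F x) \<bullet> snd (G x)) + t\<^sup>2 * (LINT x|lborel. (norm (snd (G x)))\<^sup>2)"
  using integral_norm_square_add_scaleR[OF jet_snd_sq_integrable[OF assms(1)] jet_snd_sq_integrable[OF assms(2)], of t]
  by simp

lemma tendsto_gradient_inner:
  assumes F: "\<And>n. F n \<in> jets \<Omega>" and G: "G \<in> jets \<Omega>" and N: "N \<in> jets \<Omega>"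
    and lim: "(\<lambda>n. LINT x|lborel. (norm (F n x - G x))\<^sup>2) \<longlonglongrightarrow> 0"
  shows "(\<lambda>n. LINT x|lborel. snd (F n x) \<bullet> snd (N x)) \<longlonglongrightarrow> (LINT x|lborel. snd (G x) \<bullet> snd (N x))"
proof (rule tendsto_integral_inner[OF jet_snd_sq_integrable[OF F] jet_snd_sq_integrable[OF G] jet_snd_sq_integrable[OF N]])
  show "(\<lambda>n. LINT x|lborel. (norm (snd (F n x) - snd (G x)))\<^sup>2) \<longlonglongrightarrow> 0"
  proof (rule tendsto_sandwich[OF _ _ tendsto_const lim])
    have "(LINT x|lborel. (norm (snd (F n x) - snd (G x)))\<^sup>2) \<le> (LINT x|lborel. (norm (F n x - G x))\<^sup>2)" for n
    proof (rule sq_integrable_dominated(2))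
      have "sq_integrable lborel (\<lambda>x. snd (F n x) - snd (G x))"
        by (rule sq_integrable_diff[OF jet_snd_sq_integrable[OF F] jet_snd_sq_integrable[OF G]])
      then show "(\<lambda>x. snd (F n x) - snd (G x)) \<in> borel_measurable lborel" by (rule sq_integrable_measurable)
      show "sq_integrable lborel (\<lambda>x. F n x - G x)"
        by (rule sq_integrable_diff[OF jet_sq_integrable[OF F] jet_sq_integrable[OF G]])
      show "norm (snd (F n x) - snd (G x)) \<le> norm (F n x - G x)" for x
        using norm_snd_le_norm[of "F n x - G x"] by simp
    qed
    then show "\<forall>\<^sub>F n in sequentially. (LINT x|lborel. (norm (snd (F n x) - snd (G x)))\<^sup>2) \<le> (LINT x|lborel. (norm (F n x - G x))\<^sup>2)"
      by simp
  qed simp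
qed

lemma zero_if_quadratic_nonneg:
  fixes a q :: real
  assumes "\<And>t. 0 \<le> 2 * t * a + t\<^sup>2 * q" and "0 \<le> q"
  shows "a = 0"
proof (rule ccontr)
  assume "a \<noteq> 0"
  define s where "s = - a / (q + 1)"
  have a: "a = - (s * (q + 1))" using \<open>0 \<le> q\<close> by (simp add: s_def)
  have "0 \<le> 2 * s * a + s\<^sup>2 * q" by (rule assms(1))
  also have "\<dots> = - (s\<^sup>2 * (q + 2))" by (simp add: a power2_eq_square algebra_simps)
  finally have "s\<^sup>2 * (q + 2) \<le> 0" by simp
  then have "s = 0" using \<open>0 \<le> q\<close> by (simp add: mult_le_0_iff)
  then show False using a \<open>a \<noteq> 0\<close> by simp
qed

lemma harmonic_jetD:
  assumes "harmonic_jet \<Omega> F g"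
  shows "F \<in> jets \<Omega>" "has_boundary_trace \<Omega> F g"
    and "\<And>N. N \<in> jets \<Omega> \<Longrightarrow> has_boundary_trace \<Omega> N (\<lambda>z. 0) \<Longrightarrow> (LINT x|lborel. snd (F x) \<bullet> snd (N x)) = 0"
  using assms by (simp_all add: harmonic_jet_def)

text \<open>The direct method. The difference \<open>D\<close> of two members of a minimising sequence has zero trace,
  and the midpoint competes for the minimum, so the parallelogram law bounds the energy of \<open>D\<close>
  by the excess energies; the Poincare inequality turns this into a bound for \<open>D\<close> itself. The
  limit has the same trace, since the traces in the sequence are constant. Orthogonality to a
  jet \<open>N\<close> with zero trace follows from the first variation at the members of the sequence, in
  the limit.\<close>

theorem harmonic_jet_exists:
  assumes F0: "F0 \<in> jets \<Omega>" "has_boundary_trace \<Omega> F0 g"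
  shows "\<exists>F. harmonic_jet \<Omega> F g"
proof -
  define A where "A = {F \<in> jets \<Omega>. has_boundary_trace \<Omega> F g}"
  define E where "E F = (LINT x|lborel. (norm (snd (F x)))\<^sup>2)" for F :: "'a \<Rightarrow> real \<times> 'a"
  have E_nonneg: "0 \<le> E F" for F by (simp add: E_def)
  define m where "m = Inf (E ` A)"
  have bdd: "bdd_below (E ` A)" using E_nonneg by (intro bdd_belowI[of _ 0]) auto
  have "E ` A \<noteq> {}" using F0 by (auto simp: A_def)
  have m_le: "m \<le> E F" if "F \<in> A" for F unfolding m_def using that by (intro cInf_lower bdd) auto
  have shift: "(\<lambda>x. F x + t *\<^sub>R N x) \<in> A" if "F \<in> A" "N \<in> jets \<Omega>" "has_boundary_trace \<Omega> N (\<lambda>z. 0)" for F N t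
    using that jets_lincomb[of F N t] has_boundary_trace_lincomb[of F g N "\<lambda>z. 0" t] by (simp add: A_def)
  have "\<exists>F\<in>A. E F < m + 1 / Suc n" for n
  proof -
    have "Inf (E ` A) < m + 1 / Suc n" by (simp add: m_def)
    from cInf_lessD[OF \<open>E ` A \<noteq> {}\<close> this] show ?thesis by blast
  qed
  then obtain F where FA: "\<And>n. F n \<in> A" and EF: "\<And>n. E (F n) < m + 1 / Suc n" by metis
  have Fj: "F n \<in> jets \<Omega>" "has_boundary_trace \<Omega> (F n) g" for n using FA[of n] by (auto simp: A_def)
  have diff: "(LINT x|lborel. (norm (F n x - F k x))\<^sup>2) \<le> ((diameter \<Omega>)\<^sup>2 + 1) * (2 * (1 / Suc n + 1 / Suc k))" for n k
  proof -
    define D where "D x = F n x - F k x" for x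
    have D: "D \<in> jets \<Omega>" unfolding D_def[abs_def] by (intro jets_diff Fj)
    have Dtr: "has_boundary_trace \<Omega> D (\<lambda>z. 0)"
      using has_boundary_trace_lincomb[OF Fj(1)[of n] Fj(2)[of n] Fj(1)[of k] Fj(2)[of k], of "-1"]
      by (simp add: D_def[abs_def])
    let ?i = "LINT x|lborel. snd (F n x) \<bullet> snd (D x)"
    have "E (F k) = E (\<lambda>x. F n x + (-1) *\<^sub>R D x)" by (simp add: D_def)
    also have "\<dots> = E (F n) - 2 * ?i + E D"
      unfolding E_def gradient_square_lincomb[OF Fj(1) D] by simp
    finally have k: "E (F k) = E (F n) - 2 * ?i + E D" .
    have "m \<le> E (\<lambda>x. F n x + (-1/2) *\<^sub>R D x)" by (intro m_le shift FA D Dtr)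
    also have "\<dots> = E (F n) - ?i + E D / 4"
      unfolding E_def gradient_square_lincomb[OF Fj(1) D] by (simp add: power2_eq_square)
    finally have "E D \<le> 2 * (E (F n) - m + (E (F k) - m))" using k by simp
    also have "\<dots> \<le> 2 * (1 / Suc n + 1 / Suc k)" using EF[of n] EF[of k] by simp
    finally have "E D \<le> 2 * (1 / Suc n + 1 / Suc k)" .
    then have "((diameter \<Omega>)\<^sup>2 + 1) * E D \<le> ((diameter \<Omega>)\<^sup>2 + 1) * (2 * (1 / Suc n + 1 / Suc k))"
      by (intro mult_left_mono) auto
    with Poincare_zero_trace[OF D Dtr] show ?thesis by (simp add: D_def E_def)
  qed
  have Cauchy: "\<exists>N. \<forall>n\<ge>N. \<forall>k\<ge>N. (LINT x|lborel. (norm (F n x - F k x))\<^sup>2) < e" if e: "0 < e" for e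
  proof -
    define K where "K = (diameter \<Omega>)\<^sup>2 + 1"
    have "0 < K" by (simp add: K_def add_nonneg_pos)
    then obtain N :: nat where N: "1 / Suc N < e / (4 * K)"
      using reals_Archimedean[of "e / (4 * K)"] e \<open>0 < K\<close> by (auto simp: inverse_eq_divide)
    have "(LINT x|lborel. (norm (F n x - F k x))\<^sup>2) < e" if "n \<ge> N" "k \<ge> N" for n k
    proof -
      have "1 / Suc n \<le> 1 / Suc N" "1 / Suc k \<le> 1 / Suc N" using that by (simp_all add: frac_le)
      from mult_left_mono[OF add_mono[OF this], of 2]
      have "2 * (1 / Suc n + 1 / Suc k) \<le> 4 * (1 / real (Suc N))" by simp
      also have "\<dots> < 4 * (e / (4 * K))" by (rule mult_strict_left_mono[OF N]) simp
      finally have "K * (2 * (1 / Suc n + 1 / Suc k)) < K * (4 * (e / (4 * K)))"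
        by (rule mult_strict_left_mono) fact
      also have "\<dots> = e" using \<open>0 < K\<close> by simp
      finally have "K * (2 * (1 / Suc n + 1 / Suc k)) < e" .
      with diff[of n k] show ?thesis by (simp add: K_def)
    qed
    then show ?thesis by blast
  qed
  obtain G and r :: "nat \<Rightarrow> nat" where G: "G \<in> jets \<Omega>" "has_boundary_trace \<Omega> G (\<lambda>z. lim (\<lambda>k. g z))"
    and lim: "(\<lambda>n. LINT x|lborel. (norm (F n x - G x))\<^sup>2) \<longlonglongrightarrow> 0"
    by (rule jets_with_trace_complete[OF Fj Cauchy]) (assumption, blast)
  have "(\<lambda>n. E (F n)) \<longlonglongrightarrow> m"
  proof (rule tendsto_sandwich[OF _ _ tendsto_const])
    show "\<forall>\<^sub>F n in sequentially. m \<le> E (F n)" using m_le FA by simp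
    show "\<forall>\<^sub>F n in sequentially. E (F n) \<le> m + 1 / Suc n" using EF by (auto intro: always_eventually less_imp_le)
    show "(\<lambda>n. m + 1 / Suc n) \<longlonglongrightarrow> m"
      using tendsto_add[OF tendsto_const LIMSEQ_inverse_real_of_nat, of m] by (simp add: inverse_eq_divide)
  qed
  have "(LINT x|lborel. snd (G x) \<bullet> snd (N x)) = 0"
    if N: "N \<in> jets \<Omega>" "has_boundary_trace \<Omega> N (\<lambda>z. 0)" for N
  proof (rule zero_if_quadratic_nonneg[OF _ E_nonneg[of N]])
    fix t
    have "(\<lambda>n. E (F n) + 2 * t * (LINT x|lborel. snd (F n x) \<bullet> snd (N x)) + t\<^sup>2 * E N)
        \<longlonglongrightarrow> m + 2 * t * (LINT x|lborel. snd (G x) \<bullet> snd (N x)) + t\<^sup>2 * E N"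
      by (intro tendsto_intros \<open>(\<lambda>n. E (F n)) \<longlonglongrightarrow> m\<close> tendsto_gradient_inner Fj G N lim)
    moreover have "m \<le> E (F n) + 2 * t * (LINT x|lborel. snd (F n x) \<bullet> snd (N x)) + t\<^sup>2 * E N" for n
      using m_le[OF shift[OF FA N, of n t]] gradient_square_lincomb[OF Fj(1) N(1), of n t] by (simp add: E_def)
    ultimately have "m \<le> m + 2 * t * (LINT x|lborel. snd (G x) \<bullet> snd (N x)) + t\<^sup>2 * E N"
      by (intro LIMSEQ_le_const) auto
    then show "0 \<le> 2 * t * (LINT x|lborel. snd (G x) \<bullet> snd (N x)) + t\<^sup>2 * E N" by simp
  qed
  moreover have "has_boundary_trace \<Omega> G g" using G(2) by (simp add: lim_const)
  ultimately have "harmonic_jet \<Omega> G g" using G(1) by (simp add: harmonic_jet_def)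
  then show ?thesis by (rule exI[of _ G])
qed

lemma harmonic_jet_lincomb:
  assumes F: "harmonic_jet \<Omega> F f" and G: "harmonic_jet \<Omega> G g"
  shows "harmonic_jet \<Omega> (\<lambda>x. F x + c *\<^sub>R G x) (\<lambda>z. f z + c * g z)"
  unfolding harmonic_jet_def
proof (intro conjI ballI impI)
  show "(\<lambda>x. F x + c *\<^sub>R G x) \<in> jets \<Omega>"
    by (rule jets_lincomb[OF harmonic_jetD(1)[OF F] harmonic_jetD(1)[OF G]])
  show "has_boundary_trace \<Omega> (\<lambda>x. F x + c *\<^sub>R G x) (\<lambda>z. f z + c * g z)"
    by (rule has_boundary_trace_lincomb[OF harmonic_jetD(1,2)[OF F] harmonic_jetD(1,2)[OF G]])
  fix N assume N: "N \<in> jets \<Omega>" "has_boundary_trace \<Omega> N (\<lambda>z. 0)"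
  have "integrable lborel (\<lambda>x. snd (F x) \<bullet> snd (N x))" "integrable lborel (\<lambda>x. snd (G x) \<bullet> snd (N x))"
    by (intro sq_integrable_inner jet_snd_sq_integrable harmonic_jetD(1)[OF F] harmonic_jetD(1)[OF G] N(1))+
  then show "(LINT x|lborel. snd (F x + c *\<^sub>R G x) \<bullet> snd (N x)) = 0"
    using harmonic_jetD(3)[OF F N] harmonic_jetD(3)[OF G N] by (simp add: inner_add_left)
qed

text \<open>The difference has zero trace and is orthogonal to itself.\<close>

lemma harmonic_jet_unique:
  assumes F: "harmonic_jet \<Omega> F g" and G: "harmonic_jet \<Omega> G g"
  shows "AE x in lborel. F x = G x"
proof -
  define D where "D x = F x + (-1) *\<^sub>R G x" for x
  have "harmonic_jet \<Omega> D (\<lambda>z. 0)"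
    using harmonic_jet_lincomb[OF F G, of "-1"] by (simp add: D_def[abs_def])
  note D = harmonic_jetD(1,2)[OF this] harmonic_jetD(3)[OF this harmonic_jetD(1,2)[OF this]]
  have "(LINT x|lborel. (norm (D x))\<^sup>2) \<le> 0"
    using Poincare_zero_trace[OF D(1,2)] D(3) by (simp add: power2_norm_eq_inner)
  moreover have "0 \<le> (LINT x|lborel. (norm (D x))\<^sup>2)" by simp
  ultimately have "(LINT x|lborel. (norm (D x))\<^sup>2) = 0" by (rule antisym)
  then have "AE x in lborel. (norm (D x))\<^sup>2 = 0"
    using jet_sq_integrable[OF D(1)]
    by (subst (asm) integral_nonneg_eq_0_iff_AE) (auto simp: sq_integrable_def)
  then show ?thesis by eventually_elim (simp add: D_def)
qed

lemma harmonic_jet_zero: "harmonic_jet \<Omega> (\<lambda>x. 0) (\<lambda>z. 0)"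
  by (simp add: harmonic_jet_def jets_zero has_boundary_trace_zero)

lemma harmonic_jet_bdL2_fun: "harmonic_jet \<Omega> F g \<Longrightarrow> g \<in> bdL2_fun \<Omega>"
  by (simp add: harmonic_jet_def has_boundary_trace_def)

lemma harmonic_jet_lifting:
  assumes "harmonic_jet \<Omega> F g"
  shows "is_harmonic_lifting \<Omega> (trace_class \<Omega> g) U \<longleftrightarrow> U = jet_class \<Omega> F"
proof
  assume "is_harmonic_lifting \<Omega> (trace_class \<Omega> g) U"
  then obtain G where "harmonic_jet \<Omega> G g" "U = jet_class \<Omega> G"
    using is_harmonic_lifting_iff[OF harmonic_jet_bdL2_fun[OF assms]] by blast
  then show "U = jet_class \<Omega> F"
    using jet_class_cong[OF _ _ harmonic_jet_unique[of G g F]] assms by (simp add: harmonic_jet_def)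
next
  assume "U = jet_class \<Omega> F"
  then show "is_harmonic_lifting \<Omega> (trace_class \<Omega> g) U"
    using is_harmonic_lifting_iff[OF harmonic_jet_bdL2_fun[OF assms]] assms by blast
qed

section \<open>The Hilbert space of traces\<close>

text \<open>Every trace is the trace of its harmonic lifting, so all of \<open>H_half\<close> is described by harmonic
  jets.\<close>

lemma H_half_iff: "G \<in> H_half \<Omega> \<longleftrightarrow> (\<exists>F g. harmonic_jet \<Omega> F g \<and> G = trace_class \<Omega> g)"
proof
  assume "G \<in> H_half \<Omega>"
  then obtain F g where F: "F \<in> jets \<Omega>" "has_boundary_trace \<Omega> F g" and "G = tr \<Omega> (jet_class \<Omega> F)"
    by (auto simp: H_half_def H1_tr_iff)
  then have "G = trace_class \<Omega> g" by (simp add: tr_jet_class[OF F])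
  with harmonic_jet_exists[OF F] show "\<exists>F g. harmonic_jet \<Omega> F g \<and> G = trace_class \<Omega> g" by blast
next
  assume "\<exists>F g. harmonic_jet \<Omega> F g \<and> G = trace_class \<Omega> g"
  then obtain F g where F: "F \<in> jets \<Omega>" "has_boundary_trace \<Omega> F g" and G: "G = trace_class \<Omega> g"
    unfolding harmonic_jet_def by blast
  then have "jet_class \<Omega> F \<in> H1_tr \<Omega>" using H1_tr_iff by blast
  then show "G \<in> H_half \<Omega>" unfolding H_half_def G tr_jet_class[OF F, symmetric] by (rule imageI)
qed

lemma H_half_cases:
  assumes "G \<in> H_half \<Omega>"
  obtains F g where "harmonic_jet \<Omega> F g" "G = trace_class \<Omega> g"
  using assms H_half_iff by blast

lemma trace_class_in_H_half: "harmonic_jet \<Omega> F g \<Longrightarrow> trace_class \<Omega> g \<in> H_half \<Omega>"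
  using H_half_iff by blast

lemma Psi_trace_class: "harmonic_jet \<Omega> F g \<Longrightarrow> Psi \<Omega> (trace_class \<Omega> g) = jet_class \<Omega> F"
  unfolding Psi_def by (rule the_equality) (simp_all add: harmonic_jet_lifting)

lemma H_half_inner_trace_class:
  assumes F: "harmonic_jet \<Omega> F f" and G: "harmonic_jet \<Omega> G g"
  shows "H_half_inner \<Omega> (trace_class \<Omega> f) (trace_class \<Omega> g) = (LINT x|lborel. F x \<bullet> G x)"
  using F G by (simp add: H_half_inner_def Psi_trace_class[OF F] Psi_trace_class[OF G] inner_jet_class harmonic_jet_def)

lemma trace_class_cong:
  "has_boundary_trace \<Omega> F g \<Longrightarrow> has_boundary_trace \<Omega> F g' \<Longrightarrow> trace_class \<Omega> g' = trace_class \<Omega> g"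
  using trace_class_eq_iff has_boundary_trace_bdL2_fun by blast

lemma bd_add_trace_class:
  assumes F: "harmonic_jet \<Omega> F f" and G: "harmonic_jet \<Omega> G g"
  shows "bd_add \<Omega> (trace_class \<Omega> f) (trace_class \<Omega> g) = trace_class \<Omega> (\<lambda>z. f z + g z)"
proof -
  have F': "F \<in> jets \<Omega>" "has_boundary_trace \<Omega> F f" and G': "G \<in> jets \<Omega>" "has_boundary_trace \<Omega> G g"
    by (rule harmonic_jetD(1,2)[OF F] harmonic_jetD(1,2)[OF G])+
  have "trace_class \<Omega> (\<lambda>z. f' z + g' z) = trace_class \<Omega> (\<lambda>z. f z + g z)"
    if "f' \<in> trace_class \<Omega> f" "g' \<in> trace_class \<Omega> g" for f' g'
  proof -
    have "has_boundary_trace \<Omega> F f'" "has_boundary_trace \<Omega> G g'"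
      using that by (simp_all add: mem_trace_class[OF F'(2)] mem_trace_class[OF G'(2)])
    from has_boundary_trace_lincomb[OF F'(1) this(1) G'(1) this(2), of 1]
      has_boundary_trace_lincomb[OF F' G', of 1]
    show ?thesis by (intro trace_class_cong[of "\<lambda>x. F x + 1 *\<^sub>R G x"]) simp_all
  qed
  moreover have "f \<in> trace_class \<Omega> f" "g \<in> trace_class \<Omega> g"
    by (simp_all add: mem_trace_class[OF F'(2)] mem_trace_class[OF G'(2)] F' G')
  ultimately show ?thesis
    unfolding bd_add_def trace_class_def[symmetric] by blast
qed

lemma bd_scale_trace_class:
  assumes F: "harmonic_jet \<Omega> F f"
  shows "bd_scale \<Omega> c (trace_class \<Omega> f) = trace_class \<Omega> (\<lambda>z. c * f z)"
proof -
  have F': "F \<in> jets \<Omega>" "has_boundary_trace \<Omega> F f" by (rule harmonic_jetD(1,2)[OF F])+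
  have "trace_class \<Omega> (\<lambda>z. c * f' z) = trace_class \<Omega> (\<lambda>z. c * f z)" if "f' \<in> trace_class \<Omega> f" for f'
  proof -
    have "has_boundary_trace \<Omega> F f'" using that by (simp add: mem_trace_class[OF F'(2)])
    from has_boundary_trace_lincomb[OF jets_zero has_boundary_trace_zero F'(1) this, of c]
      has_boundary_trace_lincomb[OF jets_zero has_boundary_trace_zero F', of c]
    show ?thesis by (intro trace_class_cong[of "\<lambda>x. 0 + c *\<^sub>R F x"]) simp_all
  qed
  moreover have "f \<in> trace_class \<Omega> f" by (simp add: mem_trace_class[OF F'(2)] F')
  ultimately show ?thesis
    unfolding bd_scale_def trace_class_def[symmetric] by blast
qed

lemma harmonic_jet_add:
  "harmonic_jet \<Omega> F f \<Longrightarrow> harmonic_jet \<Omega> G g \<Longrightarrow> harmonic_jet \<Omega> (\<lambda>x. F x + G x) (\<lambda>z. f z + g z)"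
  using harmonic_jet_lincomb[of F f G g 1] by simp

lemma harmonic_jet_scale: "harmonic_jet \<Omega> F f \<Longrightarrow> harmonic_jet \<Omega> (\<lambda>x. c *\<^sub>R F x) (\<lambda>z. c * f z)"
  using harmonic_jet_lincomb[OF harmonic_jet_zero, of F f c] by simp

lemma jet_inner_integrable: "F \<in> jets \<Omega> \<Longrightarrow> G \<in> jets \<Omega> \<Longrightarrow> integrable lborel (\<lambda>x. F x \<bullet> G x)"
  by (intro sq_integrable_inner jet_sq_integrable)

theorem H_half_inner_product_space:
  "real_inner_product_space_on (H_half \<Omega>) (bd_add \<Omega>) (bd_zero \<Omega>) (bd_scale \<Omega>) (H_half_inner \<Omega>)"
proof unfold_locales
  fix X Y Z and a b :: real
  assume X: "X \<in> H_half \<Omega>"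
  obtain F f where F: "harmonic_jet \<Omega> F f" and Xf: "X = trace_class \<Omega> f" using X by (rule H_half_cases)
  note aF = harmonic_jet_scale[OF F, of a] and bF = harmonic_jet_scale[OF F, of b]
  have Fj: "F \<in> jets \<Omega>" using F by (simp add: harmonic_jet_def)
  show "bd_scale \<Omega> a X \<in> H_half \<Omega>"
    unfolding Xf bd_scale_trace_class[OF F] by (rule trace_class_in_H_half[OF aF])
  show "bd_add \<Omega> X (bd_zero \<Omega>) = X"
    by (simp add: Xf bd_zero_eq bd_add_trace_class[OF F harmonic_jet_zero])
  have "bd_add \<Omega> X (trace_class \<Omega> (\<lambda>z. -1 * f z)) = bd_zero \<Omega>"
    unfolding Xf bd_zero_eq bd_add_trace_class[OF F harmonic_jet_scale[OF F]] by simp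
  then show "\<exists>Y\<in>H_half \<Omega>. bd_add \<Omega> X Y = bd_zero \<Omega>"
    using trace_class_in_H_half[OF harmonic_jet_scale[OF F]] by blast
  show "bd_scale \<Omega> (a + b) X = bd_add \<Omega> (bd_scale \<Omega> a X) (bd_scale \<Omega> b X)"
    by (simp add: Xf bd_scale_trace_class[OF F] bd_add_trace_class[OF aF bF] distrib_right)
  show "bd_scale \<Omega> a (bd_scale \<Omega> b X) = bd_scale \<Omega> (a * b) X"
    by (simp add: Xf bd_scale_trace_class[OF F] bd_scale_trace_class[OF bF] mult.assoc)
  show "bd_scale \<Omega> 1 X = X" by (simp add: Xf bd_scale_trace_class[OF F])
  show "0 \<le> H_half_inner \<Omega> X X" by (simp add: Xf H_half_inner_trace_class[OF F F])
  {
    assume "H_half_inner \<Omega> X X = 0"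
    then have "(LINT x|lborel. F x \<bullet> F x) = 0" by (simp add: Xf H_half_inner_trace_class[OF F F])
    then have "AE x in lborel. F x \<bullet> F x = 0"
      by (subst (asm) integral_nonneg_eq_0_iff_AE) (auto intro: jet_inner_integrable Fj)
    then have "AE x in lborel. F x = 0" by eventually_elim simp
    then have "has_boundary_trace \<Omega> (\<lambda>x. 0) f"
      by (rule has_boundary_trace_AE_cong[OF Fj jets_zero _ harmonic_jetD(2)[OF F]])
    then show "X = bd_zero \<Omega>"
      unfolding Xf bd_zero_eq by (rule trace_class_cong[OF has_boundary_trace_zero])
  }
  assume Y: "Y \<in> H_half \<Omega>"
  obtain G g where G: "harmonic_jet \<Omega> G g" and Yg: "Y = trace_class \<Omega> g" using Y by (rule H_half_cases)
  have Gj: "G \<in> jets \<Omega>" using G by (simp add: harmonic_jet_def)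
  note FG = harmonic_jet_add[OF F G]
  show "bd_add \<Omega> X Y \<in> H_half \<Omega>"
    unfolding Xf Yg bd_add_trace_class[OF F G] by (rule trace_class_in_H_half[OF FG])
  show "bd_add \<Omega> X Y = bd_add \<Omega> Y X"
    by (simp add: Xf Yg bd_add_trace_class[OF F G] bd_add_trace_class[OF G F] add.commute)
  show "bd_scale \<Omega> a (bd_add \<Omega> X Y) = bd_add \<Omega> (bd_scale \<Omega> a X) (bd_scale \<Omega> a Y)"
    by (simp add: Xf Yg bd_add_trace_class[OF F G] bd_scale_trace_class[OF F] bd_scale_trace_class[OF G]
        bd_scale_trace_class[OF FG] bd_add_trace_class[OF aF harmonic_jet_scale[OF G]] distrib_left)
  show "H_half_inner \<Omega> X Y = H_half_inner \<Omega> Y X"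
    by (simp add: Xf Yg H_half_inner_trace_class[OF F G] H_half_inner_trace_class[OF G F] inner_commute)
  show "H_half_inner \<Omega> (bd_scale \<Omega> a X) Y = a * H_half_inner \<Omega> X Y"
    by (simp add: Xf Yg bd_scale_trace_class[OF F] H_half_inner_trace_class[OF F G] H_half_inner_trace_class[OF aF G])
  assume Z: "Z \<in> H_half \<Omega>"
  obtain H h where H: "harmonic_jet \<Omega> H h" and Zh: "Z = trace_class \<Omega> h" using Z by (rule H_half_cases)
  have Hj: "H \<in> jets \<Omega>" using H by (simp add: harmonic_jet_def)
  note GH = harmonic_jet_add[OF G H]
  show "bd_add \<Omega> (bd_add \<Omega> X Y) Z = bd_add \<Omega> X (bd_add \<Omega> Y Z)"
    by (simp add: Xf Yg Zh bd_add_trace_class[OF F G] bd_add_trace_class[OF G H]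
        bd_add_trace_class[OF FG H] bd_add_trace_class[OF F GH] add.assoc)
  show "H_half_inner \<Omega> (bd_add \<Omega> X Y) Z = H_half_inner \<Omega> X Z + H_half_inner \<Omega> Y Z"
    using jet_inner_integrable[OF Fj Hj] jet_inner_integrable[OF Gj Hj]
    by (simp add: Xf Yg Zh bd_add_trace_class[OF F G] H_half_inner_trace_class[OF FG H]
        H_half_inner_trace_class[OF F H] H_half_inner_trace_class[OF G H] inner_add_left)
next
  show "bd_zero \<Omega> \<in> H_half \<Omega>"
    unfolding bd_zero_eq by (rule trace_class_in_H_half[OF harmonic_jet_zero])
qed

text \<open>Distances of traces are \<open>L\<^sup>2\<close> distances of their harmonic jets. A Cauchy sequence of traces
  thus comes from a convergent sequence of harmonic jets, whose limit has a trace and is again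
  harmonic.\<close>

theorem H_half_hilbert_space:
  "real_hilbert_space_on (H_half \<Omega>) (bd_add \<Omega>) (bd_zero \<Omega>) (bd_scale \<Omega>) (H_half_inner \<Omega>)"
proof -
  interpret real_inner_product_space_on "H_half \<Omega>" "bd_add \<Omega>" "bd_zero \<Omega>" "bd_scale \<Omega>" "H_half_inner \<Omega>"
    by (rule H_half_inner_product_space)
  have dist: "ip_dist (trace_class \<Omega> f) (trace_class \<Omega> g) = sqrt (LINT x|lborel. (norm (F x - G x))\<^sup>2)"
    if F: "harmonic_jet \<Omega> F f" and G: "harmonic_jet \<Omega> G g" for F G f g
  proof -
    note G' = harmonic_jet_scale[OF G, of "-1"]
    note FG = harmonic_jet_add[OF F G']
    show ?thesis
      unfolding ip_dist_def bd_scale_trace_class[OF G] bd_add_trace_class[OF F G'] H_half_inner_trace_class[OF FG FG]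
      by (simp add: power2_norm_eq_inner)
  qed
  show ?thesis
  proof unfold_locales
    fix X :: "nat \<Rightarrow> ('a \<Rightarrow> real) set"
    assume X: "\<And>n. X n \<in> H_half \<Omega>"
      and Cauchy: "\<And>e. 0 < e \<Longrightarrow> \<exists>N. \<forall>m\<ge>N. \<forall>n\<ge>N. ip_dist (X m) (X n) < e"
    have "\<forall>n. \<exists>F g. harmonic_jet \<Omega> F g \<and> X n = trace_class \<Omega> g" using X H_half_iff by blast
    then obtain F g where F: "\<And>n. harmonic_jet \<Omega> (F n) (g n)" and Xg: "\<And>n. X n = trace_class \<Omega> (g n)"
      by metis
    have Fj: "F n \<in> jets \<Omega>" "has_boundary_trace \<Omega> (F n) (g n)" for n
      by (rule harmonic_jetD(1,2)[OF F])+
    have sq_Cauchy: "\<exists>N. \<forall>m\<ge>N. \<forall>n\<ge>N. (LINT x|lborel. (norm (F m x - F n x))\<^sup>2) < e" if "0 < e" for e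
      using Cauchy[of "sqrt e"] that unfolding Xg dist[OF F F] real_sqrt_less_iff by simp
    obtain G and r :: "nat \<Rightarrow> nat" where G: "G \<in> jets \<Omega>" "has_boundary_trace \<Omega> G (\<lambda>z. lim (\<lambda>k. g (r k) z))"
      and lim: "(\<lambda>n. LINT x|lborel. (norm (F n x - G x))\<^sup>2) \<longlonglongrightarrow> 0"
      by (rule jets_with_trace_complete[OF Fj sq_Cauchy]) (assumption, blast)
    have "(LINT x|lborel. snd (G x) \<bullet> snd (N x)) = 0"
      if N: "N \<in> jets \<Omega>" "has_boundary_trace \<Omega> N (\<lambda>z. 0)" for N
    proof -
      have "(LINT x|lborel. snd (F n x) \<bullet> snd (N x)) = 0" for n
        using F[of n] N by (simp add: harmonic_jet_def)
      then show ?thesis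
        using tendsto_gradient_inner[OF Fj(1) G(1) N(1) lim] by (simp add: LIMSEQ_const_iff)
    qed
    then have harm: "harmonic_jet \<Omega> G (\<lambda>z. lim (\<lambda>k. g (r k) z))" using G by (simp add: harmonic_jet_def)
    have "(\<lambda>n. ip_dist (X n) (trace_class \<Omega> (\<lambda>z. lim (\<lambda>k. g (r k) z)))) \<longlonglongrightarrow> sqrt 0"
      unfolding Xg dist[OF F harm] by (rule tendsto_real_sqrt[OF lim])
    then show "\<exists>x\<in>H_half \<Omega>. (\<lambda>n. ip_dist (X n) x) \<longlonglongrightarrow> 0"
      using trace_class_in_H_half[OF harm] by auto
  qed
qed

end

theorem corollary3p12:
  fixes \<Omega> :: "'a::euclidean_space set"
  assumes "open \<Omega>" and "bounded \<Omega>"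
  shows "(\<forall>G\<in>H_half \<Omega>. \<exists>!U. is_harmonic_lifting \<Omega> G U) \<and>
    real_hilbert_space_on (H_half \<Omega>) (bd_add \<Omega>) (bd_zero \<Omega>) (bd_scale \<Omega>) (H_half_inner \<Omega>)"
proof -
  interpret bounded_domain \<Omega> using assms by unfold_locales
  have "\<exists>!U. is_harmonic_lifting \<Omega> G U" if mem: "G \<in> H_half \<Omega>" for G
  proof -
    obtain F g where F: "harmonic_jet \<Omega> F g" and G: "G = trace_class \<Omega> g"
      using mem by (rule H_half_cases)
    show ?thesis unfolding G harmonic_jet_lifting[OF F] by simp
  qed
  then show ?thesis using H_half_hilbert_space by blast
qed

end
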